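(* Let $c$ and $d$ be positive integers. The boundary quotient $\mathcal{Q}(BS(c,d)^+)$ is the universal $C^*$-algebra generated by a unitary $s$ and isometries $t_1,\dots,t_d$ satisfying (1) $\sum_{i=1}^d t_it_i^*=1$; (2) $st_i=t_{i+1}$ for $1\le i<d$; and (3) $st_d=t_1s^c$. Moreover, $\mathcal{Q}(BS(c,d)^+)$ is isomorphic to Spielberg's category of paths algebra $C^*(\Lambda)$, where $\Lambda=BS(c,d)^+$.
   Context: $BS(c,d)$ is the Baumslag--Solitar group $\langle a,b\mid ab^c=b^da\rangle$, and $BS(c,d)^+$ is the subsemigroup (with identity) generated by $a$ and $b$. Boundary quotient: let $P=BS(c,d)^+$; it is left cancellative and a right LCM semigroup (any two elements $p,q$ with a right common multiple, i.e. $pP\cap qP\ne\varnothing$, satisfy $pP\cap qP=rP$ for some $r$). For $X\subseteq P$ and $p\in P$ put $pX=\{px:x\in X\}$. Let $\mathcal{J}(P)=\{pP:p\in P\}\cup\{\varnothing\}$. A subset $F\subseteq P$ is a foundation set if it is finite and for each $p\in P$ there exists $q\in F$ with $pP\cap qP\neq\varnothing$. $\mathcal{Q}(P)$ is the universal $C^*$-algebra generated by isometries $\{v_p:p\in P\}$ and projections $\{e_X:X\in\mathcal{J}(P)\}$ satisfying $v_pv_q=v_{pq}$; $v_pe_Xv_p^*=e_{pX}$; $e_P=1$, $e_\varnothing=0$; $e_Xe_Y=e_{X\cap Y}$ for all $p,q\in P$, $X,Y\in\mathcal{J}(P)$; and $\prod_{p\in F}(1-e_{pP})=0$ for all foundation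 sets $F\subseteq P$. Category of paths algebra: a category of paths is a small category $\Lambda$ that is left and right cancellative and has no inverses (if $\alpha\beta$ is an identity then $\alpha$ and $\beta$ are identities). $BS(c,d)^+$ is regarded as a category of paths with one object. It is finitely aligned: for $\alpha,\beta\in\Lambda$ there is a finite set $\alpha\vee\beta$ of minimal common extensions with $\alpha\Lambda\cap\beta\Lambda=\bigcup_{\gamma\in\alpha\vee\beta}\gamma\Lambda$. For a countable finitely aligned category of paths $\Lambda$ with range and source maps $r,s$, the $C^*$-algebra $C^*(\Lambda)$ is the universal $C^*$-algebra generated by elements $\{T_\alpha:\alpha\in\Lambda\}$ subject to: $T_\alpha^*T_\alpha=T_{s(\alpha)}$; $T_\alpha T_\beta=T_{\alpha\beta}$ if $s(\alpha)=r(\beta)$; $T_\alpha T_\alpha^*T_\beta T_\beta^*=\bigvee_{\gamma\in\alpha\vee\beta}T_\gamma T_\gamma^*$; and $T_v=\bigvee_{\beta\in B}T_\beta T_\beta^*$ for every object $v$ and every finite exhaustive set $B\subseteq v\Lambda$, where $B$ is exhaustive at $v$ if for every $\alpha\in v\Lambda$ there is $\beta\in B$ with $\alpha\Lambda\cap\beta\Lambda\neq\varnothing$. *)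

theory Defs
  imports Complex_Main "HOL-Algebra.Ring" "HOL-Algebra.Coset" "HOL-Library.Poly_Mapping"
begin

text \<open>
  C*-algebras are not assumed to be unital: the field \<open>one\<close> is unconstrained by the locale
  below, and a unital C*-algebra is one that in addition satisfies \<open>monoid A\<close>.
\<close>

record 'a cstar = "'a ring" +
  scale :: "complex \<Rightarrow> 'a \<Rightarrow> 'a"
  star :: "'a \<Rightarrow> 'a"
  nrm :: "'a \<Rightarrow> real"

locale cstar_algebra = abelian_group A for A :: "('a, 'm) cstar_scheme" (structure) +
  assumes mult_closed: "x \<in> carrier A \<Longrightarrow> y \<in> carrier A \<Longrightarrow> x \<otimes> y \<in> carrier A"
    and mult_assoc: "x \<in> carrier A \<Longrightarrow> y \<in> carrier A \<Longrightarrow> z \<in> carrier A \<Longrightarrow>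
      (x \<otimes> y) \<otimes> z = x \<otimes> (y \<otimes> z)"
    and distrib_right: "x \<in> carrier A \<Longrightarrow> y \<in> carrier A \<Longrightarrow> z \<in> carrier A \<Longrightarrow>
      (x \<oplus> y) \<otimes> z = (x \<otimes> z) \<oplus> (y \<otimes> z)"
    and distrib_left: "x \<in> carrier A \<Longrightarrow> y \<in> carrier A \<Longrightarrow> z \<in> carrier A \<Longrightarrow>
      z \<otimes> (x \<oplus> y) = (z \<otimes> x) \<oplus> (z \<otimes> y)"
    and scale_closed: "x \<in> carrier A \<Longrightarrow> scale A k x \<in> carrier A"
    and scale_add_right: "x \<in> carrier A \<Longrightarrow> y \<in> carrier A \<Longrightarrow>
      scale A k (x \<oplus> y) = scale A k x \<oplus> scale A k y"
    and scale_add_left: "x \<in> carrier A \<Longrightarrow> scale A (k + l) x = scale A k x \<oplus> scale A l x"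
    and scale_scale: "x \<in> carrier A \<Longrightarrow> scale A k (scale A l x) = scale A (k * l) x"
    and scale_one: "x \<in> carrier A \<Longrightarrow> scale A 1 x = x"
    and scale_mult_left: "x \<in> carrier A \<Longrightarrow> y \<in> carrier A \<Longrightarrow>
      scale A k x \<otimes> y = scale A k (x \<otimes> y)"
    and scale_mult_right: "x \<in> carrier A \<Longrightarrow> y \<in> carrier A \<Longrightarrow>
      x \<otimes> scale A k y = scale A k (x \<otimes> y)"
    and star_closed: "x \<in> carrier A \<Longrightarrow> star A x \<in> carrier A"
    and star_star: "x \<in> carrier A \<Longrightarrow> star A (star A x) = x"
    and star_add: "x \<in> carrier A \<Longrightarrow> y \<in> carrier A \<Longrightarrow>
      star A (x \<oplus> y) = star A x \<oplus> star A y"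
    and star_scale: "x \<in> carrier A \<Longrightarrow> star A (scale A k x) = scale A (cnj k) (star A x)"
    and star_mult: "x \<in> carrier A \<Longrightarrow> y \<in> carrier A \<Longrightarrow>
      star A (x \<otimes> y) = star A y \<otimes> star A x"
    and nrm_eq_0: "x \<in> carrier A \<Longrightarrow> nrm A x = 0 \<longleftrightarrow> x = \<zero>"
    and nrm_nonneg: "x \<in> carrier A \<Longrightarrow> 0 \<le> nrm A x"
    and nrm_triangle: "x \<in> carrier A \<Longrightarrow> y \<in> carrier A \<Longrightarrow>
      nrm A (x \<oplus> y) \<le> nrm A x + nrm A y"
    and nrm_scale: "x \<in> carrier A \<Longrightarrow> nrm A (scale A k x) = cmod k * nrm A x"
    and nrm_mult: "x \<in> carrier A \<Longrightarrow> y \<in> carrier A \<Longrightarrow>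
      nrm A (x \<otimes> y) \<le> nrm A x * nrm A y"
    and nrm_cstar: "x \<in> carrier A \<Longrightarrow> nrm A (star A x \<otimes> x) = (nrm A x)\<^sup>2"
    and complete: "(\<And>n. X n \<in> carrier A) \<Longrightarrow>
      (\<And>e. 0 < e \<Longrightarrow> \<exists>M. \<forall>m\<ge>M. \<forall>n\<ge>M. nrm A (X m \<ominus> X n) < e) \<Longrightarrow>
      \<exists>x\<in>carrier A. (\<lambda>n. nrm A (X n \<ominus> x)) \<longlonglongrightarrow> 0"

definition isometry :: "('a, 'm) cstar_scheme \<Rightarrow> 'a \<Rightarrow> bool" where
  "isometry A x \<longleftrightarrow> x \<in> carrier A \<and> star A x \<otimes>\<^bsub>A\<^esub> x = \<one>\<^bsub>A\<^esub>"

definition unitary :: "('a, 'm) cstar_scheme \<Rightarrow> 'a \<Rightarrow> bool" where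
  "unitary A x \<longleftrightarrow>
     x \<in> carrier A \<and> star A x \<otimes>\<^bsub>A\<^esub> x = \<one>\<^bsub>A\<^esub> \<and> x \<otimes>\<^bsub>A\<^esub> star A x = \<one>\<^bsub>A\<^esub>"

definition projection :: "('a, 'm) cstar_scheme \<Rightarrow> 'a \<Rightarrow> bool" where
  "projection A x \<longleftrightarrow> x \<in> carrier A \<and> x \<otimes>\<^bsub>A\<^esub> x = x \<and> star A x = x"

definition proj_le :: "('a, 'm) cstar_scheme \<Rightarrow> 'a \<Rightarrow> 'a \<Rightarrow> bool" where
  "proj_le A p q \<longleftrightarrow> p \<otimes>\<^bsub>A\<^esub> q = p"

definition is_join :: "('a, 'm) cstar_scheme \<Rightarrow> 'a set \<Rightarrow> 'a \<Rightarrow> bool" where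
  "is_join A S p \<longleftrightarrow> projection A p \<and> (\<forall>q\<in>S. projection A q \<and> proj_le A q p) \<and>
     (\<forall>r. projection A r \<and> (\<forall>q\<in>S. proj_le A q r) \<longrightarrow> proj_le A p r)"

definition star_hom :: "('a, 'm) cstar_scheme \<Rightarrow> ('b, 'n) cstar_scheme \<Rightarrow> ('a \<Rightarrow> 'b) set" where
  "star_hom A B = {\<phi> \<in> carrier A \<rightarrow> carrier B.
     (\<forall>x\<in>carrier A. \<forall>y\<in>carrier A. \<phi> (x \<oplus>\<^bsub>A\<^esub> y) = \<phi> x \<oplus>\<^bsub>B\<^esub> \<phi> y) \<and>
     (\<forall>x\<in>carrier A. \<forall>y\<in>carrier A. \<phi> (x \<otimes>\<^bsub>A\<^esub> y) = \<phi> x \<otimes>\<^bsub>B\<^esub> \<phi> y) \<and>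
     (\<forall>k. \<forall>x\<in>carrier A. \<phi> (scale A k x) = scale B k (\<phi> x)) \<and>
     (\<forall>x\<in>carrier A. \<phi> (star A x) = star B (\<phi> x))}"

definition cstar_isomorphic :: "('a, 'm) cstar_scheme \<Rightarrow> ('b, 'n) cstar_scheme \<Rightarrow> bool" where
  "cstar_isomorphic A B \<longleftrightarrow> (\<exists>\<phi>\<in>star_hom A B. bij_betw \<phi> (carrier A) (carrier B))"

definition cstar_subalgebra :: "'a set \<Rightarrow> ('a, 'm) cstar_scheme \<Rightarrow> bool" where
  "cstar_subalgebra H A \<longleftrightarrow> H \<subseteq> carrier A \<and> \<zero>\<^bsub>A\<^esub> \<in> H \<and>
     (\<forall>x\<in>H. \<forall>y\<in>H. x \<oplus>\<^bsub>A\<^esub> y \<in> H \<and> x \<otimes>\<^bsub>A\<^esub> y \<in> H) \<and>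
     (\<forall>k. \<forall>x\<in>H. scale A k x \<in> H) \<and> (\<forall>x\<in>H. star A x \<in> H) \<and>
     (\<forall>X. \<forall>x\<in>carrier A. (\<forall>n. X n \<in> H) \<and> (\<lambda>n. nrm A (X n \<ominus>\<^bsub>A\<^esub> x)) \<longlonglongrightarrow> 0 \<longrightarrow> x \<in> H)"

definition generates_cstar :: "'a set \<Rightarrow> ('a, 'm) cstar_scheme \<Rightarrow> bool" where
  "generates_cstar S A \<longleftrightarrow> S \<subseteq> carrier A \<and>
     (\<forall>H. cstar_subalgebra H A \<and> S \<subseteq> H \<longrightarrow> H = carrier A)"

text \<open>
  The letter \<open>(g, False)\<close> stands for the generator \<open>g\<close> and \<open>(g, True)\<close> for its adjoint.
  The finitely supported functions on words form the free unital *-algebra, with convolution as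
  the multiplication of \<^type>\<open>poly_mapping\<close>; those supported on nonempty words form the
  free *-algebra without unit.
\<close>

datatype 'g star_word = Word (letters: "('g \<times> bool) list")

instantiation star_word :: (type) monoid_add
begin
definition "0 = Word []"
definition "u + v = Word (letters u @ letters v)"
instance by standard (simp_all add: zero_star_word_def plus_star_word_def)
end

type_synonym 'g star_poly = "'g star_word \<Rightarrow>\<^sub>0 complex"

definition word_adj :: "'g star_word \<Rightarrow> 'g star_word" where
  "word_adj w = Word (rev (map (apsnd Not) (letters w)))"

definition poly_gen :: "'g \<Rightarrow> 'g star_poly" where
  "poly_gen g = Poly_Mapping.single (Word [(g, False)]) 1"

definition poly_scale :: "complex \<Rightarrow> 'g star_poly \<Rightarrow> 'g star_poly" where
  "poly_scale k x = Poly_Mapping.map ((*) k) x"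

definition poly_star :: "'g star_poly \<Rightarrow> 'g star_poly" where
  "poly_star x = Poly_Mapping.map cnj (Poly_Mapping.map_key word_adj x)"

definition free_star_algebra :: "'g set \<Rightarrow> 'g star_poly set" where
  "free_star_algebra G =
     {x. \<forall>w\<in>Poly_Mapping.keys x. letters w \<noteq> [] \<and> fst ` set (letters w) \<subseteq> G}"

definition cstar_seminorm :: "'g set \<Rightarrow> ('g star_poly \<Rightarrow> real) \<Rightarrow> bool" where
  "cstar_seminorm G p \<longleftrightarrow>
     (\<forall>x\<in>free_star_algebra G. 0 \<le> p x \<and> p (poly_star x * x) = (p x)\<^sup>2 \<and>
       (\<forall>k. p (poly_scale k x) = cmod k * p x) \<and>
       (\<forall>y\<in>free_star_algebra G. p (x + y) \<le> p x + p y \<and> p (x * y) \<le> p x * p y))"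

definition cauchy_seqs :: "'g set \<Rightarrow> ('g star_poly \<Rightarrow> real) \<Rightarrow> (nat \<Rightarrow> 'g star_poly) set" where
  "cauchy_seqs G p = {x. (\<forall>n. x n \<in> free_star_algebra G) \<and>
     (\<forall>e>0. \<exists>M. \<forall>m\<ge>M. \<forall>n\<ge>M. p (x m - x n) < e)}"

definition null_rel :: "'g set \<Rightarrow> ('g star_poly \<Rightarrow> real) \<Rightarrow>
    ((nat \<Rightarrow> 'g star_poly) \<times> (nat \<Rightarrow> 'g star_poly)) set" where
  "null_rel G p = {(x, y). x \<in> cauchy_seqs G p \<and> y \<in> cauchy_seqs G p \<and>
     (\<lambda>n. p (x n - y n)) \<longlonglongrightarrow> 0}"

definition completion_mult :: "'g set \<Rightarrow> ('g star_poly \<Rightarrow> real) \<Rightarrow>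
    (nat \<Rightarrow> 'g star_poly) set \<Rightarrow> (nat \<Rightarrow> 'g star_poly) set \<Rightarrow> (nat \<Rightarrow> 'g star_poly) set" where
  "completion_mult G p X Y = (\<Union>x\<in>X. \<Union>y\<in>Y. null_rel G p `` {\<lambda>n. x n * y n})"

text \<open>
  The separated completion for the seminorm \<open>p\<close>: Cauchy sequences modulo null sequences. Its
  field \<open>one\<close> is the identity element when there is one, and is unspecified otherwise.
\<close>

definition completion :: "'g set \<Rightarrow> ('g star_poly \<Rightarrow> real) \<Rightarrow> (nat \<Rightarrow> 'g star_poly) set cstar" where
  "completion G p = \<lparr>
     carrier = cauchy_seqs G p // null_rel G p,
     mult = completion_mult G p,
     one = (THE E. E \<in> cauchy_seqs G p // null_rel G p \<and>
       (\<forall>X\<in>cauchy_seqs G p // null_rel G p.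
          completion_mult G p E X = X \<and> completion_mult G p X E = X)),
     zero = null_rel G p `` {\<lambda>n. 0},
     add = (\<lambda>X Y. \<Union>x\<in>X. \<Union>y\<in>Y. null_rel G p `` {\<lambda>n. x n + y n}),
     scale = (\<lambda>k X. \<Union>x\<in>X. null_rel G p `` {\<lambda>n. poly_scale k (x n)}),
     star = (\<lambda>X. \<Union>x\<in>X. null_rel G p `` {\<lambda>n. poly_star (x n)}),
     nrm = (\<lambda>X. THE r. \<exists>x\<in>X. (\<lambda>n. p (x n)) \<longlonglongrightarrow> r)\<rparr>"

definition completion_gen :: "'g set \<Rightarrow> ('g star_poly \<Rightarrow> real) \<Rightarrow> 'g \<Rightarrow> (nat \<Rightarrow> 'g star_poly) set" where
  "completion_gen G p g = null_rel G p `` {\<lambda>n. poly_gen g}"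

text \<open>
  Relations are given by a predicate \<open>R A g\<close> saying that the family \<open>g\<close> satisfies them in the
  C*-algebra \<open>A\<close>. A family satisfying the relations in some C*-algebra induces a C*-seminorm on
  the free *-algebra, and the C*-algebra it generates is the completion for that seminorm. So
  the universal norm is the supremum over the C*-seminorms in whose completion the canonical
  generators satisfy the relations; no quantification over all C*-algebras is needed. The
  supremum is meaningful only when the relations bound the norms of the generators, as those
  below do.
\<close>

type_synonym 'g relations =
  "(nat \<Rightarrow> 'g star_poly) set cstar \<Rightarrow> ('g \<Rightarrow> (nat \<Rightarrow> 'g star_poly) set) \<Rightarrow> bool"

definition universal_norm :: "'g set \<Rightarrow> 'g relations \<Rightarrow> 'g star_poly \<Rightarrow> real" where
  "universal_norm G R x =
     (SUP p\<in>{p. cstar_seminorm G p \<and> R (completion G p) (completion_gen G p)}. p x)"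

definition universal_cstar ::
    "'g set \<Rightarrow> 'g relations \<Rightarrow> (nat \<Rightarrow> 'g star_poly) set cstar" where
  "universal_cstar G R = completion G (universal_norm G R)"

definition principal_ideals :: "('p, 'm) monoid_scheme \<Rightarrow> 'p set set" where
  "principal_ideals P = {p <#\<^bsub>P\<^esub> carrier P | p. p \<in> carrier P} \<union> {{}}"

definition foundation_set :: "('p, 'm) monoid_scheme \<Rightarrow> 'p set \<Rightarrow> bool" where
  "foundation_set P F \<longleftrightarrow> F \<subseteq> carrier P \<and> finite F \<and>
     (\<forall>p\<in>carrier P. \<exists>q\<in>F. (p <#\<^bsub>P\<^esub> carrier P) \<inter> (q <#\<^bsub>P\<^esub> carrier P) \<noteq> {})"

datatype 'p boundary_gen = V 'p | E "'p set"

definition boundary_gens :: "('p, 'm) monoid_scheme \<Rightarrow> 'p boundary_gen set" where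
  "boundary_gens P = V ` carrier P \<union> E ` principal_ideals P"

text \<open>
  The factors of the product over a foundation set commute; the product is taken along an
  arbitrary enumeration \<open>ps\<close> of the set.
\<close>

definition boundary_relations ::
    "('p, 'm) monoid_scheme \<Rightarrow> ('a, 'n) cstar_scheme \<Rightarrow> ('p boundary_gen \<Rightarrow> 'a) \<Rightarrow> bool" where
  "boundary_relations P A g \<longleftrightarrow> monoid A \<and>
     (\<forall>p\<in>carrier P. isometry A (g (V p))) \<and>
     (\<forall>X\<in>principal_ideals P. projection A (g (E X))) \<and>
     (\<forall>p\<in>carrier P. \<forall>q\<in>carrier P. g (V p) \<otimes>\<^bsub>A\<^esub> g (V q) = g (V (p \<otimes>\<^bsub>P\<^esub> q))) \<and>
     (\<forall>p\<in>carrier P. \<forall>X\<in>principal_ideals P.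
        g (V p) \<otimes>\<^bsub>A\<^esub> g (E X) \<otimes>\<^bsub>A\<^esub> star A (g (V p)) = g (E (p <#\<^bsub>P\<^esub> X))) \<and>
     g (E (carrier P)) = \<one>\<^bsub>A\<^esub> \<and> g (E {}) = \<zero>\<^bsub>A\<^esub> \<and>
     (\<forall>X\<in>principal_ideals P. \<forall>Y\<in>principal_ideals P.
        g (E X) \<otimes>\<^bsub>A\<^esub> g (E Y) = g (E (X \<inter> Y))) \<and>
     (\<forall>ps. distinct ps \<and> foundation_set P (set ps) \<longrightarrow>
        foldr (\<lambda>p x. (\<one>\<^bsub>A\<^esub> \<ominus>\<^bsub>A\<^esub> g (E (p <#\<^bsub>P\<^esub> carrier P))) \<otimes>\<^bsub>A\<^esub> x) ps \<one>\<^bsub>A\<^esub> = \<zero>\<^bsub>A\<^esub>)"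

definition boundary_quotient ::
    "('p, 'm) monoid_scheme \<Rightarrow> (nat \<Rightarrow> 'p boundary_gen star_poly) set cstar" where
  "boundary_quotient P = universal_cstar (boundary_gens P) (boundary_relations P)"

text \<open>
  Objects are identified with their identity morphisms. The composite \<open>\<alpha>\<beta>\<close> is defined when
  the source of \<open>\<alpha>\<close> is the range of \<open>\<beta>\<close>.
\<close>

record 'm path_category =
  Mor :: "'m set"
  rng :: "'m \<Rightarrow> 'm"
  src :: "'m \<Rightarrow> 'm"
  cmp :: "'m \<Rightarrow> 'm \<Rightarrow> 'm"

definition objects :: "'m path_category \<Rightarrow> 'm set" where
  "objects L = src L ` Mor L"

definition extensions :: "'m path_category \<Rightarrow> 'm \<Rightarrow> 'm set" where
  "extensions L \<alpha> = {cmp L \<alpha> \<beta> | \<beta>. \<beta> \<in> Mor L \<and> rng L \<beta> = src L \<alpha>}"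

definition min_common_ext :: "'m path_category \<Rightarrow> 'm \<Rightarrow> 'm \<Rightarrow> 'm set" where
  "min_common_ext L \<alpha> \<beta> = {\<gamma> \<in> extensions L \<alpha> \<inter> extensions L \<beta>.
     \<forall>\<delta>\<in>extensions L \<alpha> \<inter> extensions L \<beta>. \<gamma> \<in> extensions L \<delta> \<longrightarrow> \<delta> = \<gamma>}"

definition exhaustive :: "'m path_category \<Rightarrow> 'm \<Rightarrow> 'm set \<Rightarrow> bool" where
  "exhaustive L v B \<longleftrightarrow> B \<subseteq> extensions L v \<and>
     (\<forall>\<alpha>\<in>extensions L v. \<exists>\<beta>\<in>B. extensions L \<alpha> \<inter> extensions L \<beta> \<noteq> {})"

definition path_relations ::
    "'m path_category \<Rightarrow> ('a, 'n) cstar_scheme \<Rightarrow> ('m \<Rightarrow> 'a) \<Rightarrow> bool" where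
  "path_relations L A T \<longleftrightarrow> T ` Mor L \<subseteq> carrier A \<and>
     (\<forall>\<alpha>\<in>Mor L. star A (T \<alpha>) \<otimes>\<^bsub>A\<^esub> T \<alpha> = T (src L \<alpha>)) \<and>
     (\<forall>\<alpha>\<in>Mor L. \<forall>\<beta>\<in>Mor L. src L \<alpha> = rng L \<beta> \<longrightarrow> T \<alpha> \<otimes>\<^bsub>A\<^esub> T \<beta> = T (cmp L \<alpha> \<beta>)) \<and>
     (\<forall>\<alpha>\<in>Mor L. \<forall>\<beta>\<in>Mor L.
        is_join A ((\<lambda>\<gamma>. T \<gamma> \<otimes>\<^bsub>A\<^esub> star A (T \<gamma>)) ` min_common_ext L \<alpha> \<beta>)
          (T \<alpha> \<otimes>\<^bsub>A\<^esub> star A (T \<alpha>) \<otimes>\<^bsub>A\<^esub> (T \<beta> \<otimes>\<^bsub>A\<^esub> star A (T \<beta>)))) \<and>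
     (\<forall>v\<in>objects L. \<forall>B. finite B \<and> exhaustive L v B \<longrightarrow>
        is_join A ((\<lambda>\<beta>. T \<beta> \<otimes>\<^bsub>A\<^esub> star A (T \<beta>)) ` B) (T v))"

definition path_cstar :: "'m path_category \<Rightarrow> (nat \<Rightarrow> 'm star_poly) set cstar" where
  "path_cstar L = universal_cstar (Mor L) (path_relations L)"

definition monoid_category :: "('p, 'm) monoid_scheme \<Rightarrow> 'p path_category" where
  "monoid_category P = \<lparr>Mor = carrier P, rng = (\<lambda>_. \<one>\<^bsub>P\<^esub>), src = (\<lambda>_. \<one>\<^bsub>P\<^esub>), cmp = mult P\<rparr>"

text \<open>
  Group words: \<open>(x, False)\<close> stands for \<open>x\<close> and \<open>(x, True)\<close> for its inverse. For a set \<open>R\<close> of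
  defining equations between words, \<open>word_eq R\<close> is equality in the presented group.
\<close>

inductive word_eq :: "(('x \<times> bool) list \<times> ('x \<times> bool) list) set \<Rightarrow>
    ('x \<times> bool) list \<Rightarrow> ('x \<times> bool) list \<Rightarrow> bool" for R where
  relator: "(u, v) \<in> R \<Longrightarrow> word_eq R u v"
| cancel: "word_eq R [(x, e), (x, \<not> e)] []"
| refl: "word_eq R u u"
| sym: "word_eq R u v \<Longrightarrow> word_eq R v u"
| trans: "word_eq R u v \<Longrightarrow> word_eq R v w \<Longrightarrow> word_eq R u w"
| append: "word_eq R u v \<Longrightarrow> word_eq R u' v' \<Longrightarrow> word_eq R (u @ u') (v @ v')"

definition word_class :: "(('x \<times> bool) list \<times> ('x \<times> bool) list) set \<Rightarrow>
    ('x \<times> bool) list \<Rightarrow> ('x \<times> bool) list set" where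
  "word_class R u = {v. word_eq R u v}"

definition presented_group :: "(('x \<times> bool) list \<times> ('x \<times> bool) list) set \<Rightarrow>
    ('x \<times> bool) list set monoid" where
  "presented_group R = \<lparr>
     carrier = range (word_class R),
     mult = (\<lambda>X Y. \<Union>u\<in>X. \<Union>v\<in>Y. word_class R (u @ v)),
     one = word_class R []\<rparr>"

datatype bs_letter = La | Lb

definition bs_equations ::
    "nat \<Rightarrow> nat \<Rightarrow> ((bs_letter \<times> bool) list \<times> (bs_letter \<times> bool) list) set" where
  "bs_equations c d = {([(La, False)] @ replicate c (Lb, False),
                        replicate d (Lb, False) @ [(La, False)])}"

definition BS :: "nat \<Rightarrow> nat \<Rightarrow> (bs_letter \<times> bool) list set monoid" where
  "BS c d = presented_group (bs_equations c d)"

definition bs_a :: "nat \<Rightarrow> nat \<Rightarrow> (bs_letter \<times> bool) list set" where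
  "bs_a c d = word_class (bs_equations c d) [(La, False)]"

definition bs_b :: "nat \<Rightarrow> nat \<Rightarrow> (bs_letter \<times> bool) list set" where
  "bs_b c d = word_class (bs_equations c d) [(Lb, False)]"

definition BS_plus :: "nat \<Rightarrow> nat \<Rightarrow> (bs_letter \<times> bool) list set monoid" where
  "BS_plus c d = (BS c d)\<lparr>carrier :=
     \<Inter>{H. submonoid H (BS c d) \<and> bs_a c d \<in> H \<and> bs_b c d \<in> H}\<rparr>"

datatype st_gen = S | T nat

definition st_gens :: "nat \<Rightarrow> st_gen set" where
  "st_gens d = insert S (T ` {1..d})"

definition st_relations ::
    "nat \<Rightarrow> nat \<Rightarrow> ('a, 'n) cstar_scheme \<Rightarrow> (st_gen \<Rightarrow> 'a) \<Rightarrow> bool" where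
  "st_relations c d A g \<longleftrightarrow> monoid A \<and> unitary A (g S) \<and> (\<forall>i\<in>{1..d}. isometry A (g (T i))) \<and>
     (\<Oplus>\<^bsub>A\<^esub>i\<in>{1..d}. g (T i) \<otimes>\<^bsub>A\<^esub> star A (g (T i))) = \<one>\<^bsub>A\<^esub> \<and>
     (\<forall>i. 1 \<le> i \<and> i < d \<longrightarrow> g S \<otimes>\<^bsub>A\<^esub> g (T i) = g (T (i + 1))) \<and>
     g S \<otimes>\<^bsub>A\<^esub> g (T d) = g (T 1) \<otimes>\<^bsub>A\<^esub> (g S [^]\<^bsub>A\<^esub> c)"

end

theory Submission
  imports Defs
begin

text \<open>
  The proof compares relations inside arbitrary C*-algebras and lets universality do the rest.

  The monoid. Every element of \<open>P = BS(c,d)\<^sup>+\<close> is uniquely \<open>b\<^sup>i a b\<^sup>j a \<dots> a b\<^sup>n\<close> with digits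
  \<open>i, j, \<dots> < d\<close>, because \<open>b\<^sup>d a = a b\<^sup>c\<close> pushes multiples of \<open>d\<close> to the right. Existence is a rewriting
  argument that works in every monoid with two elements satisfying this relation (\<open>val_nf\<close>). Uniqueness needs the group: it acts on the reduced
  words of its HNN decomposition, and the action on the empty word reads off the digits
  (\<open>wact_word_eq\<close>, \<open>wact_pos\<close>). In these coordinates left multiplication by \<open>b\<close> is an adding machine, and
  two principal right ideals meet exactly when one digit string is a prefix of the other; then the
  intersection is again principal (\<open>ideal_inter_prefix\<close>).

  The relations. Put \<open>s = v\<^sub>b\<close> and let \<open>t\<^sub>i\<close> be \<open>v\<close> at \<open>b\<^sup>i\<^sup>-\<^sup>1 a\<close>. The sets \<open>{b}\<close> and \<open>{a, b a, \<dots>, b\<^sup>d\<^sup>-\<^sup>1 a}\<close>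
  are foundation sets and the ideals of the second one are disjoint, so \<open>s\<close> is unitary and the range
  projections of the \<open>t\<^sub>i\<close> sum to one (\<open>boundary_to_st\<close>). Conversely a solution \<open>(s, t\<^sub>i)\<close> defines \<open>v\<close> on
  positive words; the powers of \<open>s\<close> cancel in \<open>v\<^sub>p v\<^sub>p\<^sup>*\<close>, so that this projection depends only on the
  digits of \<open>p\<close>, and the relations of \<open>P\<close> reduce to those of a Cuntz family (\<open>vfam_path_unital\<close>). The one
  analytic point is that isometries with \<open>\<Sum> t\<^sub>i t\<^sub>i\<^sup>* = 1\<close> have orthogonal ranges. Instead of the theory
  of positive elements, its proof uses that the unit is an extreme point of the unit ball
  (\<open>isometries_orthogonal\<close>). The boundary relations and the path relations are equivalent for any
  monoid whose principal right ideals intersect in principal ones or not at all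
  (\<open>boundary_to_path\<close>, \<open>path_to_boundary\<close>): for commuting projections, a join equals one exactly when
  the product of the complements vanishes.

  The universal algebras. The completion of the free *-algebra for a C*-seminorm is a C*-algebra.
  The supremum of the admissible seminorms is admissible because each set of relations holds in an
  algebra as soon as it holds in the images under a jointly faithful family of homomorphisms. The
  same property, used for a single target \<open>B\<close>, shows that the norm pulled back from \<open>B\<close> is admissible,
  which is the universal property (\<open>universal_relations\<close>, \<open>universal_property\<close>). The homomorphisms so
  obtained are contractive by construction, so two of them agree if they agree on generators, and the
  isomorphisms follow by checking generators.
\<close>

section \<open>The free *-algebra\<close>

lemma letters_zero [simp]: "letters 0 = []"
  by (simp add: zero_star_word_def)

lemma letters_plus [simp]: "letters (u + v) = letters u @ letters v"
  by (simp add: plus_star_word_def)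

lemma word_adj_word_adj [simp]: "word_adj (word_adj w) = w"
  by (cases w) (simp add: word_adj_def rev_map apsnd_def map_prod_def case_prod_beta comp_def)

lemma word_adj_plus: "word_adj (u + v) = word_adj v + word_adj u"
  by (simp add: word_adj_def plus_star_word_def)

lemma inj_word_adj: "inj word_adj"
  by (metis injI word_adj_word_adj)

lemma lookup_poly_star: "Poly_Mapping.lookup (poly_star x) w = cnj (Poly_Mapping.lookup x (word_adj w))"
  by (simp add: poly_star_def Poly_Mapping.map.rep_eq map_key.rep_eq inj_word_adj when_def)

lemma lookup_poly_scale: "Poly_Mapping.lookup (poly_scale k x) w = k * Poly_Mapping.lookup x w"
  by (simp add: poly_scale_def Poly_Mapping.map.rep_eq when_def)

lemma poly_scale_eq: "poly_scale k x = Poly_Mapping.single 0 k * x"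
  by (simp add: poly_scale_def mult_map_scale_conv_mult)

lemma poly_star_single: "poly_star (Poly_Mapping.single w k) = Poly_Mapping.single (word_adj w) (cnj k)"
  by (rule poly_mapping_eqI) (auto simp: lookup_poly_star lookup_single when_def)

lemma poly_star_zero [simp]: "poly_star 0 = 0"
  by (rule poly_mapping_eqI) (simp add: lookup_poly_star)

lemma poly_star_add: "poly_star (x + y) = poly_star x + poly_star y"
  by (rule poly_mapping_eqI) (simp add: lookup_poly_star lookup_add)

lemma poly_star_minus: "poly_star (x - y) = poly_star x - poly_star y"
  by (rule poly_mapping_eqI) (simp add: lookup_poly_star lookup_minus)

lemma poly_star_star [simp]: "poly_star (poly_star x) = x"
  by (rule poly_mapping_eqI) (simp add: lookup_poly_star)

lemma poly_star_scale: "poly_star (poly_scale k x) = poly_scale (cnj k) (poly_star x)"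
  by (rule poly_mapping_eqI) (simp add: lookup_poly_star lookup_poly_scale)

lemma poly_scale_add: "poly_scale k (x + y) = poly_scale k x + poly_scale k y"
  by (simp add: poly_scale_eq distrib_left)

lemma poly_scale_add_left: "poly_scale (k + l) x = poly_scale k x + poly_scale l x"
  by (rule poly_mapping_eqI) (simp add: lookup_poly_scale lookup_add distrib_right)

lemma poly_scale_scale: "poly_scale k (poly_scale l x) = poly_scale (k * l) x"
  by (rule poly_mapping_eqI) (simp add: lookup_poly_scale)

lemma poly_scale_one: "poly_scale 1 x = x"
  by (rule poly_mapping_eqI) (simp add: lookup_poly_scale)

lemma poly_scale_diff: "poly_scale k (x - y) = poly_scale k x - poly_scale k y"
  by (simp add: poly_scale_eq right_diff_distrib)

lemma poly_scale_mult_left: "poly_scale k x * y = poly_scale k (x * y)"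
  by (simp add: poly_scale_eq mult.assoc)

lemma poly_scale_neg_one: "poly_scale (- 1) x = - x"
  by (rule poly_mapping_eqI) (simp add: lookup_poly_scale)

lemma poly_scale_zero [simp]: "poly_scale 0 x = 0"
  by (rule poly_mapping_eqI) (simp add: lookup_poly_scale)

lemma poly_eq_sum_single: "(\<Sum>w\<in>Poly_Mapping.keys x. Poly_Mapping.single w (Poly_Mapping.lookup x w)) = x"
proof (rule poly_mapping_eqI)
  fix v
  have "(\<Sum>w\<in>Poly_Mapping.keys x. Poly_Mapping.lookup x w when w = v) = Poly_Mapping.lookup x v"
    by (cases "v \<in> Poly_Mapping.keys x") (auto simp: when_def in_keys_iff sum.delta' cong: if_cong)
  thus "Poly_Mapping.lookup (\<Sum>w\<in>Poly_Mapping.keys x. Poly_Mapping.single w (Poly_Mapping.lookup x w)) v = Poly_Mapping.lookup x v"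
    by (simp add: lookup_sum lookup_single)
qed

lemma free_star_algebra_single:
  "\<lbrakk>letters w \<noteq> []; fst ` set (letters w) \<subseteq> G\<rbrakk> \<Longrightarrow> Poly_Mapping.single w k \<in> free_star_algebra G"
  by (auto simp: free_star_algebra_def)

lemma poly_induct [case_names zero single add]:
  assumes "P 0" and "\<And>w k. P (Poly_Mapping.single w k)"
    and "\<And>x y. P x \<Longrightarrow> P y \<Longrightarrow> P (x + y)"
  shows "P (x :: 'g star_poly)"
proof -
  have "finite F \<Longrightarrow> P (\<Sum>w\<in>F. Poly_Mapping.single w (Poly_Mapping.lookup x w))" for F
    by (induction F rule: finite_induct) (auto intro: assms)
  from this[of "Poly_Mapping.keys x"] show ?thesis by (simp add: poly_eq_sum_single)
qed

lemma poly_scale_mult_right: "x * poly_scale k y = poly_scale k (x * y)"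
proof -
  have "x * Poly_Mapping.single 0 k = Poly_Mapping.single 0 k * x"
    by (induction x rule: poly_induct) (simp_all add: mult_single algebra_simps)
  thus ?thesis by (simp add: poly_scale_eq flip: mult.assoc)
qed

lemma poly_star_mult: "poly_star (x * y) = poly_star y * poly_star x"
proof (induction x rule: poly_induct)
  case (single w k)
  show ?case
    by (induction y rule: poly_induct)
      (simp_all add: mult_single poly_star_single poly_star_add word_adj_plus algebra_simps)
qed (simp_all add: poly_star_add algebra_simps)

lemma free_star_algebra_zero [simp]: "0 \<in> free_star_algebra G"
  by (simp add: free_star_algebra_def)

lemma free_star_algebra_gen: "g \<in> G \<Longrightarrow> poly_gen g \<in> free_star_algebra G"
  by (simp add: poly_gen_def free_star_algebra_single)

lemma free_star_algebra_add:
  assumes "x \<in> free_star_algebra G" "y \<in> free_star_algebra G"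
  shows "x + y \<in> free_star_algebra G"
  using assms keys_add[of x y] unfolding free_star_algebra_def by blast

lemma free_star_algebra_scale:
  assumes "x \<in> free_star_algebra G"
  shows "poly_scale k x \<in> free_star_algebra G"
proof -
  have "Poly_Mapping.keys (poly_scale k x) \<subseteq> Poly_Mapping.keys x"
    by (auto simp: in_keys_iff lookup_poly_scale)
  thus ?thesis using assms unfolding free_star_algebra_def by blast
qed

lemma free_star_algebra_diff:
  assumes "x \<in> free_star_algebra G" "y \<in> free_star_algebra G"
  shows "x - y \<in> free_star_algebra G"
  using free_star_algebra_add[OF assms(1) free_star_algebra_scale[OF assms(2), of "-1"]]
  by (simp add: poly_scale_neg_one)

lemma free_star_algebra_mult:
  assumes "x \<in> free_star_algebra G" "y \<in> free_star_algebra G"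
  shows "x * y \<in> free_star_algebra G"
proof -
  have "letters w \<noteq> [] \<and> fst ` set (letters w) \<subseteq> G" if "w \<in> Poly_Mapping.keys (x * y)" for w
  proof -
    obtain u v where "u \<in> Poly_Mapping.keys x" "v \<in> Poly_Mapping.keys y" "w = u + v"
      using \<open>w \<in> Poly_Mapping.keys (x * y)\<close> keys_mult[of x y] by blast
    thus ?thesis using assms by (auto simp: free_star_algebra_def image_Un)
  qed
  thus ?thesis by (simp add: free_star_algebra_def)
qed

lemma free_star_algebra_star:
  assumes "x \<in> free_star_algebra G"
  shows "poly_star x \<in> free_star_algebra G"
proof -
  have "letters w \<noteq> [] \<and> fst ` set (letters w) \<subseteq> G" if "w \<in> Poly_Mapping.keys (poly_star x)" for w
  proof -
    have "word_adj w \<in> Poly_Mapping.keys x" using that by (auto simp: in_keys_iff lookup_poly_star)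
    hence "letters (word_adj w) \<noteq> [] \<and> fst ` set (letters (word_adj w)) \<subseteq> G"
      using assms by (auto simp: free_star_algebra_def)
    thus ?thesis by (auto simp: word_adj_def image_image)
  qed
  thus ?thesis by (simp add: free_star_algebra_def)
qed

lemmas free_star_algebra_closed = free_star_algebra_add free_star_algebra_scale
  free_star_algebra_diff free_star_algebra_mult free_star_algebra_star

lemma poly_single_snoc:
  "Poly_Mapping.single (Word (xs @ ys)) k =
     Poly_Mapping.single (Word xs) k * Poly_Mapping.single (Word ys) (1::complex)"
  by (simp add: mult_single plus_star_word_def)

text \<open>The generators really generate: this is what density arguments in completions reduce to.\<close>

lemma free_star_algebra_induct [consumes 1, case_names zero gen add mult scale star]:
  assumes "x \<in> free_star_algebra G"
    and zero: "P 0" and gen: "\<And>g. g \<in> G \<Longrightarrow> P (poly_gen g)"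
    and add: "\<And>x y. x \<in> free_star_algebra G \<Longrightarrow> y \<in> free_star_algebra G \<Longrightarrow> P x \<Longrightarrow> P y \<Longrightarrow> P (x + y)"
    and mult: "\<And>x y. x \<in> free_star_algebra G \<Longrightarrow> y \<in> free_star_algebra G \<Longrightarrow> P x \<Longrightarrow> P y \<Longrightarrow> P (x * y)"
    and scale: "\<And>k x. x \<in> free_star_algebra G \<Longrightarrow> P x \<Longrightarrow> P (poly_scale k x)"
    and star: "\<And>x. x \<in> free_star_algebra G \<Longrightarrow> P x \<Longrightarrow> P (poly_star x)"
  shows "P x"
proof -
  have letter: "P (Poly_Mapping.single (Word [(g, e)]) 1)" if "g \<in> G" for g e
  proof (cases e)
    case True
    have "Poly_Mapping.single (Word [(g, e)]) 1 = poly_star (poly_gen g)"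
      by (simp add: True poly_gen_def poly_star_single word_adj_def)
    thus ?thesis using star[OF free_star_algebra_gen gen] that by simp
  next
    case False
    thus ?thesis using gen that by (simp add: poly_gen_def)
  qed
  have word: "P (Poly_Mapping.single (Word (l # ls)) 1)" if "fst ` set (l # ls) \<subseteq> G" for l ls
    using that
  proof (induction ls arbitrary: l)
    case Nil
    thus ?case using letter[of "fst l" "snd l"] by simp
  next
    case (Cons m ls)
    have "P (Poly_Mapping.single (Word [l]) 1)" using letter[of "fst l" "snd l"] Cons.prems by simp
    moreover have "P (Poly_Mapping.single (Word (m # ls)) 1)" using Cons by auto
    moreover have "Poly_Mapping.single (Word (l # m # ls)) (1::complex) =
        Poly_Mapping.single (Word [l]) 1 * Poly_Mapping.single (Word (m # ls)) 1"
      using poly_single_snoc[of "[l]" "m # ls" 1] by simp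
    moreover have "Poly_Mapping.single (Word [l]) 1 \<in> free_star_algebra G"
      "Poly_Mapping.single (Word (m # ls)) 1 \<in> free_star_algebra G"
      using Cons.prems by (simp_all add: free_star_algebra_single)
    ultimately show ?case using mult by metis
  qed
  have monomial: "P (Poly_Mapping.single w k)" if w: "letters w \<noteq> []" "fst ` set (letters w) \<subseteq> G" for w k
  proof -
    obtain l ls where "letters w = l # ls" using w(1) by (cases "letters w") auto
    hence w': "w = Word (l # ls)" by (cases w) simp
    have "Poly_Mapping.single w k = poly_scale k (Poly_Mapping.single w 1)"
      by (rule poly_mapping_eqI) (simp add: lookup_poly_scale lookup_single when_def)
    moreover have "P (Poly_Mapping.single w 1)" using word[of l ls] w w' by simp
    ultimately show ?thesis using scale[OF free_star_algebra_single[OF w, of 1], of k] by simp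
  qed
  have "F \<subseteq> Poly_Mapping.keys x \<Longrightarrow> P (\<Sum>w\<in>F. Poly_Mapping.single w (Poly_Mapping.lookup x w)) \<and>
      (\<Sum>w\<in>F. Poly_Mapping.single w (Poly_Mapping.lookup x w)) \<in> free_star_algebra G" if "finite F" for F
    using that
  proof (induction F rule: finite_induct)
    case (insert w F)
    hence "letters w \<noteq> []" "fst ` set (letters w) \<subseteq> G"
      using assms(1) by (auto simp: free_star_algebra_def)
    thus ?case using insert by (auto intro!: add monomial free_star_algebra_add free_star_algebra_single)
  qed (simp add: zero)
  from this[of "Poly_Mapping.keys x"] show ?thesis by (simp add: poly_eq_sum_single)
qed

section \<open>The completion for a C*-seminorm\<close>

locale seminormed =
  fixes G :: "'g set" and p :: "'g star_poly \<Rightarrow> real"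
  assumes cstar_seminorm: "cstar_seminorm G p"
begin

abbreviation "F \<equiv> free_star_algebra G"

lemma p_nonneg: "x \<in> F \<Longrightarrow> 0 \<le> p x"
  and p_cstar: "x \<in> F \<Longrightarrow> p (poly_star x * x) = (p x)\<^sup>2"
  and p_scale: "x \<in> F \<Longrightarrow> p (poly_scale k x) = cmod k * p x"
  and p_add: "x \<in> F \<Longrightarrow> y \<in> F \<Longrightarrow> p (x + y) \<le> p x + p y"
  and p_mult: "x \<in> F \<Longrightarrow> y \<in> F \<Longrightarrow> p (x * y) \<le> p x * p y"
  using cstar_seminorm unfolding cstar_seminorm_def by blast+

lemma p_zero [simp]: "p 0 = 0"
  using p_scale[of 0 0] by simp

lemma p_uminus: "x \<in> F \<Longrightarrow> p (- x) = p x"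
  using p_scale[of x "-1"] by (simp add: poly_scale_neg_one)

lemma p_commute: "x \<in> F \<Longrightarrow> y \<in> F \<Longrightarrow> p (x - y) = p (y - x)"
  using p_uminus[of "x - y"] by (simp add: free_star_algebra_diff)

lemma p_tri: "x \<in> F \<Longrightarrow> y \<in> F \<Longrightarrow> z \<in> F \<Longrightarrow> p (x - z) \<le> p (x - y) + p (y - z)"
  using p_add[of "x - y" "y - z"] by (simp add: free_star_algebra_diff)

lemma p_diff: "x \<in> F \<Longrightarrow> y \<in> F \<Longrightarrow> p x \<le> p (x - y) + p y"
  using p_add[of "x - y" y] by (simp add: free_star_algebra_diff)

lemma p_abs: "x \<in> F \<Longrightarrow> y \<in> F \<Longrightarrow> \<bar>p x - p y\<bar> \<le> p (x - y)"
  using p_diff[of x y] p_diff[of y x] p_commute[of x y] by linarith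

lemma p_star: assumes "x \<in> F" shows "p (poly_star x) = p x"
proof -
  have le: "p x \<le> p (poly_star x)" if "x \<in> F" for x
  proof -
    have "(p x)\<^sup>2 \<le> p (poly_star x) * p x"
      using p_cstar[OF that] p_mult[of "poly_star x" x] that by (simp add: free_star_algebra_star)
    moreover have "0 \<le> p x" "0 \<le> p (poly_star x)"
      using p_nonneg[OF that] p_nonneg[OF free_star_algebra_star[OF that]] by simp_all
    ultimately show ?thesis by (cases "p x = 0") (simp_all add: power2_eq_square)
  qed
  show ?thesis using le[OF assms] le[of "poly_star x"] assms by (simp add: free_star_algebra_star)
qed

abbreviation "C \<equiv> cauchy_seqs G p"
text \<open>The opaque name keeps the image of the equivalence relation from being rewritten into membership
  statements.\<close>

definition cls where "cls x = null_rel G p `` {x}"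
abbreviation "K \<equiv> completion G p"

lemma cauchyD: "x \<in> C \<Longrightarrow> 0 < e \<Longrightarrow> \<exists>M. \<forall>m\<ge>M. \<forall>n\<ge>M. p (x m - x n) < e"
  by (simp add: cauchy_seqs_def)

lemma cauchyI: "(\<And>n. x n \<in> F) \<Longrightarrow> (\<And>e. 0 < e \<Longrightarrow> \<exists>M. \<forall>m\<ge>M. \<forall>n\<ge>M. p (x m - x n) < e) \<Longrightarrow> x \<in> C"
  by (simp add: cauchy_seqs_def)

lemma cauchy_const: "x \<in> F \<Longrightarrow> (\<lambda>n. x) \<in> C"
  by (simp add: cauchy_seqs_def)

lemma cauchy_in [simp]: "x \<in> C \<Longrightarrow> x n \<in> F"
  by (simp add: cauchy_seqs_def)

lemma cauchy_norm: "x \<in> C \<Longrightarrow> Cauchy (\<lambda>n. p (x n))"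
proof (rule metric_CauchyI)
  fix e :: real assume x: "x \<in> C" and "0 < e"
  then obtain M where M: "\<forall>m\<ge>M. \<forall>n\<ge>M. p (x m - x n) < e" using cauchyD[OF x, of e] by auto
  have "dist (p (x m)) (p (x n)) < e" if "m \<ge> M" "n \<ge> M" for m n
    using p_abs[OF cauchy_in[OF x, of m] cauchy_in[OF x, of n]] M[rule_format, OF that]
    by (simp add: dist_real_def)
  thus "\<exists>M. \<forall>m\<ge>M. \<forall>n\<ge>M. dist (p (x m)) (p (x n)) < e" by blast
qed

lemma cauchy_bounded: assumes "x \<in> C" obtains B where "0 < B" "\<And>n. p (x n) \<le> B"
proof -
  obtain B where "0 < B" "\<forall>n. norm (p (x n)) \<le> B"
    using Cauchy_Bseq[OF cauchy_norm[OF assms]] unfolding Bseq_def by auto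
  thus ?thesis using that[of B] by (simp add: abs_le_iff)
qed

text \<open>All operations are Lipschitz on bounded sets; the two bounds below turn such estimates into
  statements about Cauchy and null sequences once and for all.\<close>

lemma cauchy_by_bound:
  assumes "\<And>n. z n \<in> F" "x \<in> C" "y \<in> C" "0 \<le> a" "0 \<le> b"
    and "\<And>m n. p (z m - z n) \<le> a * p (x m - x n) + b * p (y m - y n)"
  shows "z \<in> C"
proof (rule cauchyI)
  fix e :: real assume "0 < e"
  define e' where "e' = e / (2 * (a + b + 1))"
  have e': "0 < e'" using \<open>0 < e\<close> assms(4,5) by (simp add: e'_def)
  obtain M N where M: "\<forall>m\<ge>M. \<forall>n\<ge>M. p (x m - x n) < e'" and N: "\<forall>m\<ge>N. \<forall>n\<ge>N. p (y m - y n) < e'"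
    using cauchyD[OF assms(2) e'] cauchyD[OF assms(3) e'] by auto
  have "p (z m - z n) < e" if "m \<ge> max M N" "n \<ge> max M N" for m n
  proof -
    have "p (z m - z n) \<le> a * e' + b * e'"
    proof -
      have "p (x m - x n) \<le> e'" "p (y m - y n) \<le> e'"
        using M N that by (auto intro: less_imp_le)
      hence "a * p (x m - x n) + b * p (y m - y n) \<le> a * e' + b * e'"
        using assms(4,5) by (intro add_mono mult_left_mono)
      thus ?thesis using assms(6)[of m n] by linarith
    qed
    also have "\<dots> \<le> e / 2"
    proof -
      have "0 < a + b + 1" using add_nonneg_pos[OF add_nonneg_nonneg[OF assms(4,5)]] by simp
      hence "e' * (2 * (a + b + 1)) = e" unfolding e'_def by simp
      thus ?thesis using e' by (simp add: algebra_simps)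
    qed
    finally show ?thesis using \<open>0 < e\<close> by simp
  qed
  thus "\<exists>M. \<forall>m\<ge>M. \<forall>n\<ge>M. p (z m - z n) < e" by blast
qed (rule assms(1))

lemma cauchy_add: assumes "x \<in> C" "y \<in> C" shows "(\<lambda>n. x n + y n) \<in> C"
proof (rule cauchy_by_bound[OF _ assms, of _ 1 1])
  fix m n
  have *: "x m + y m - (x n + y n) = (x m - x n) + (y m - y n)" by simp
  thus "p (x m + y m - (x n + y n)) \<le> 1 * p (x m - x n) + 1 * p (y m - y n)"
    using p_add[of "x m - x n" "y m - y n"] assms by (simp only: * free_star_algebra_diff cauchy_in mult_1)
qed (use assms in \<open>auto intro: free_star_algebra_closed\<close>)

lemma cauchy_scale: assumes "x \<in> C" shows "(\<lambda>n. poly_scale k (x n)) \<in> C"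
  by (rule cauchy_by_bound[OF _ assms assms, of _ "cmod k" 0])
    (use assms in \<open>auto intro: free_star_algebra_closed simp: p_scale free_star_algebra_diff simp flip: poly_scale_diff\<close>)

lemma cauchy_diff: assumes "x \<in> C" "y \<in> C" shows "(\<lambda>n. x n - y n) \<in> C"
  using cauchy_add[OF assms(1) cauchy_scale[OF assms(2), of "-1"]] by (simp add: poly_scale_neg_one)

lemma cauchy_star: assumes "x \<in> C" shows "(\<lambda>n. poly_star (x n)) \<in> C"
  by (rule cauchy_by_bound[OF _ assms assms, of _ 1 0])
    (use assms in \<open>auto intro: free_star_algebra_closed simp: p_star free_star_algebra_diff simp flip: poly_star_minus\<close>)

lemma p_mult_diff:
  assumes "x \<in> F" "y \<in> F" "x' \<in> F" "y' \<in> F"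
  shows "p (x * y - x' * y') \<le> p (x - x') * p y + p x' * p (y - y')"
proof -
  have "x * y - x' * y' = (x - x') * y + x' * (y - y')" by (simp add: algebra_simps)
  thus ?thesis
    using p_add[of "(x - x') * y" "x' * (y - y')"] p_mult[of "x - x'" y] p_mult[of x' "y - y'"] assms
    by (simp add: free_star_algebra_closed)
qed

lemma cauchy_mult: assumes "x \<in> C" "y \<in> C" shows "(\<lambda>n. x n * y n) \<in> C"
proof -
  obtain a where a: "0 < a" "\<And>n. p (x n) \<le> a" using cauchy_bounded[OF assms(1)] by blast
  obtain b where b: "0 < b" "\<And>n. p (y n) \<le> b" using cauchy_bounded[OF assms(2)] by blast
  show ?thesis
  proof (rule cauchy_by_bound[OF _ assms, of _ b a])
    fix m n
    have "p (x m * y m - x n * y n) \<le> p (x m - x n) * p (y m) + p (x n) * p (y m - y n)"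
      using assms by (intro p_mult_diff) auto
    also have "\<dots> \<le> p (x m - x n) * b + a * p (y m - y n)"
      using assms a b by (intro add_mono mult_left_mono mult_right_mono p_nonneg free_star_algebra_diff) auto
    finally show "p (x m * y m - x n * y n) \<le> b * p (x m - x n) + a * p (y m - y n)"
      by (simp add: mult.commute)
  qed (use assms a b in \<open>auto intro: free_star_algebra_closed\<close>)
qed

lemmas cauchy_closed = cauchy_add cauchy_scale cauchy_diff cauchy_star cauchy_mult

lemma null_by_bound:
  assumes "(\<lambda>n. p (x n)) \<longlonglongrightarrow> 0" "(\<lambda>n. p (y n)) \<longlonglongrightarrow> 0" "\<And>n. z n \<in> F"
    and "\<And>n. p (z n) \<le> a * p (x n) + b * p (y n)"
  shows "(\<lambda>n. p (z n)) \<longlonglongrightarrow> 0"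
proof (rule tendsto_sandwich[OF _ _ tendsto_const])
  show "(\<lambda>n. a * p (x n) + b * p (y n)) \<longlonglongrightarrow> 0"
    using tendsto_add[OF tendsto_mult_left[OF assms(1), of a] tendsto_mult_left[OF assms(2), of b]] by simp
qed (use assms p_nonneg in auto)

lemma null_rel_iff: "(x, y) \<in> null_rel G p \<longleftrightarrow> x \<in> C \<and> y \<in> C \<and> (\<lambda>n. p (x n - y n)) \<longlonglongrightarrow> 0"
  by (simp add: null_rel_def)

lemma equiv_null_rel: "equiv C (null_rel G p)"
proof (rule equivI)
  show "null_rel G p \<subseteq> C \<times> C" by (auto simp: null_rel_iff)
  show "refl_on C (null_rel G p)" by (auto simp: refl_on_def null_rel_iff)
  show "sym (null_rel G p)"
  proof (rule symI)
    fix x y assume "(x, y) \<in> null_rel G p"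
    thus "(y, x) \<in> null_rel G p" using p_commute[of "x _" "y _"] by (simp add: null_rel_iff)
  qed
  show "trans (null_rel G p)"
  proof (rule transI)
    fix x y z assume xy: "(x, y) \<in> null_rel G p" and yz: "(y, z) \<in> null_rel G p"
    have "(\<lambda>n. p (x n - z n)) \<longlonglongrightarrow> 0"
      by (rule null_by_bound[where a = 1 and b = 1, of "\<lambda>n. x n - y n" "\<lambda>n. y n - z n"])
        (use xy yz in \<open>auto simp: null_rel_iff free_star_algebra_diff intro!: p_tri\<close>)
    thus "(x, z) \<in> null_rel G p" using xy yz by (simp add: null_rel_iff)
  qed
qed

lemma cls_eq_iff: "x \<in> C \<Longrightarrow> y \<in> C \<Longrightarrow> cls x = cls y \<longleftrightarrow> (\<lambda>n. p (x n - y n)) \<longlonglongrightarrow> 0"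
  using eq_equiv_class_iff[OF equiv_null_rel] by (simp add: null_rel_iff cls_def)

lemma carrier_completion: "carrier K = cls ` C"
  by (auto simp: completion_def quotient_def cls_def)

lemma cls_in [simp, intro]: "x \<in> C \<Longrightarrow> cls x \<in> carrier K"
  by (simp add: carrier_completion)

lemma carrier_cases [elim]: "X \<in> carrier K \<Longrightarrow> (\<And>x. x \<in> C \<Longrightarrow> X = cls x \<Longrightarrow> P) \<Longrightarrow> P"
  by (auto simp: carrier_completion)

lemma cls_mem: "x \<in> C \<Longrightarrow> x \<in> cls x"
  by (simp add: null_rel_iff cls_def)

lemma mem_cls: "x' \<in> cls x \<longleftrightarrow> x \<in> C \<and> x' \<in> C \<and> (\<lambda>n. p (x n - x' n)) \<longlonglongrightarrow> 0"
  by (simp add: null_rel_iff cls_def)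

lemma lift_unary:
  assumes "x \<in> C" "\<And>x'. x' \<in> cls x \<Longrightarrow> f x' = f x"
  shows "(\<Union>x'\<in>cls x. f x') = f x"
  using cls_mem[OF assms(1)] assms(2) by (metis (mono_tags, lifting) UN_constant_eq)

lemma lift_binary:
  assumes "x \<in> C" "y \<in> C" "\<And>x' y'. x' \<in> cls x \<Longrightarrow> y' \<in> cls y \<Longrightarrow> f x' y' = f x y"
  shows "(\<Union>x'\<in>cls x. \<Union>y'\<in>cls y. f x' y') = f x y"
proof -
  have "(\<Union>y'\<in>cls y. f x' y') = f x y" if x': "x' \<in> cls x" for x'
  proof -
    have "(\<Union>y'\<in>cls y. f x' y') = f x' y"
      by (rule lift_unary[OF assms(2)]) (metis assms(3)[OF x'] cls_mem[OF assms(2)])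
    thus ?thesis using assms(3)[OF x' cls_mem[OF assms(2)]] by simp
  qed
  hence "(\<Union>x'\<in>cls x. \<Union>y'\<in>cls y. f x' y') = (\<Union>x'\<in>cls x. f x y)" by simp
  thus ?thesis using cls_mem[OF assms(1)] by auto
qed

lemma add_cls: assumes "x \<in> C" "y \<in> C" shows "cls x \<oplus>\<^bsub>K\<^esub> cls y = cls (\<lambda>n. x n + y n)"
proof -
  have "cls (\<lambda>n. x' n + y' n) = cls (\<lambda>n. x n + y n)" if "x' \<in> cls x" "y' \<in> cls y" for x' y'
  proof (subst eq_commute, subst cls_eq_iff)
    have *: "x n + y n - (x' n + y' n) = (x n - x' n) + (y n - y' n)" for n by simp
    show "(\<lambda>n. p (x n + y n - (x' n + y' n))) \<longlonglongrightarrow> 0" unfolding *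
      by (rule null_by_bound[where a = 1 and b = 1, of "\<lambda>n. x n - x' n" "\<lambda>n. y n - y' n"])
        (use that in \<open>simp_all add: mem_cls p_add free_star_algebra_add free_star_algebra_diff\<close>)
  qed (use that in \<open>auto simp: mem_cls intro: cauchy_closed\<close>)
  from lift_binary[OF assms, of "\<lambda>x y. cls (\<lambda>n. x n + y n)", OF this]
  show ?thesis by (simp add: completion_def flip: cls_def)
qed

lemma mult_cls: assumes "x \<in> C" "y \<in> C" shows "cls x \<otimes>\<^bsub>K\<^esub> cls y = cls (\<lambda>n. x n * y n)"
proof -
  have "cls (\<lambda>n. x' n * y' n) = cls (\<lambda>n. x n * y n)" if "x' \<in> cls x" "y' \<in> cls y" for x' y'
  proof (subst eq_commute, subst cls_eq_iff)
    have xy: "x' \<in> C" "y' \<in> C" using that by (auto simp: mem_cls)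
    obtain a where a: "0 < a" "\<And>n. p (x' n) \<le> a" using cauchy_bounded[OF xy(1)] by blast
    obtain b where b: "0 < b" "\<And>n. p (y n) \<le> b" using cauchy_bounded[OF assms(2)] by blast
    show "(\<lambda>n. p (x n * y n - x' n * y' n)) \<longlonglongrightarrow> 0"
    proof (rule null_by_bound)
      fix n
      have "p (x n * y n - x' n * y' n) \<le> p (x n - x' n) * p (y n) + p (x' n) * p (y n - y' n)"
        using assms xy by (intro p_mult_diff) auto
      also have "\<dots> \<le> p (x n - x' n) * b + a * p (y n - y' n)"
        using assms xy a b by (intro add_mono mult_left_mono mult_right_mono p_nonneg free_star_algebra_diff) auto
      finally show "p (x n * y n - x' n * y' n) \<le> b * p (x n - x' n) + a * p (y n - y' n)"
        by (simp add: mult.commute)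
    qed (use that assms in \<open>auto simp: mem_cls intro!: free_star_algebra_closed\<close>)
  qed (use that in \<open>auto simp: mem_cls intro: cauchy_closed\<close>)
  from lift_binary[OF assms, of "\<lambda>x y. cls (\<lambda>n. x n * y n)", OF this]
  show ?thesis by (simp add: completion_def completion_mult_def flip: cls_def)
qed

lemma scale_cls: assumes "x \<in> C" shows "scale K k (cls x) = cls (\<lambda>n. poly_scale k (x n))"
proof -
  have "cls (\<lambda>n. poly_scale k (x' n)) = cls (\<lambda>n. poly_scale k (x n))" if "x' \<in> cls x" for x'
  proof (subst eq_commute, subst cls_eq_iff)
    show "(\<lambda>n. p (poly_scale k (x n) - poly_scale k (x' n))) \<longlonglongrightarrow> 0"
      by (rule null_by_bound[where a = "cmod k" and b = 0, of "\<lambda>n. x n - x' n" "\<lambda>n. x n - x' n"])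
        (use that in \<open>simp_all add: mem_cls p_scale free_star_algebra_diff free_star_algebra_scale flip: poly_scale_diff\<close>)
  qed (use that in \<open>auto simp: mem_cls intro: cauchy_closed\<close>)
  from lift_unary[OF assms, of "\<lambda>x. cls (\<lambda>n. poly_scale k (x n))", OF this]
  show ?thesis by (simp add: completion_def flip: cls_def)
qed

lemma star_cls: assumes "x \<in> C" shows "star K (cls x) = cls (\<lambda>n. poly_star (x n))"
proof -
  have "cls (\<lambda>n. poly_star (x' n)) = cls (\<lambda>n. poly_star (x n))" if "x' \<in> cls x" for x'
  proof (subst eq_commute, subst cls_eq_iff)
    show "(\<lambda>n. p (poly_star (x n) - poly_star (x' n))) \<longlonglongrightarrow> 0"
      by (rule null_by_bound[where a = 1 and b = 0, of "\<lambda>n. x n - x' n" "\<lambda>n. x n - x' n"])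
        (use that in \<open>simp_all add: mem_cls p_star free_star_algebra_diff free_star_algebra_star flip: poly_star_minus\<close>)
  qed (use that in \<open>auto simp: mem_cls intro: cauchy_closed\<close>)
  from lift_unary[OF assms, of "\<lambda>x. cls (\<lambda>n. poly_star (x n))", OF this]
  show ?thesis by (simp add: completion_def flip: cls_def)
qed

lemma zero_cls: "\<zero>\<^bsub>K\<^esub> = cls (\<lambda>n. 0)"
  by (simp add: completion_def cls_def)

lemma norm_convergent: "x \<in> C \<Longrightarrow> convergent (\<lambda>n. p (x n))"
  using cauchy_norm Cauchy_convergent by blast

lemma nrm_cls:
  assumes "x \<in> C" and lim: "(\<lambda>n. p (x n)) \<longlonglongrightarrow> r"
  shows "nrm K (cls x) = r"
proof -
  have "s = r" if "x' \<in> cls x" "(\<lambda>n. p (x' n)) \<longlonglongrightarrow> s" for x' s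
  proof -
    have "(\<lambda>n. p (x n) - p (x' n)) \<longlonglongrightarrow> 0"
    proof (rule tendsto_rabs_zero_cancel, rule tendsto_sandwich[OF _ _ tendsto_const])
      show "(\<lambda>n. p (x n - x' n)) \<longlonglongrightarrow> 0" using that by (simp add: mem_cls)
    qed (use that in \<open>simp_all add: mem_cls p_abs\<close>)
    moreover have "(\<lambda>n. p (x n) - p (x' n)) \<longlonglongrightarrow> r - s" by (intro tendsto_diff lim that)
    ultimately show ?thesis using LIMSEQ_unique by fastforce
  qed
  hence "(THE r. \<exists>x'\<in>cls x. (\<lambda>n. p (x' n)) \<longlonglongrightarrow> r) = r"
    using cls_mem[OF assms(1)] lim by (intro the_equality) blast+
  thus ?thesis by (simp add: completion_def)
qed

lemma nrm_cls_lim: "x \<in> C \<Longrightarrow> (\<lambda>n. p (x n)) \<longlonglongrightarrow> nrm K (cls x)"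
  using norm_convergent[of x] nrm_cls[of x] unfolding convergent_def by auto

lemma nrm_cls_const: "x \<in> F \<Longrightarrow> nrm K (cls (\<lambda>n. x)) = p x"
  by (intro nrm_cls cauchy_const tendsto_const)

lemmas cls_simps = add_cls mult_cls scale_cls star_cls zero_cls

lemma abelian_group_completion: "abelian_group K"
proof (rule abelian_groupI)
  fix X assume "X \<in> carrier K"
  then obtain x where x: "x \<in> C" "X = cls x" by blast
  have "cls (\<lambda>n. poly_scale (-1) (x n)) \<oplus>\<^bsub>K\<^esub> X = \<zero>\<^bsub>K\<^esub>"
    using x by (simp add: cls_simps cauchy_closed) (simp add: poly_scale_neg_one)
  thus "\<exists>Y\<in>carrier K. Y \<oplus>\<^bsub>K\<^esub> X = \<zero>\<^bsub>K\<^esub>" using x by (auto intro!: cauchy_scale)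
qed (auto elim!: carrier_cases simp: cls_simps cauchy_closed cauchy_const ac_simps intro!: cls_in cauchy_closed)

lemma uminus_cls: assumes "x \<in> C" shows "\<ominus>\<^bsub>K\<^esub> cls x = cls (\<lambda>n. - x n)"
proof -
  interpret abelian_group K by (rule abelian_group_completion)
  have *: "(\<lambda>n. - x n) \<in> C" using cauchy_scale[OF assms, of "-1"] by (simp add: poly_scale_neg_one)
  show ?thesis by (rule minus_equality) (use assms * in \<open>auto simp: cls_simps\<close>)
qed

lemma minus_cls: assumes "x \<in> C" "y \<in> C" shows "cls x \<ominus>\<^bsub>K\<^esub> cls y = cls (\<lambda>n. x n - y n)"
proof -
  have "(\<lambda>n. - y n) \<in> C" using cauchy_scale[OF assms(2), of "-1"] by (simp add: poly_scale_neg_one)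
  thus ?thesis using assms by (simp add: a_minus_def uminus_cls add_cls)
qed

lemma nrm_eq_lim:
  assumes "X \<in> carrier K" obtains x where "x \<in> C" "X = cls x" "(\<lambda>n. p (x n)) \<longlonglongrightarrow> nrm K X"
  using assms nrm_cls_lim by blast

text \<open>Each class in a Cauchy sequence of classes is within \<open>1/(n+1)\<close> of a single polynomial
  \<open>y n\<close>; the sequence \<open>y\<close> is then Cauchy and represents the limit.\<close>

lemma complete_completion:
  assumes X: "\<And>n. X n \<in> carrier K"
    and cau: "\<And>e. 0 < e \<Longrightarrow> \<exists>M. \<forall>m\<ge>M. \<forall>n\<ge>M. nrm K (X m \<ominus>\<^bsub>K\<^esub> X n) < e"
  shows "\<exists>x\<in>carrier K. (\<lambda>n. nrm K (X n \<ominus>\<^bsub>K\<^esub> x)) \<longlonglongrightarrow> 0"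
proof -
  have "\<forall>n. \<exists>x. x \<in> C \<and> X n = cls x" using X by (auto simp: carrier_completion)
  then obtain x where x: "\<And>n. x n \<in> C" "\<And>n. X n = cls (x n)" by metis
  have "\<exists>k. \<forall>m\<ge>k. p (x n m - x n k) < inverse (Suc n)" for n
    using cauchyD[OF x(1), of "inverse (Suc n)" n] by auto
  then obtain k where k: "\<And>n m. m \<ge> k n \<Longrightarrow> p (x n m - x n (k n)) < inverse (Suc n)" by metis
  define y where "y n = x n (k n)" for n
  have yF: "y n \<in> F" for n using x by (simp add: y_def)
  have near: "nrm K (X n \<ominus>\<^bsub>K\<^esub> cls (\<lambda>_. y n)) \<le> inverse (Suc n)" for n
  proof -
    have "(\<lambda>m. x n m - y n) \<in> C" using cauchy_diff[OF x(1) cauchy_const[OF yF]] .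
    from nrm_cls_lim[OF this] show ?thesis
      using k[of n] unfolding x(2) minus_cls[OF x(1) cauchy_const[OF yF]]
      by (intro LIMSEQ_le_const2[of "\<lambda>m. p (x n m - y n)"]) (auto simp: y_def intro: less_imp_le)
  qed
  have pd: "p (y m - y n) \<le> inverse (Suc m) + inverse (Suc n) + nrm K (X m \<ominus>\<^bsub>K\<^esub> X n)" for m n
  proof -
    have lim: "(\<lambda>j. p (x m j - x n j)) \<longlonglongrightarrow> nrm K (X m \<ominus>\<^bsub>K\<^esub> X n)"
      using nrm_cls_lim[OF cauchy_diff[OF x(1) x(1)]] by (simp add: x minus_cls)
    have "p (y m - y n) \<le> inverse (Suc m) + inverse (Suc n) + p (x m j - x n j)"
      if "j \<ge> max (k m) (k n)" for j
    proof -
      have "p (y m - y n) \<le> p (y m - x m j) + (p (x m j - x n j) + p (x n j - y n))"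
        using p_tri[of "y m" "x m j" "y n"] p_tri[of "x m j" "x n j" "y n"] x(1) yF by simp
      thus ?thesis using k[of m j] k[of n j] that p_commute[of "y m" "x m j"] x(1) yF
        by (simp add: y_def)
    qed
    hence "eventually (\<lambda>j. p (y m - y n) \<le> inverse (Suc m) + inverse (Suc n) + p (x m j - x n j)) sequentially"
      using eventually_ge_at_top[of "max (k m) (k n)"] by (rule eventually_mono[rotated])
    thus ?thesis
      by (rule tendsto_lowerbound[OF tendsto_add[OF tendsto_const lim]]) simp
  qed
  have inv0: "\<exists>N. \<forall>n\<ge>N. inverse (Suc n) < e" if "0 < e" for e :: real
    using LIMSEQ_inverse_real_of_nat that unfolding lim_sequentially dist_real_def by (metis abs_ge_self diff_zero order_le_less_trans)
  have yC: "y \<in> C"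
  proof (rule cauchyI)
    fix e :: real assume "0 < e"
    then obtain M N where M: "\<forall>m\<ge>M. \<forall>n\<ge>M. nrm K (X m \<ominus>\<^bsub>K\<^esub> X n) < e/3"
      and N: "\<forall>n\<ge>N. inverse (Suc n) < e/3" using cau[of "e/3"] inv0[of "e/3"] by auto
    have "p (y m - y n) < e" if "m \<ge> max M N" "n \<ge> max M N" for m n
    proof -
      have "nrm K (X m \<ominus>\<^bsub>K\<^esub> X n) < e/3" "inverse (Suc m) < e/3" "inverse (Suc n) < e/3"
        using M N that by auto
      thus ?thesis using pd[of m n] by linarith
    qed
    thus "\<exists>M. \<forall>m\<ge>M. \<forall>n\<ge>M. p (y m - y n) < e" by blast
  qed (rule yF)
  have "(\<lambda>n. nrm K (X n \<ominus>\<^bsub>K\<^esub> cls y)) \<longlonglongrightarrow> 0"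
  proof (rule LIMSEQ_I)
    fix e :: real assume "0 < e"
    then obtain M N where M: "\<forall>m\<ge>M. \<forall>n\<ge>M. p (y m - y n) < e/3"
      and N: "\<forall>n\<ge>N. inverse (Suc n) < e/3" using cauchyD[OF yC, of "e/3"] inv0[of "e/3"] by auto
    have "norm (nrm K (X n \<ominus>\<^bsub>K\<^esub> cls y) - 0) < e" if n: "n \<ge> max M N" for n
    proof -
      have C': "(\<lambda>j. x n j - y j) \<in> C" using cauchy_diff[OF x(1) yC] .
      have lim: "(\<lambda>j. p (x n j - y j)) \<longlonglongrightarrow> nrm K (X n \<ominus>\<^bsub>K\<^esub> cls y)"
        using nrm_cls_lim[OF C'] by (simp add: x minus_cls yC)
      have "p (x n j - y j) \<le> 2*e/3" if "j \<ge> max (k n) M" for j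
      proof -
        have "inverse (Suc n) < e/3" "p (y n - y j) < e/3" using M N n that by auto
        thus ?thesis using p_tri[of "x n j" "y n" "y j"] k[of n j] that x(1) yF by (simp add: y_def)
      qed
      hence "nrm K (X n \<ominus>\<^bsub>K\<^esub> cls y) \<le> 2*e/3" by (intro LIMSEQ_le_const2[OF lim] exI[of _ "max (k n) M"]) blast
      moreover have "0 \<le> nrm K (X n \<ominus>\<^bsub>K\<^esub> cls y)"
        using lim p_nonneg[OF cauchy_in[OF C']] by (intro LIMSEQ_le_const) auto
      ultimately show ?thesis using \<open>0 < e\<close> by simp
    qed
    thus "\<exists>N. \<forall>n\<ge>N. norm (nrm K (X n \<ominus>\<^bsub>K\<^esub> cls y) - 0) < e" by blast
  qed
  thus ?thesis using yC by blast
qed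

lemma cstar_algebra_completion: "cstar_algebra K"
proof (intro cstar_algebra.intro[OF abelian_group_completion] cstar_algebra_axioms.intro)
  fix X assume "X \<in> carrier K"
  then obtain x where x: "x \<in> C" "X = cls x" and lim: "(\<lambda>n. p (x n)) \<longlonglongrightarrow> nrm K X" by (rule nrm_eq_lim)
  show "0 \<le> nrm K X" using lim x by (intro LIMSEQ_le_const[OF lim]) (auto intro!: p_nonneg)
  show "(nrm K X = 0) = (X = \<zero>\<^bsub>K\<^esub>)"
  proof -
    have "X = \<zero>\<^bsub>K\<^esub> \<longleftrightarrow> (\<lambda>n. p (x n)) \<longlonglongrightarrow> 0"
      unfolding x(2) zero_cls cls_eq_iff[OF x(1) cauchy_const[OF free_star_algebra_zero]] by simp
    thus ?thesis using lim LIMSEQ_unique[OF lim, of 0] by metis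
  qed
  show "nrm K (scale K k X) = cmod k * nrm K X" for k
    unfolding x(2) scale_cls[OF x(1)]
    by (rule nrm_cls) (use x tendsto_mult_left[OF lim] in \<open>auto simp: p_scale cauchy_closed\<close>)
  show "nrm K (star K X \<otimes>\<^bsub>K\<^esub> X) = (nrm K X)\<^sup>2"
    unfolding x(2) star_cls[OF x(1)] mult_cls[OF cauchy_star[OF x(1)] x(1)]
    by (rule nrm_cls) (use x tendsto_power[OF lim] in \<open>auto simp: p_cstar cauchy_closed\<close>)
next
  fix X Y assume "X \<in> carrier K" "Y \<in> carrier K"
  then obtain x y where x: "x \<in> C" "X = cls x" and lx: "(\<lambda>n. p (x n)) \<longlonglongrightarrow> nrm K X"
    and y: "y \<in> C" "Y = cls y" and ly: "(\<lambda>n. p (y n)) \<longlonglongrightarrow> nrm K Y" by (metis nrm_eq_lim)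
  have "(\<lambda>n. p (x n + y n)) \<longlonglongrightarrow> nrm K (X \<oplus>\<^bsub>K\<^esub> Y)"
    using nrm_cls_lim[OF cauchy_add[OF x(1) y(1)]] x y by (simp add: add_cls)
  thus "nrm K (X \<oplus>\<^bsub>K\<^esub> Y) \<le> nrm K X + nrm K Y"
    by (rule LIMSEQ_le[OF _ tendsto_add[OF lx ly]]) (use x y in \<open>auto intro!: p_add\<close>)
  have "(\<lambda>n. p (x n * y n)) \<longlonglongrightarrow> nrm K (X \<otimes>\<^bsub>K\<^esub> Y)"
    using nrm_cls_lim[OF cauchy_mult[OF x(1) y(1)]] x y by (simp add: mult_cls)
  thus "nrm K (X \<otimes>\<^bsub>K\<^esub> Y) \<le> nrm K X * nrm K Y"
    by (rule LIMSEQ_le[OF _ tendsto_mult[OF lx ly]]) (use x y in \<open>auto intro!: p_mult\<close>)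
next
  fix X assume "\<And>n::nat. X n \<in> carrier K" "\<And>e. 0 < e \<Longrightarrow> \<exists>M. \<forall>m\<ge>M. \<forall>n\<ge>M. nrm K (X m \<ominus>\<^bsub>K\<^esub> X n) < e"
  thus "\<exists>x\<in>carrier K. (\<lambda>n. nrm K (X n \<ominus>\<^bsub>K\<^esub> x)) \<longlonglongrightarrow> 0" by (rule complete_completion)
qed ((elim carrier_cases, simp add: cls_simps cauchy_closed mult.assoc distrib_left distrib_right
    poly_star_add poly_star_mult poly_star_scale poly_scale_add poly_scale_add_left poly_scale_scale
    poly_scale_one poly_scale_mult_left poly_scale_mult_right)+)

end

section \<open>Elementary C*-algebra theory\<close>

context cstar_algebra
begin

lemma nrm_zero [simp]: "nrm A \<zero> = 0"
  using nrm_eq_0[of \<zero>] by simp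

lemma nrm_le_0: "x \<in> carrier A \<Longrightarrow> nrm A x \<le> 0 \<Longrightarrow> x = \<zero>"
  using nrm_eq_0[of x] nrm_nonneg[of x] by linarith

lemma mult_zero_left [simp]: "x \<in> carrier A \<Longrightarrow> \<zero> \<otimes> x = \<zero>"
  using nrm_mult[of \<zero> x] by (intro nrm_le_0) (simp_all add: mult_closed)

lemma mult_zero_right [simp]: "x \<in> carrier A \<Longrightarrow> x \<otimes> \<zero> = \<zero>"
  using nrm_mult[of x \<zero>] by (intro nrm_le_0) (simp_all add: mult_closed)

lemma scale_zero_left [simp]: "x \<in> carrier A \<Longrightarrow> scale A 0 x = \<zero>"
  by (intro nrm_le_0) (simp_all add: nrm_scale scale_closed)

lemma scale_zero_right [simp]: "scale A k \<zero> = \<zero>"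
  by (intro nrm_le_0) (simp_all add: nrm_scale scale_closed)

lemma uminus_eq_scale: "x \<in> carrier A \<Longrightarrow> \<ominus> x = scale A (- 1) x"
  using scale_add_left[of x "-1" 1] by (intro minus_equality) (simp_all add: scale_one scale_closed)

lemma star_zero [simp]: "star A \<zero> = \<zero>"
  using star_scale[of \<zero> 0] star_closed[of \<zero>] by simp

lemma star_uminus: "x \<in> carrier A \<Longrightarrow> star A (\<ominus> x) = \<ominus> star A x"
  by (simp add: uminus_eq_scale star_scale star_closed)

lemma star_minus: "x \<in> carrier A \<Longrightarrow> y \<in> carrier A \<Longrightarrow> star A (x \<ominus> y) = star A x \<ominus> star A y"
  by (simp add: a_minus_def star_add star_uminus)

lemma nrm_uminus: "x \<in> carrier A \<Longrightarrow> nrm A (\<ominus> x) = nrm A x"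
  by (simp add: uminus_eq_scale nrm_scale)

lemma nrm_star: assumes "x \<in> carrier A" shows "nrm A (star A x) = nrm A x"
proof -
  have le: "nrm A x \<le> nrm A (star A x)" if "x \<in> carrier A" for x
  proof -
    have "(nrm A x)\<^sup>2 \<le> nrm A (star A x) * nrm A x"
      using nrm_cstar[OF that] nrm_mult[OF star_closed[OF that] that] by simp
    moreover have "0 \<le> nrm A x" "0 \<le> nrm A (star A x)"
      using nrm_nonneg[OF that] nrm_nonneg[OF star_closed[OF that]] by simp_all
    ultimately show ?thesis by (cases "nrm A x = 0") (simp_all add: power2_eq_square)
  qed
  show ?thesis using le[OF assms] le[OF star_closed[OF assms]] assms by (simp add: star_star)
qed

lemma eq_iff_minus: "x \<in> carrier A \<Longrightarrow> y \<in> carrier A \<Longrightarrow> x = y \<longleftrightarrow> x \<ominus> y = \<zero>"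
  by (metis a_minus_def add.inv_closed add.inv_equality add.inv_inv r_neg)

lemma nrm_minus_commute: "x \<in> carrier A \<Longrightarrow> y \<in> carrier A \<Longrightarrow> nrm A (x \<ominus> y) = nrm A (y \<ominus> x)"
  using nrm_uminus[of "x \<ominus> y"] by (simp add: a_minus_def minus_add a_comm)

lemma add_minus_distrib: "\<lbrakk>x \<in> carrier A; y \<in> carrier A; x' \<in> carrier A; y' \<in> carrier A\<rbrakk> \<Longrightarrow>
    (x \<oplus> y) \<ominus> (x' \<oplus> y') = (x \<ominus> x') \<oplus> (y \<ominus> y')"
  by (simp add: a_minus_def minus_add a_ac)

lemma minus_split: "\<lbrakk>x \<in> carrier A; y \<in> carrier A; z \<in> carrier A\<rbrakk> \<Longrightarrow> x \<ominus> z = (x \<ominus> y) \<oplus> (y \<ominus> z)"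
  by (simp add: a_minus_def a_assoc r_neg1)

lemma minus_distrib_left: "\<lbrakk>x \<in> carrier A; y \<in> carrier A; z \<in> carrier A\<rbrakk> \<Longrightarrow>
    z \<otimes> (x \<ominus> y) = (z \<otimes> x) \<ominus> (z \<otimes> y)"
  by (simp add: a_minus_def distrib_left uminus_eq_scale scale_closed scale_mult_right mult_closed)

lemma minus_distrib_right: "\<lbrakk>x \<in> carrier A; y \<in> carrier A; z \<in> carrier A\<rbrakk> \<Longrightarrow>
    (x \<ominus> y) \<otimes> z = (x \<otimes> z) \<ominus> (y \<otimes> z)"
  by (simp add: a_minus_def distrib_right uminus_eq_scale scale_closed scale_mult_left mult_closed)

lemma scale_minus: "\<lbrakk>x \<in> carrier A; y \<in> carrier A\<rbrakk> \<Longrightarrow>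
    scale A k (x \<ominus> y) = scale A k x \<ominus> scale A k y"
  by (simp add: a_minus_def scale_add_right uminus_eq_scale scale_closed scale_scale)

definition lim_to :: "(nat \<Rightarrow> 'a) \<Rightarrow> 'a \<Rightarrow> bool" where
  "lim_to X x \<longleftrightarrow> (\<forall>n. X n \<in> carrier A) \<and> x \<in> carrier A \<and> (\<lambda>n. nrm A (X n \<ominus> x)) \<longlonglongrightarrow> 0"

lemma cstar_subalgebra_lim:
  assumes "cstar_subalgebra H A" "\<forall>n. X n \<in> H" "lim_to X x"
  shows "x \<in> H"
proof -
  have "\<forall>X. \<forall>x\<in>carrier A. (\<forall>n. X n \<in> H) \<and> (\<lambda>n. nrm A (X n \<ominus> x)) \<longlonglongrightarrow> 0 \<longrightarrow> x \<in> H"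
    using assms(1) unfolding cstar_subalgebra_def by (elim conjE)
  from this[THEN spec, of X, THEN bspec, of x] show ?thesis
    using assms(2,3) by (simp add: lim_to_def)
qed

lemma lim_to_by_bound:
  assumes "\<And>n. Z n \<in> carrier A" "z \<in> carrier A" "a \<longlonglongrightarrow> 0" "\<And>n. nrm A (Z n \<ominus> z) \<le> a n"
  shows "lim_to Z z"
  unfolding lim_to_def using assms tendsto_sandwich[OF _ _ tendsto_const[of 0] assms(3)]
  by (simp add: nrm_nonneg)

lemma lim_to_add: assumes "lim_to X x" "lim_to Y y" shows "lim_to (\<lambda>n. X n \<oplus> Y n) (x \<oplus> y)"
proof (rule lim_to_by_bound)
  show "(\<lambda>n. nrm A (X n \<ominus> x) + nrm A (Y n \<ominus> y)) \<longlonglongrightarrow> 0"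
    by (rule tendsto_add_zero) (use assms in \<open>simp_all add: lim_to_def\<close>)
qed (use assms in \<open>auto simp: lim_to_def add_minus_distrib intro!: nrm_triangle\<close>)

lemma lim_to_scale: assumes "lim_to X x" shows "lim_to (\<lambda>n. scale A k (X n)) (scale A k x)"
proof (rule lim_to_by_bound)
  show "(\<lambda>n. cmod k * nrm A (X n \<ominus> x)) \<longlonglongrightarrow> 0"
    using assms tendsto_mult_left[of _ 0 sequentially "cmod k"] by (simp add: lim_to_def)
qed (use assms in \<open>auto simp: lim_to_def scale_closed nrm_scale simp flip: scale_minus\<close>)

lemma lim_to_star: assumes "lim_to X x" shows "lim_to (\<lambda>n. star A (X n)) (star A x)"
proof (rule lim_to_by_bound)
  show "(\<lambda>n. nrm A (X n \<ominus> x)) \<longlonglongrightarrow> 0" using assms by (simp add: lim_to_def)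
qed (use assms in \<open>auto simp: lim_to_def star_closed nrm_star simp flip: star_minus\<close>)

lemma nrm_abs_diff: "x \<in> carrier A \<Longrightarrow> y \<in> carrier A \<Longrightarrow> \<bar>nrm A x - nrm A y\<bar> \<le> nrm A (x \<ominus> y)"
  using nrm_triangle[of "x \<ominus> y" y] nrm_triangle[of "y \<ominus> x" x] nrm_minus_commute[of x y]
  by (simp add: a_minus_def a_assoc l_neg)

lemma lim_to_nrm: assumes "lim_to X x" shows "(\<lambda>n. nrm A (X n)) \<longlonglongrightarrow> nrm A x"
proof (rule LIM_zero_cancel, rule tendsto_rabs_zero_cancel, rule tendsto_sandwich[OF _ _ tendsto_const])
  show "(\<lambda>n. nrm A (X n \<ominus> x)) \<longlonglongrightarrow> 0" using assms by (simp add: lim_to_def)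
qed (use assms in \<open>simp_all add: lim_to_def nrm_abs_diff\<close>)

lemma tendsto_mult_zero_left:
  fixes f g :: "nat \<Rightarrow> real" shows "f \<longlonglongrightarrow> 0 \<Longrightarrow> g \<longlonglongrightarrow> b \<Longrightarrow> (\<lambda>n. f n * g n) \<longlonglongrightarrow> 0"
  using tendsto_mult[of f 0 sequentially g b] by simp

lemma lim_to_mult: assumes "lim_to X x" "lim_to Y y" shows "lim_to (\<lambda>n. X n \<otimes> Y n) (x \<otimes> y)"
proof (rule lim_to_by_bound)
  show "(\<lambda>n. nrm A (X n \<ominus> x) * nrm A (Y n) + nrm A x * nrm A (Y n \<ominus> y)) \<longlonglongrightarrow> 0"
    by (intro tendsto_add_zero tendsto_mult_right_zero tendsto_mult_zero_left[OF _ lim_to_nrm[OF assms(2)]])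
      (use assms in \<open>simp_all add: lim_to_def\<close>)
  fix n
  have c: "X n \<in> carrier A" "x \<in> carrier A" "Y n \<in> carrier A" "y \<in> carrier A"
    using assms by (auto simp: lim_to_def)
  have "X n \<otimes> Y n \<ominus> x \<otimes> y = (X n \<otimes> Y n \<ominus> x \<otimes> Y n) \<oplus> (x \<otimes> Y n \<ominus> x \<otimes> y)"
    using c by (intro minus_split) (simp_all add: mult_closed)
  also have "\<dots> = (X n \<ominus> x) \<otimes> Y n \<oplus> x \<otimes> (Y n \<ominus> y)"
    using c by (simp add: minus_distrib_left minus_distrib_right)
  finally show "nrm A (X n \<otimes> Y n \<ominus> x \<otimes> y) \<le> nrm A (X n \<ominus> x) * nrm A (Y n) + nrm A x * nrm A (Y n \<ominus> y)"
    using c nrm_triangle[of "(X n \<ominus> x) \<otimes> Y n" "x \<otimes> (Y n \<ominus> y)"]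
      nrm_mult[of "X n \<ominus> x" "Y n"] nrm_mult[of x "Y n \<ominus> y"] by (simp add: mult_closed)
qed (use assms in \<open>auto simp: lim_to_def mult_closed\<close>)

lemma lim_to_unique: assumes "lim_to X x" "lim_to X y" shows "x = y"
proof -
  have c: "x \<in> carrier A" "y \<in> carrier A" "\<And>n. X n \<in> carrier A" using assms by (auto simp: lim_to_def)
  have "lim_to (\<lambda>n. X n \<oplus> scale A (- 1) (X n)) (x \<oplus> scale A (- 1) y)"
    by (intro lim_to_add lim_to_scale assms)
  hence "(\<lambda>n. nrm A (X n \<oplus> scale A (- 1) (X n))) \<longlonglongrightarrow> nrm A (x \<oplus> scale A (- 1) y)"
    by (rule lim_to_nrm)
  hence "nrm A (x \<ominus> y) = 0"
    using c by (simp add: a_minus_def r_neg LIMSEQ_const_iff flip: uminus_eq_scale)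
  thus ?thesis using c nrm_eq_0 eq_iff_minus by simp
qed

lemma lim_to_const: "x \<in> carrier A \<Longrightarrow> lim_to (\<lambda>n. x) x"
  by (simp add: lim_to_def a_minus_def r_neg)

end

lemma star_homD:
  assumes "\<phi> \<in> star_hom A B" "x \<in> carrier A"
  shows "\<phi> x \<in> carrier B" "\<phi> (scale A k x) = scale B k (\<phi> x)" "\<phi> (star A x) = star B (\<phi> x)"
    "y \<in> carrier A \<Longrightarrow> \<phi> (x \<oplus>\<^bsub>A\<^esub> y) = \<phi> x \<oplus>\<^bsub>B\<^esub> \<phi> y"
    "y \<in> carrier A \<Longrightarrow> \<phi> (x \<otimes>\<^bsub>A\<^esub> y) = \<phi> x \<otimes>\<^bsub>B\<^esub> \<phi> y"
  using assms unfolding star_hom_def by auto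

lemma star_hom_zero:
  assumes "cstar_algebra A" "cstar_algebra B" "\<phi> \<in> star_hom A B"
  shows "\<phi> \<zero>\<^bsub>A\<^esub> = \<zero>\<^bsub>B\<^esub>"
proof -
  interpret A: cstar_algebra A by fact
  interpret B: cstar_algebra B by fact
  have "\<phi> (scale A 0 \<zero>\<^bsub>A\<^esub>) = scale B 0 (\<phi> \<zero>\<^bsub>A\<^esub>)"
    by (rule star_homD(2)[OF assms(3)]) simp
  thus ?thesis using star_homD(1)[OF assms(3), of "\<zero>\<^bsub>A\<^esub>"] by simp
qed

lemma star_hom_minus:
  assumes "cstar_algebra A" "cstar_algebra B" "\<phi> \<in> star_hom A B" "x \<in> carrier A" "y \<in> carrier A"
  shows "\<phi> (x \<ominus>\<^bsub>A\<^esub> y) = \<phi> x \<ominus>\<^bsub>B\<^esub> \<phi> y"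
proof -
  interpret A: cstar_algebra A by fact
  interpret B: cstar_algebra B by fact
  show ?thesis using assms(4,5)
    by (simp add: a_minus_def A.uminus_eq_scale B.uminus_eq_scale A.scale_closed
        star_homD[OF assms(3)])
qed

lemma star_hom_comp: "\<phi> \<in> star_hom A B \<Longrightarrow> \<psi> \<in> star_hom B C \<Longrightarrow> \<psi> \<circ> \<phi> \<in> star_hom A C"
  unfolding star_hom_def by (auto simp: Pi_iff)

text \<open>Every *-homomorphism of C*-algebras is contractive, but that needs the spectral radius formula.
  The homomorphisms built here are contractive by construction, so contractivity is carried along.\<close>

definition contractive :: "('a, 'm) cstar_scheme \<Rightarrow> ('b, 'n) cstar_scheme \<Rightarrow> ('a \<Rightarrow> 'b) \<Rightarrow> bool" where
  "contractive A B \<phi> \<longleftrightarrow> \<phi> \<in> star_hom A B \<and> (\<forall>x\<in>carrier A. nrm B (\<phi> x) \<le> nrm A x)"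

lemma contractive_id: "contractive A A (\<lambda>x. x)"
  by (auto simp: contractive_def star_hom_def)

lemma contractive_comp:
  assumes "contractive A B \<phi>" "contractive B C \<psi>"
  shows "contractive A C (\<psi> \<circ> \<phi>)"
proof -
  have h: "\<phi> \<in> star_hom A B" "\<psi> \<in> star_hom B C" using assms by (simp_all add: contractive_def)
  have "nrm C (\<psi> (\<phi> x)) \<le> nrm A x" if x: "x \<in> carrier A" for x
  proof -
    have "nrm C (\<psi> (\<phi> x)) \<le> nrm B (\<phi> x)"
      using assms(2) star_homD(1)[OF h(1) x] by (simp add: contractive_def)
    also have "\<dots> \<le> nrm A x" using assms(1) x by (simp add: contractive_def)
    finally show ?thesis .
  qed
  thus ?thesis using star_hom_comp[OF h] by (simp add: contractive_def)
qed

lemma contractive_lim: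
  assumes "cstar_algebra A" "cstar_algebra B" "contractive A B \<phi>" "cstar_algebra.lim_to A X x"
  shows "cstar_algebra.lim_to B (\<lambda>n. \<phi> (X n)) (\<phi> x)"
proof -
  interpret A: cstar_algebra A by fact
  interpret B: cstar_algebra B by fact
  have h: "\<phi> \<in> star_hom A B" using assms by (simp add: contractive_def)
  have c: "X n \<in> carrier A" "x \<in> carrier A" for n using assms(4) by (auto simp: A.lim_to_def)
  show ?thesis
  proof (rule B.lim_to_by_bound)
    show "(\<lambda>n. nrm A (X n \<ominus>\<^bsub>A\<^esub> x)) \<longlonglongrightarrow> 0" using assms(4) by (simp add: A.lim_to_def)
    show "nrm B (\<phi> (X n) \<ominus>\<^bsub>B\<^esub> \<phi> x) \<le> nrm A (X n \<ominus>\<^bsub>A\<^esub> x)" for n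
      using assms(3) c unfolding contractive_def star_hom_minus[OF assms(1,2) h c(1) c(2), symmetric]
      by simp
  qed (use c star_homD(1)[OF h] in auto)
qed

text \<open>A homomorphism from a C*-algebra is determined by its values on a generating set; stated for
  contractive homomorphisms, for which continuity needs no spectral theory.\<close>

lemma contractive_eq_on_generators:
  assumes A: "cstar_algebra A" and B: "cstar_algebra B"
    and phi: "contractive A B \<phi>" and psi: "contractive A B \<psi>"
    and gen: "generates_cstar M A" and eq: "\<And>s. s \<in> M \<Longrightarrow> \<phi> s = \<psi> s"
    and x: "x \<in> carrier A"
  shows "\<phi> x = \<psi> x"
proof -
  interpret A: cstar_algebra A by fact
  interpret B: cstar_algebra B by fact
  have h: "\<phi> \<in> star_hom A B" "\<psi> \<in> star_hom A B" using phi psi by (simp_all add: contractive_def)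
  let ?H = "{x \<in> carrier A. \<phi> x = \<psi> x}"
  have "x \<in> ?H" if X: "\<forall>n. X n \<in> ?H" "(\<lambda>n. nrm A (X n \<ominus>\<^bsub>A\<^esub> x)) \<longlonglongrightarrow> 0" and "x \<in> carrier A" for X x
  proof -
    have l: "A.lim_to X x" using that by (simp add: A.lim_to_def)
    show ?thesis using B.lim_to_unique[OF contractive_lim[OF A B phi l]] contractive_lim[OF A B psi l] X that by simp
  qed
  hence "cstar_subalgebra ?H A"
    unfolding cstar_subalgebra_def using star_hom_zero[OF A B h(1)] star_hom_zero[OF A B h(2)]
    by (auto simp: star_homD[OF h(1)] star_homD[OF h(2)] A.mult_closed A.scale_closed A.star_closed)
  moreover have "M \<subseteq> ?H" using gen eq by (auto simp: generates_cstar_def)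
  ultimately show ?thesis using gen x unfolding generates_cstar_def by blast
qed

lemma mutually_inverse_on_generators:
  assumes A: "cstar_algebra A" and B: "cstar_algebra B"
    and phi: "contractive A B \<phi>" and psi: "contractive B A \<psi>"
    and genA: "generates_cstar M A" and genB: "generates_cstar U B"
    and "\<And>s. s \<in> M \<Longrightarrow> \<psi> (\<phi> s) = s" and "\<And>u. u \<in> U \<Longrightarrow> \<phi> (\<psi> u) = u"
  shows "\<forall>x\<in>carrier A. \<psi> (\<phi> x) = x" "\<forall>y\<in>carrier B. \<phi> (\<psi> y) = y" "cstar_isomorphic A B"
proof -
  show 1: "\<forall>x\<in>carrier A. \<psi> (\<phi> x) = x"
    using contractive_eq_on_generators[OF A A contractive_comp[OF phi psi] contractive_id genA] assms(7) by auto
  show 2: "\<forall>y\<in>carrier B. \<phi> (\<psi> y) = y"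
    using contractive_eq_on_generators[OF B B contractive_comp[OF psi phi] contractive_id genB] assms(8) by auto
  have "bij_betw \<phi> (carrier A) (carrier B)"
    by (rule bij_betw_byWitness[where f' = \<psi>])
      (use 1 2 phi psi star_homD(1) in \<open>auto simp: contractive_def\<close>)
  thus "cstar_isomorphic A B" using phi by (auto simp: cstar_isomorphic_def contractive_def)
qed

text \<open>Pulling closed subalgebras back along \<open>\<psi>\<close> shows that images of generators generate.\<close>

lemma generates_cstar_image:
  assumes A: "cstar_algebra A" and B: "cstar_algebra B" and psi: "contractive B A \<psi>"
    and gen: "generates_cstar U B" and surj: "carrier A \<subseteq> \<psi> ` carrier B"
  shows "generates_cstar (\<psi> ` U) A"
proof -
  interpret A: cstar_algebra A by fact
  interpret B: cstar_algebra B by fact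
  have h: "\<psi> \<in> star_hom B A" using psi by (simp add: contractive_def)
  have UB: "U \<subseteq> carrier B" using gen by (simp add: generates_cstar_def)
  have "H = carrier A" if H: "cstar_subalgebra H A" and U: "\<psi> ` U \<subseteq> H" for H
  proof -
    let ?H = "{y \<in> carrier B. \<psi> y \<in> H}"
    have "x \<in> ?H" if X: "\<forall>n. X n \<in> ?H" "(\<lambda>n. nrm B (X n \<ominus>\<^bsub>B\<^esub> x)) \<longlonglongrightarrow> 0" and "x \<in> carrier B" for X x
    proof -
      have l: "B.lim_to X x" using that by (simp add: B.lim_to_def)
      have "A.lim_to (\<lambda>n. \<psi> (X n)) (\<psi> x)" by (rule contractive_lim[OF B A psi l])
      moreover have "\<forall>n. \<psi> (X n) \<in> H" using X by simp
      ultimately have "\<psi> x \<in> H" using A.cstar_subalgebra_lim[OF H, of "\<lambda>n. \<psi> (X n)"] by simp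
      thus ?thesis using that by simp
    qed
    moreover have "\<psi> \<zero>\<^bsub>B\<^esub> \<in> H" using H star_hom_zero[OF B A h] by (simp add: cstar_subalgebra_def)
    ultimately have "cstar_subalgebra ?H B"
      using H unfolding cstar_subalgebra_def
      by (auto simp: star_homD[OF h] B.mult_closed B.scale_closed B.star_closed)
    hence "?H = carrier B" using gen U UB unfolding generates_cstar_def by auto
    hence "carrier A \<subseteq> H" using surj by auto
    thus ?thesis using H by (auto simp: cstar_subalgebra_def)
  qed
  thus ?thesis using UB star_homD(1)[OF h] by (auto simp: generates_cstar_def)
qed

section \<open>Unital C*-algebras and evaluation of *-polynomials\<close>

locale unital_cstar = cstar_algebra A + monoid A for A :: "('a, 'm) cstar_scheme" (structure)

sublocale unital_cstar \<subseteq> ring A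
  by unfold_locales (simp_all add: distrib_right distrib_left)

context unital_cstar
begin

lemma star_one [simp]: "star A \<one> = \<one>"
  by (metis l_one one_closed star_closed star_mult star_star)

lemma nrm_one_le: "nrm A \<one> \<le> 1"
proof -
  have "nrm A \<one> = (nrm A \<one>)\<^sup>2" using nrm_cstar[of \<one>] by simp
  thus ?thesis using nrm_nonneg[of \<one>]
    by (metis order_refl mult_cancel_left1 one_closed power2_eq_square zero_le_one)
qed

lemma nrm_isometry: assumes "isometry A x" shows "nrm A x \<le> 1"
proof -
  have "(nrm A x)\<^sup>2 \<le> 1" using assms nrm_cstar[of x] nrm_one_le by (simp add: isometry_def)
  thus ?thesis using power2_le_imp_le[of "nrm A x" 1] by simp
qed

lemma nrm_projection: assumes "projection A x" shows "nrm A x \<le> 1"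
proof -
  have "(nrm A x)\<^sup>2 = nrm A x" using assms nrm_cstar[of x] by (simp add: projection_def)
  thus ?thesis by (metis mult_cancel_left1 order_refl power2_eq_square zero_le_one)
qed

end

definition letter_val :: "('a, 'm) cstar_scheme \<Rightarrow> ('g \<Rightarrow> 'a) \<Rightarrow> 'g \<times> bool \<Rightarrow> 'a" where
  "letter_val A h l = (if snd l then star A (h (fst l)) else h (fst l))"

definition word_val :: "('a, 'm) cstar_scheme \<Rightarrow> ('g \<Rightarrow> 'a) \<Rightarrow> ('g \<times> bool) list \<Rightarrow> 'a" where
  "word_val A h ls = foldr (\<lambda>l y. letter_val A h l \<otimes>\<^bsub>A\<^esub> y) ls \<one>\<^bsub>A\<^esub>"

definition ev :: "('a, 'm) cstar_scheme \<Rightarrow> ('g \<Rightarrow> 'a) \<Rightarrow> 'g star_poly \<Rightarrow> 'a" where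
  "ev A h x = (\<Oplus>\<^bsub>A\<^esub>w\<in>Poly_Mapping.keys x. scale A (Poly_Mapping.lookup x w) (word_val A h (letters w)))"

text \<open>The family \<open>h\<close> is total; a family that is only given on a set of generators is extended by zero,
  which does not change its values on the *-algebra of these generators.\<close>

locale evaluation = unital_cstar A for A :: "('a, 'm) cstar_scheme" (structure) +
  fixes h :: "'g \<Rightarrow> 'a"
  assumes h_closed [simp]: "h g \<in> carrier A"
begin

lemma letter_val_closed [simp]: "letter_val A h l \<in> carrier A"
  by (simp add: letter_val_def star_closed)

lemma word_val_Nil: "word_val A h [] = \<one>"
  by (simp add: word_val_def)

lemma word_val_Cons: "word_val A h (l # ls) = letter_val A h l \<otimes> word_val A h ls"
  by (simp add: word_val_def)

lemma word_val_closed [simp]: "word_val A h ls \<in> carrier A"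
  by (induction ls) (simp_all add: word_val_Nil word_val_Cons)

lemma word_val_append: "word_val A h (ls @ ms) = word_val A h ls \<otimes> word_val A h ms"
  by (induction ls) (simp_all add: word_val_Nil word_val_Cons m_assoc)

lemma word_val_adj: "word_val A h (letters (word_adj w)) = star A (word_val A h (letters w))"
proof -
  have "word_val A h (rev (map (apsnd Not) ls)) = star A (word_val A h ls)" for ls
    by (induction ls)
      (auto simp: word_val_Nil word_val_Cons word_val_append letter_val_def star_mult star_star star_closed)
  thus ?thesis by (simp add: word_adj_def)
qed

lemma ev_superset:
  assumes "finite W" "Poly_Mapping.keys x \<subseteq> W"
  shows "ev A h x = (\<Oplus>w\<in>W. scale A (Poly_Mapping.lookup x w) (word_val A h (letters w)))"
  unfolding ev_def
  by (rule add.finprod_mono_neutral_cong_left)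
    (use assms in \<open>auto simp: scale_closed in_keys_iff\<close>)

lemma ev_closed [simp]: "ev A h x \<in> carrier A"
  unfolding ev_def by (rule finsum_closed) (simp add: scale_closed)

lemma ev_zero [simp]: "ev A h 0 = \<zero>"
  by (simp add: ev_def)

lemma ev_add: "ev A h (x + y) = ev A h x \<oplus> ev A h y"
proof -
  let ?W = "Poly_Mapping.keys x \<union> Poly_Mapping.keys y"
  have "Poly_Mapping.keys (x + y) \<subseteq> ?W" by (rule keys_add)
  hence "ev A h (x + y) = (\<Oplus>w\<in>?W. scale A (Poly_Mapping.lookup (x + y) w) (word_val A h (letters w)))"
    by (intro ev_superset) auto
  also have "\<dots> = (\<Oplus>w\<in>?W. scale A (Poly_Mapping.lookup x w) (word_val A h (letters w)) \<oplus>
      scale A (Poly_Mapping.lookup y w) (word_val A h (letters w)))"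
    by (simp add: lookup_add scale_add_left)
  also have "\<dots> = ev A h x \<oplus> ev A h y"
    by (subst finsum_addf) (auto simp: ev_superset[of ?W x] ev_superset[of ?W y] scale_closed)
  finally show ?thesis .
qed

lemma ev_single: "ev A h (Poly_Mapping.single w k) = scale A k (word_val A h (letters w))"
  by (subst ev_superset[of "{w}"]) (auto simp: scale_closed)

lemma ev_scale: "ev A h (poly_scale k x) = scale A k (ev A h x)"
proof (induction x rule: poly_induct)
  case (single w l)
  have "poly_scale k (Poly_Mapping.single w l) = Poly_Mapping.single w (k * l)"
    by (simp add: poly_scale_eq mult_single)
  thus ?case by (simp add: ev_single scale_scale)
next
  case zero
  show ?case by (simp add: poly_scale_eq)
qed (simp add: poly_scale_add ev_add scale_add_right)

lemma ev_mult: "ev A h (x * y) = ev A h x \<otimes> ev A h y"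
proof (induction x rule: poly_induct)
  case (single w k)
  show ?case
  proof (induction y rule: poly_induct)
    case (single v l)
    show ?case
      by (simp add: mult_single ev_single word_val_append scale_mult_left scale_mult_right scale_scale
          scale_closed mult.commute)
  qed (simp_all add: semiring_class.distrib_left ev_add r_distr)
qed (simp_all add: semiring_class.distrib_right ev_add l_distr)

lemma ev_star: "ev A h (poly_star x) = star A (ev A h x)"
  by (induction x rule: poly_induct)
    (simp_all add: poly_star_single poly_star_add ev_add ev_single star_add star_scale word_val_adj)

lemma ev_gen: "ev A h (poly_gen g) = h g"
  by (simp add: poly_gen_def ev_single word_val_Cons word_val_Nil letter_val_def scale_one)

lemma ev_diff: "ev A h (x - y) = ev A h x \<ominus> ev A h y"
  using ev_add[of x "poly_scale (-1) y"]
  by (simp add: ev_scale a_minus_def uminus_eq_scale) (simp add: poly_scale_neg_one)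

lemma cstar_seminorm_ev: "cstar_seminorm G (\<lambda>x. nrm A (ev A h x))"
  unfolding cstar_seminorm_def
  by (simp add: nrm_nonneg ev_mult ev_star nrm_cstar ev_scale nrm_scale ev_add nrm_triangle nrm_mult)

end

section \<open>Homomorphisms out of a completion\<close>

lemma tendsto_zero_le_half:
  fixes f :: "nat \<Rightarrow> real"
  assumes "\<And>n. 0 \<le> f n" and "\<And>e. 0 < e \<Longrightarrow> \<exists>M. \<forall>n\<ge>M. f n \<le> e / 2"
  shows "f \<longlonglongrightarrow> 0"
proof (rule LIMSEQ_I)
  fix e :: real assume e: "0 < e"
  obtain M where M: "\<forall>n\<ge>M. f n \<le> e / 2" using assms(2)[OF e] by blast
  have "norm (f n - 0) < e" if "n \<ge> M" for n
  proof -
    have "f n \<le> e / 2" using M that by blast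
    thus ?thesis using assms(1)[of n] e by simp
  qed
  thus "\<exists>M. \<forall>n\<ge>M. norm (f n - 0) < e" by blast
qed

context seminormed
begin

lemma completion_gen_eq: "completion_gen G p g = cls (\<lambda>n. poly_gen g)"
  by (simp add: completion_gen_def cls_def)

lemma completion_gen_closed: "g \<in> G \<Longrightarrow> completion_gen G p g \<in> carrier K"
  by (simp add: completion_gen_eq cauchy_const free_star_algebra_gen)

text \<open>Polynomials are dense: a class is the limit of the constant sequences at the terms of a
  representative.\<close>

lemma lim_to_const_cls:
  assumes "x \<in> C" shows "cstar_algebra.lim_to K (\<lambda>n. cls (\<lambda>_. x n)) (cls x)"
proof -
  interpret K: cstar_algebra K by (rule cstar_algebra_completion)
  have "(\<lambda>n. nrm K (cls (\<lambda>_. x n) \<ominus>\<^bsub>K\<^esub> cls x)) \<longlonglongrightarrow> 0"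
  proof (rule tendsto_zero_le_half)
    fix e :: real assume e: "0 < e"
    obtain N where N: "\<forall>m\<ge>N. \<forall>n\<ge>N. p (x m - x n) < e / 2"
      using cauchyD[OF assms half_gt_zero[OF e]] by blast
    have "nrm K (cls (\<lambda>_. x n) \<ominus>\<^bsub>K\<^esub> cls x) \<le> e / 2" if n: "n \<ge> N" for n
    proof (rule LIMSEQ_le_const2)
      show "(\<lambda>m. p (x n - x m)) \<longlonglongrightarrow> nrm K (cls (\<lambda>_. x n) \<ominus>\<^bsub>K\<^esub> cls x)"
        unfolding minus_cls[OF cauchy_const[OF cauchy_in[OF assms]] assms]
        by (rule nrm_cls_lim[OF cauchy_diff[OF cauchy_const[OF cauchy_in[OF assms]] assms]])
      show "\<exists>M. \<forall>m\<ge>M. p (x n - x m) \<le> e / 2" using N n by (meson less_imp_le)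
    qed
    thus "\<exists>M. \<forall>n\<ge>M. nrm K (cls (\<lambda>_. x n) \<ominus>\<^bsub>K\<^esub> cls x) \<le> e / 2" by blast
  next
    show "0 \<le> nrm K (cls (\<lambda>_. x n) \<ominus>\<^bsub>K\<^esub> cls x)" for n
      using assms by (intro K.nrm_nonneg K.minus_closed cls_in cauchy_const cauchy_in)
  qed
  thus ?thesis using assms unfolding K.lim_to_def by (simp add: cauchy_const)
qed

lemma cls_const_mem_subalgebra:
  assumes "cstar_subalgebra H K" "completion_gen G p ` G \<subseteq> H" "x \<in> F"
  shows "cls (\<lambda>_. x) \<in> H"
  using assms(3)
proof (induction x rule: free_star_algebra_induct)
  case zero
  show ?case using assms(1) by (simp add: cstar_subalgebra_def zero_cls)
next
  case (gen g)
  thus ?case using assms(2) by (auto simp: completion_gen_eq)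
next
  case (add x y)
  hence "cls (\<lambda>_. x) \<oplus>\<^bsub>K\<^esub> cls (\<lambda>_. y) \<in> H" using assms(1) by (simp add: cstar_subalgebra_def)
  thus ?case using add by (simp add: add_cls cauchy_const)
next
  case (mult x y)
  hence "cls (\<lambda>_. x) \<otimes>\<^bsub>K\<^esub> cls (\<lambda>_. y) \<in> H" using assms(1) by (simp add: cstar_subalgebra_def)
  thus ?case using mult by (simp add: mult_cls cauchy_const)
next
  case (scale k x)
  hence "Defs.scale K k (cls (\<lambda>_. x)) \<in> H" using assms(1) by (simp add: cstar_subalgebra_def)
  thus ?case using scale by (simp add: scale_cls cauchy_const)
next
  case (star x)
  hence "Defs.star K (cls (\<lambda>_. x)) \<in> H" using assms(1) by (simp add: cstar_subalgebra_def)
  thus ?case using star by (simp add: star_cls cauchy_const)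
qed

lemma generates_completion: "generates_cstar (completion_gen G p ` G) K"
proof -
  interpret K: cstar_algebra K by (rule cstar_algebra_completion)
  have "carrier K \<subseteq> H" if "cstar_subalgebra H K" "completion_gen G p ` G \<subseteq> H" for H
  proof
    fix X assume "X \<in> carrier K"
    then obtain x where x: "x \<in> C" "X = cls x" by (rule carrier_cases)
    show "X \<in> H" unfolding x(2)
      by (rule K.cstar_subalgebra_lim[OF that(1) _ lim_to_const_cls[OF x(1)]])
        (use cls_const_mem_subalgebra[OF that] cauchy_in[OF x(1)] in blast)
  qed
  thus ?thesis using completion_gen_closed by (auto simp: generates_cstar_def cstar_subalgebra_def)
qed

end

text \<open>Completions have this property, as their field \<open>one\<close> is the identity element when there is one. So
  a unit need only be exhibited, not matched with that field.\<close>

definition unit_determined :: "('a, 'm) cstar_scheme \<Rightarrow> bool" where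
  "unit_determined A \<longleftrightarrow> (\<forall>u\<in>carrier A. (\<forall>x\<in>carrier A. u \<otimes>\<^bsub>A\<^esub> x = x \<and> x \<otimes>\<^bsub>A\<^esub> u = x) \<longrightarrow> \<one>\<^bsub>A\<^esub> = u)"

lemma (in seminormed) unit_determined_completion: "unit_determined K"
proof -
  have one: "\<one>\<^bsub>K\<^esub> = (THE u. u \<in> carrier K \<and> (\<forall>x\<in>carrier K. u \<otimes>\<^bsub>K\<^esub> x = x \<and> x \<otimes>\<^bsub>K\<^esub> u = x))"
    by (simp add: completion_def)
  have "\<one>\<^bsub>K\<^esub> = u" if "u \<in> carrier K" "\<forall>x\<in>carrier K. u \<otimes>\<^bsub>K\<^esub> x = x \<and> x \<otimes>\<^bsub>K\<^esub> u = x" for u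
    unfolding one by (rule the_equality) (use that in metis)+
  thus ?thesis by (simp add: unit_determined_def)
qed

lemma unit_determined_monoid:
  assumes "cstar_algebra A" "unit_determined A" "u \<in> carrier A"
    and "\<And>x. x \<in> carrier A \<Longrightarrow> u \<otimes>\<^bsub>A\<^esub> x = x \<and> x \<otimes>\<^bsub>A\<^esub> u = x"
  shows "\<one>\<^bsub>A\<^esub> = u" "monoid A"
proof -
  interpret cstar_algebra A by fact
  show 1: "\<one>\<^bsub>A\<^esub> = u" using assms unfolding unit_determined_def by blast
  show "monoid A" by (rule monoidI) (use assms 1 mult_closed mult_assoc in auto)
qed

text \<open>A C*-seminorm dominating the pulled back norm of \<open>B\<close> lets the evaluation extend to the
  completion by continuity.\<close>

locale completion_map = seminormed G p + evaluation B h
  for G :: "'g set" and p and B :: "('b, 'm) cstar_scheme" and h :: "'g \<Rightarrow> 'b" +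
  assumes dominated: "x \<in> free_star_algebra G \<Longrightarrow> nrm B (ev B h x) \<le> p x"
begin

definition ext :: "(nat \<Rightarrow> 'g star_poly) set \<Rightarrow> 'b" where
  "ext X = (SOME y. \<exists>x\<in>C. X = cls x \<and> lim_to (\<lambda>n. ev B h (x n)) y)"

lemma ev_convergent: assumes "x \<in> C" shows "\<exists>y. lim_to (\<lambda>n. ev B h (x n)) y"
proof -
  have "\<exists>M. \<forall>m\<ge>M. \<forall>n\<ge>M. nrm B (ev B h (x m) \<ominus>\<^bsub>B\<^esub> ev B h (x n)) < e" if e: "0 < e" for e
  proof -
    obtain M where M: "\<forall>m\<ge>M. \<forall>n\<ge>M. p (x m - x n) < e" using cauchyD[OF assms e] by blast
    have "nrm B (ev B h (x m) \<ominus>\<^bsub>B\<^esub> ev B h (x n)) < e" if "m \<ge> M" "n \<ge> M" for m n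
      using dominated[OF free_star_algebra_diff[OF cauchy_in[OF assms, of m] cauchy_in[OF assms, of n]]] M that
      by (auto simp: ev_diff intro: order_le_less_trans)
    thus ?thesis by blast
  qed
  from complete[OF ev_closed this] show ?thesis by (auto simp: lim_to_def)
qed

lemma ext_cls:
  assumes "x \<in> C" "lim_to (\<lambda>n. ev B h (x n)) y"
  shows "ext (cls x) = y"
proof -
  have "y' = y" if x': "x' \<in> C" "cls x = cls x'" "lim_to (\<lambda>n. ev B h (x' n)) y'" for x' y'
  proof -
    have d: "(\<lambda>n. p (x n - x' n)) \<longlonglongrightarrow> 0" using x' assms(1) by (simp add: cls_eq_iff)
    have "lim_to (\<lambda>n. ev B h (x n - x' n)) \<zero>\<^bsub>B\<^esub>"
      by (rule lim_to_by_bound[OF _ _ d])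
        (use dominated[OF free_star_algebra_diff[OF cauchy_in[OF assms(1)] cauchy_in[OF x'(1)]]] in \<open>simp_all add: a_minus_def\<close>)
    from lim_to_add[OF this x'(3)] have "lim_to (\<lambda>n. ev B h (x n)) y'"
      using x'(3) by (simp add: lim_to_def flip: ev_add)
    thus ?thesis using lim_to_unique assms(2) by blast
  qed
  note uniq = this
  show ?thesis unfolding ext_def
  proof (rule some_equality)
    show "\<exists>x'\<in>C. cls x = cls x' \<and> lim_to (\<lambda>n. ev B h (x' n)) y" using assms by blast
    fix y' assume "\<exists>x'\<in>C. cls x = cls x' \<and> lim_to (\<lambda>n. ev B h (x' n)) y'"
    then obtain x' where "x' \<in> C" "cls x = cls x'" "lim_to (\<lambda>n. ev B h (x' n)) y'" by blast
    thus "y' = y" by (rule uniq)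
  qed
qed

lemma lim_ext: "x \<in> C \<Longrightarrow> lim_to (\<lambda>n. ev B h (x n)) (ext (cls x))"
  using ev_convergent[of x] ext_cls[of x] by auto

lemma ext_closed: "X \<in> carrier K \<Longrightarrow> ext X \<in> carrier B"
  using lim_ext by (auto elim!: carrier_cases simp: lim_to_def)

lemma ext_contractive: "contractive K B ext"
proof -
  have "ext \<in> star_hom K B"
    unfolding star_hom_def
  proof (intro CollectI conjI ballI allI)
    show "ext \<in> carrier K \<rightarrow> carrier B" using ext_closed by blast
  next
    fix X Y assume "X \<in> carrier K" "Y \<in> carrier K"
    then obtain x y where x: "x \<in> C" "X = cls x" and y: "y \<in> C" "Y = cls y" by (metis carrier_cases)
    show "ext (X \<oplus>\<^bsub>K\<^esub> Y) = ext X \<oplus>\<^bsub>B\<^esub> ext Y"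
      using lim_to_add[OF lim_ext[OF x(1)] lim_ext[OF y(1)]] ext_cls[OF cauchy_add[OF x(1) y(1)]] x y
      by (simp add: add_cls ev_add)
    show "ext (X \<otimes>\<^bsub>K\<^esub> Y) = ext X \<otimes>\<^bsub>B\<^esub> ext Y"
      using lim_to_mult[OF lim_ext[OF x(1)] lim_ext[OF y(1)]] ext_cls[OF cauchy_mult[OF x(1) y(1)]] x y
      by (simp add: mult_cls ev_mult)
  next
    fix X k assume "X \<in> carrier K"
    then obtain x where x: "x \<in> C" "X = cls x" by (metis carrier_cases)
    show "ext (scale K k X) = scale B k (ext X)"
      using lim_to_scale[OF lim_ext[OF x(1)], of k] ext_cls[OF cauchy_scale[OF x(1)], of k] x
      by (simp add: scale_cls ev_scale)
    show "ext (star K X) = star B (ext X)"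
      using lim_to_star[OF lim_ext[OF x(1)]] ext_cls[OF cauchy_star[OF x(1)]] x
      by (simp add: star_cls ev_star)
  qed
  moreover have "nrm B (ext X) \<le> nrm K X" if X: "X \<in> carrier K" for X
  proof -
    obtain x where x: "x \<in> C" "X = cls x" "(\<lambda>n. p (x n)) \<longlonglongrightarrow> nrm K X" using nrm_eq_lim[OF X] .
    show ?thesis unfolding x(2)
      by (rule LIMSEQ_le[OF lim_to_nrm[OF lim_ext[OF x(1)]] nrm_cls_lim[OF x(1)]])
        (use dominated cauchy_in[OF x(1)] in blast)
  qed
  ultimately show ?thesis by (simp add: contractive_def)
qed

lemma ext_gen: "g \<in> G \<Longrightarrow> ext (completion_gen G p g) = h g"
  unfolding completion_gen_eq
  by (rule ext_cls) (simp_all add: cauchy_const free_star_algebra_gen ev_gen lim_to_const)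

lemma ext_isometric:
  assumes "\<And>x. x \<in> free_star_algebra G \<Longrightarrow> p x = nrm B (ev B h x)" "X \<in> carrier K"
  shows "nrm B (ext X) = nrm K X"
proof -
  obtain x where x: "x \<in> C" "X = cls x" "(\<lambda>n. p (x n)) \<longlonglongrightarrow> nrm K X" using nrm_eq_lim[OF assms(2)] .
  have "(\<lambda>n. p (x n)) \<longlonglongrightarrow> nrm B (ext X)"
    using lim_to_nrm[OF lim_ext[OF x(1)]] x by (simp add: assms(1))
  thus ?thesis using x(3) LIMSEQ_unique by blast
qed

end

section \<open>The universal C*-algebra of a set of relations\<close>

text \<open>A family \<open>\<Theta>\<close> of representations of \<open>A\<close>, each recorded with its target and with the image of
  the generating family \<open>g\<close>, is jointly faithful if only \<open>0\<close> is annihilated by all of them. Relations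
  that hold in every target of a jointly faithful family hold in \<open>A\<close>; this is the property of
  relations which makes the supremum of the admissible seminorms admissible.\<close>

definition jointly_faithful ::
    "('a, 'm) cstar_scheme \<Rightarrow> 'g set \<Rightarrow> ('g \<Rightarrow> 'a) \<Rightarrow> (('b, 'n) cstar_scheme \<times> ('g \<Rightarrow> 'b) \<times> ('a \<Rightarrow> 'b)) set \<Rightarrow> bool" where
  "jointly_faithful A G g \<Theta> \<longleftrightarrow> cstar_algebra A \<and> unit_determined A \<and> g ` G \<subseteq> carrier A \<and>
     (\<forall>(B, h, \<phi>)\<in>\<Theta>. cstar_algebra B \<and> \<phi> \<in> star_hom A B \<and> (\<forall>x\<in>G. \<phi> (g x) = h x)) \<and>
     (\<forall>x\<in>carrier A. (\<forall>(B, h, \<phi>)\<in>\<Theta>. \<phi> x = \<zero>\<^bsub>B\<^esub>) \<longrightarrow> x = \<zero>\<^bsub>A\<^esub>)"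

lemma (in seminormed) jointly_faithful_trivial:
  assumes "\<And>x. x \<in> F \<Longrightarrow> p x = 0"
  shows "jointly_faithful K G (completion_gen G p) {}"
proof -
  have "X = \<zero>\<^bsub>K\<^esub>" if X: "X \<in> carrier K" for X
  proof -
    obtain x where x: "x \<in> C" "X = cls x" using X by (rule carrier_cases)
    have "p (x n - 0) = 0" for n using assms x(1) by simp
    hence "cls x = cls (\<lambda>n. 0)"
      by (intro iffD2[OF cls_eq_iff[OF x(1) cauchy_const[OF free_star_algebra_zero]]]) simp
    thus ?thesis by (simp only: x(2) zero_cls)
  qed
  thus ?thesis unfolding jointly_faithful_def
    using cstar_algebra_completion unit_determined_completion completion_gen_closed by blast
qed

text \<open>Here \<open>reflect\<close> is the inheritance property just described, for representations in algebras of
  the same type as the completions, and \<open>gen_bound\<close> is what makes the supremum finite.\<close>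

locale presentation =
  fixes G :: "'g set" and R :: "'g relations"
  assumes reflect: "\<And>p \<Theta>. jointly_faithful (completion G p) G (completion_gen G p) \<Theta> \<Longrightarrow>
      (\<And>B h \<phi>. (B, h, \<phi>) \<in> \<Theta> \<Longrightarrow> R B h) \<Longrightarrow> R (completion G p) (completion_gen G p)"
    and unital: "\<And>p. cstar_seminorm G p \<Longrightarrow> R (completion G p) (completion_gen G p) \<Longrightarrow> monoid (completion G p)"
    and gen_bound: "\<And>p g. cstar_seminorm G p \<Longrightarrow> R (completion G p) (completion_gen G p) \<Longrightarrow> g \<in> G \<Longrightarrow>
      nrm (completion G p) (completion_gen G p g) \<le> 1"
begin

definition Adm :: "('g star_poly \<Rightarrow> real) set" where
  "Adm = {p. cstar_seminorm G p \<and> R (completion G p) (completion_gen G p)}"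

abbreviation "FA \<equiv> free_star_algebra G"
abbreviation "N \<equiv> universal_norm G R"
abbreviation "U \<equiv> universal_cstar G R"
definition "gen = completion_gen G N"

lemma seminormed_Adm: "p \<in> Adm \<Longrightarrow> seminormed G p"
  by (simp add: Adm_def seminormed_def)

text \<open>A supremum of reals over the empty set would be meaningless. The zero seminorm is admissible
  because its completion is zero, where even the empty family is jointly faithful.\<close>

lemma Adm_zero: "(\<lambda>_. 0) \<in> Adm"
proof -
  have c: "cstar_seminorm G (\<lambda>_. 0)" by (simp add: cstar_seminorm_def)
  hence "jointly_faithful (completion G (\<lambda>_. 0)) G (completion_gen G (\<lambda>_. 0))
      ({} :: ((nat \<Rightarrow> 'g star_poly) set cstar \<times> _ \<times> _) set)"
    by (intro seminormed.jointly_faithful_trivial) (simp_all add: seminormed_def)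
  from reflect[OF this] show ?thesis using c by (simp add: Adm_def)
qed

lemma Adm_bounded: assumes "x \<in> FA" shows "\<exists>b. \<forall>p\<in>Adm. p x \<le> b"
  using assms
proof (induction x rule: free_star_algebra_induct)
  case zero
  show ?case using seminormed.p_zero[OF seminormed_Adm] by (metis order_refl)
next
  case (gen g)
  have "p (poly_gen g) \<le> 1" if "p \<in> Adm" for p
  proof -
    interpret seminormed G p by (rule seminormed_Adm[OF that])
    show ?thesis using gen_bound[of p g] gen that
      by (simp add: Adm_def completion_gen_eq nrm_cls_const free_star_algebra_gen)
  qed
  thus ?case by blast
next
  case (add x y)
  then obtain a b where "\<forall>p\<in>Adm. p x \<le> a" "\<forall>p\<in>Adm. p y \<le> b" by auto
  hence "p (x + y) \<le> a + b" if "p \<in> Adm" for p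
    using seminormed.p_add[OF seminormed_Adm[OF that] add(1,2)] that by fastforce
  thus ?case by blast
next
  case (mult x y)
  then obtain a b where ab: "\<forall>p\<in>Adm. p x \<le> a" "\<forall>p\<in>Adm. p y \<le> b" by auto
  have "p (x * y) \<le> a * b" if "p \<in> Adm" for p
  proof -
    interpret seminormed G p by (rule seminormed_Adm[OF that])
    have "p x * p y \<le> a * b"
      using ab that p_nonneg[OF mult(1)] p_nonneg[OF mult(2)] by (intro mult_mono) (auto intro: order_trans)
    thus ?thesis using p_mult[OF mult(1,2)] by simp
  qed
  thus ?case by blast
next
  case (scale k x)
  then obtain a where "\<forall>p\<in>Adm. p x \<le> a" by auto
  hence "p (poly_scale k x) \<le> cmod k * a" if "p \<in> Adm" for p
    using seminormed.p_scale[OF seminormed_Adm[OF that] scale(1), of k] that by (simp add: mult_left_mono)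
  thus ?case by blast
next
  case (star x)
  then obtain a where "\<forall>p\<in>Adm. p x \<le> a" by auto
  hence "p (poly_star x) \<le> a" if "p \<in> Adm" for p
    using seminormed.p_star[OF seminormed_Adm[OF that] star(1)] that by simp
  thus ?case by blast
qed

lemma Adm_le: assumes "p \<in> Adm" "x \<in> FA" shows "p x \<le> N x"
  unfolding universal_norm_def Adm_def[symmetric]
  by (rule cSUP_upper) (use assms Adm_bounded[OF assms(2)] in \<open>auto simp: bdd_above_def\<close>)

lemma N_least: assumes "\<And>p. p \<in> Adm \<Longrightarrow> p x \<le> b" shows "N x \<le> b"
  unfolding universal_norm_def Adm_def[symmetric]
  by (rule cSUP_least) (use assms Adm_zero in auto)

lemma N_nonneg: "x \<in> FA \<Longrightarrow> 0 \<le> N x"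
  using Adm_le[OF Adm_zero] by simp

lemma cstar_seminorm_N: "cstar_seminorm G N"
  unfolding cstar_seminorm_def
proof (intro ballI conjI allI)
  fix x assume x: "x \<in> FA"
  show "0 \<le> N x" by (rule N_nonneg[OF x])
  show "N (poly_star x * x) = (N x)\<^sup>2"
  proof (rule antisym)
    show "N (poly_star x * x) \<le> (N x)\<^sup>2"
    proof (rule N_least)
      fix p assume p: "p \<in> Adm"
      interpret seminormed G p by (rule seminormed_Adm[OF p])
      show "p (poly_star x * x) \<le> (N x)\<^sup>2"
        unfolding p_cstar[OF x] using Adm_le[OF p x] p_nonneg[OF x] by (rule power_mono)
    qed
    have "N x \<le> sqrt (N (poly_star x * x))"
    proof (rule N_least)
      fix p assume p: "p \<in> Adm"
      interpret seminormed G p by (rule seminormed_Adm[OF p])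
      have "(p x)\<^sup>2 \<le> N (poly_star x * x)"
        using Adm_le[OF p, of "poly_star x * x"] x by (simp add: p_cstar free_star_algebra_closed)
      thus "p x \<le> sqrt (N (poly_star x * x))" by (rule real_le_rsqrt)
    qed
    moreover have "0 \<le> N (poly_star x * x)" using x by (intro N_nonneg free_star_algebra_closed)
    ultimately show "(N x)\<^sup>2 \<le> N (poly_star x * x)"
      using N_nonneg[OF x] by (metis power_mono real_sqrt_pow2)
  qed
  show scale: "N (poly_scale k x) = cmod k * N x" for k
  proof -
    have le: "N (poly_scale k x) \<le> cmod k * N x" if x: "x \<in> FA" for k x
    proof (rule N_least)
      fix p assume p: "p \<in> Adm"
      interpret seminormed G p by (rule seminormed_Adm[OF p])
      show "p (poly_scale k x) \<le> cmod k * N x"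
        unfolding p_scale[OF x] using Adm_le[OF p x] by (simp add: mult_left_mono)
    qed
    show ?thesis
    proof (cases "k = 0")
      case True
      thus ?thesis using le[OF x, of 0] N_nonneg[of 0] by simp
    next
      case False
      have "N x \<le> cmod (inverse k) * N (poly_scale k x)"
        using le[OF free_star_algebra_scale[OF x], of "inverse k" k] False
        by (simp add: poly_scale_scale poly_scale_one)
      hence "cmod k * N x \<le> cmod k * (cmod (inverse k) * N (poly_scale k x))"
        by (intro mult_left_mono) simp_all
      also have "\<dots> = N (poly_scale k x)" using False by (simp add: norm_inverse)
      finally show ?thesis using le[OF x, of k] by simp
    qed
  qed
  fix y assume y: "y \<in> FA"
  show "N (x + y) \<le> N x + N y"
  proof (rule N_least)
    fix p assume p: "p \<in> Adm"
    interpret seminormed G p by (rule seminormed_Adm[OF p])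
    show "p (x + y) \<le> N x + N y" using p_add[OF x y] Adm_le[OF p x] Adm_le[OF p y] by simp
  qed
  show "N (x * y) \<le> N x * N y"
  proof (rule N_least)
    fix p assume p: "p \<in> Adm"
    interpret seminormed G p by (rule seminormed_Adm[OF p])
    have "p x * p y \<le> N x * N y"
      using Adm_le[OF p x] Adm_le[OF p y] p_nonneg[OF x] p_nonneg[OF y] N_nonneg[OF x] by (intro mult_mono)
    thus "p (x * y) \<le> N x * N y" using p_mult[OF x y] by simp
  qed
qed

sublocale universal: seminormed G N
  by unfold_locales (rule cstar_seminorm_N)

lemma universal_cstar_algebra: "cstar_algebra U"
  unfolding universal_cstar_def by (rule universal.cstar_algebra_completion)

lemma generates_universal: "generates_cstar (gen ` G) U"
  unfolding universal_cstar_def gen_def by (rule universal.generates_completion)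

lemma completion_map_h:
  assumes "cstar_algebra B" "monoid B" "h ` G \<subseteq> carrier B" "cstar_seminorm G p"
    and "\<And>x. x \<in> FA \<Longrightarrow> nrm B (ev B (\<lambda>g. if g \<in> G then h g else \<zero>\<^bsub>B\<^esub>) x) \<le> p x"
  shows "completion_map G p B (\<lambda>g. if g \<in> G then h g else \<zero>\<^bsub>B\<^esub>)"
proof -
  interpret B: unital_cstar B using assms(1,2) by (simp add: unital_cstar_def)
  show ?thesis by unfold_locales (use assms in auto)
qed

text \<open>The completions for the admissible seminorms are jointly faithful on the universal algebra. For
  polynomials this is clear; for a Cauchy sequence \<open>x\<close> with \<open>q (x n) \<longlongrightarrow> 0\<close> for every admissible \<open>q\<close>, the
  Cauchy condition for the supremum makes this convergence uniform in \<open>q\<close>.\<close>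

lemma universal_relations: "R U gen"
proof -
  define h where "h q = (\<lambda>g. if g \<in> G then completion_gen G q g else \<zero>\<^bsub>completion G q\<^esub>)" for q
  have cm: "completion_map G N (completion G q) (h q)" if q: "q \<in> Adm" for q
    unfolding h_def
  proof (rule completion_map_h)
    interpret q: seminormed G q by (rule seminormed_Adm[OF q])
    show Q: "cstar_algebra (completion G q)" by (rule q.cstar_algebra_completion)
    show M: "monoid (completion G q)" using unital q by (simp add: Adm_def)
    show "completion_gen G q ` G \<subseteq> carrier (completion G q)" using q.completion_gen_closed by blast
    show "cstar_seminorm G N" by (rule cstar_seminorm_N)
    interpret Q: unital_cstar "completion G q" using Q M by (simp add: unital_cstar_def)
    interpret e: evaluation "completion G q" "h q"
      by unfold_locales (simp add: h_def q.completion_gen_closed)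
    fix x assume x: "x \<in> FA"
    have "ev (completion G q) (h q) x = q.cls (\<lambda>_. x)" using x
    proof (induction x rule: free_star_algebra_induct)
      case zero thus ?case by (simp add: q.zero_cls)
    next
      case (gen g) thus ?case by (simp add: e.ev_gen) (simp add: h_def q.completion_gen_eq)
    qed (simp_all add: e.ev_add e.ev_mult e.ev_scale e.ev_star q.cls_simps q.cauchy_const)
    thus "nrm (completion G q) (ev (completion G q) (\<lambda>g. if g \<in> G then completion_gen G q g
        else \<zero>\<^bsub>completion G q\<^esub>) x) \<le> N x"
      using Adm_le[OF q x] q.nrm_cls_const[OF x] by (simp add: h_def)
  qed
  define \<Theta> where "\<Theta> = {(completion G q, completion_gen G q, completion_map.ext G N (completion G q) (h q)) |q. q \<in> Adm}"
  have "jointly_faithful U G gen \<Theta>"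
    unfolding jointly_faithful_def
  proof (intro conjI ballI impI)
    show "cstar_algebra U" by (rule universal_cstar_algebra)
    show "unit_determined U" unfolding universal_cstar_def by (rule universal.unit_determined_completion)
    show "gen ` G \<subseteq> carrier U" using generates_universal by (simp add: generates_cstar_def)
    fix P assume "P \<in> \<Theta>"
    then obtain q where q: "q \<in> Adm"
      and P: "P = (completion G q, completion_gen G q, completion_map.ext G N (completion G q) (h q))"
      by (auto simp: \<Theta>_def)
    interpret completion_map G N "completion G q" "h q" by (rule cm[OF q])
    have "ext (gen g) = completion_gen G q g" if "g \<in> G" for g
      using ext_gen[OF that] that by (simp add: gen_def h_def)
    thus "case P of (B, h, \<phi>) \<Rightarrow> cstar_algebra B \<and> \<phi> \<in> star_hom U B \<and> (\<forall>x\<in>G. \<phi> (gen x) = h x)"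
      using ext_contractive seminormed.cstar_algebra_completion[OF seminormed_Adm[OF q]]
      by (simp add: P contractive_def universal_cstar_def)
  next
    fix X assume X: "X \<in> carrier U" and 0: "\<forall>(B, h, \<phi>)\<in>\<Theta>. \<phi> X = \<zero>\<^bsub>B\<^esub>"
    obtain x where x: "x \<in> universal.C" "X = universal.cls x"
      using X unfolding universal_cstar_def by (rule universal.carrier_cases)
    have q0: "(\<lambda>n. q (x n)) \<longlonglongrightarrow> 0" if q: "q \<in> Adm" for q
    proof -
      interpret q: seminormed G q by (rule seminormed_Adm[OF q])
      interpret completion_map G N "completion G q" "h q" by (rule cm[OF q])
      have "ext X = \<zero>\<^bsub>completion G q\<^esub>" using 0 q by (auto simp: \<Theta>_def)
      hence "lim_to (\<lambda>n. ev (completion G q) (h q) (x n)) \<zero>\<^bsub>completion G q\<^esub>"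
        using lim_ext[OF x(1)] x(2) by simp
      from lim_to_nrm[OF this] have "(\<lambda>n. nrm (completion G q) (ev (completion G q) (h q) (x n))) \<longlonglongrightarrow> 0" by simp
      moreover have "nrm (completion G q) (ev (completion G q) (h q) y) = q y" if "y \<in> FA" for y
      proof -
        have "ev (completion G q) (h q) y = q.cls (\<lambda>_. y)" using that
        proof (induction y rule: free_star_algebra_induct)
          case zero thus ?case by (simp add: q.zero_cls)
        next
          case (gen g) thus ?case by (simp add: ev_gen) (simp add: h_def q.completion_gen_eq)
        qed (simp_all add: ev_add ev_mult ev_scale ev_star q.cls_simps q.cauchy_const)
        thus ?thesis using q.nrm_cls_const[OF that] by simp
      qed
      ultimately show ?thesis using universal.cauchy_in[OF x(1)] by simp
    qed
    have "(\<lambda>n. N (x n)) \<longlonglongrightarrow> 0"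
    proof (rule tendsto_zero_le_half)
      fix e :: real assume e: "0 < e"
      obtain M where M: "\<forall>m\<ge>M. \<forall>n\<ge>M. N (x m - x n) < e/2"
        using universal.cauchyD[OF x(1) half_gt_zero[OF e]] by blast
      have "N (x n) \<le> e/2" if n: "n \<ge> M" for n
      proof (rule N_least)
        fix q assume q: "q \<in> Adm"
        interpret q: seminormed G q by (rule seminormed_Adm[OF q])
        have "q (x n) \<le> e/2 + q (x m)" if m: "m \<ge> M" for m
        proof -
          have xF: "x n \<in> FA" "x m \<in> FA" using universal.cauchy_in[OF x(1)] by auto
          have "N (x n - x m) < e/2" using M n m by blast
          thus ?thesis
            using q.p_diff[OF xF] Adm_le[OF q free_star_algebra_diff[OF xF]] by linarith
        qed
        hence "eventually (\<lambda>m. q (x n) \<le> e/2 + q (x m)) sequentially"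
          using eventually_ge_at_top[of M] by (rule eventually_mono[rotated])
        hence "q (x n) \<le> e/2 + 0"
          by (rule tendsto_lowerbound[OF tendsto_add[OF tendsto_const q0[OF q]]]) simp
        thus "q (x n) \<le> e/2" by simp
      qed
      thus "\<exists>M. \<forall>n\<ge>M. N (x n) \<le> e/2" by blast
    qed (rule N_nonneg[OF universal.cauchy_in[OF x(1)]])
    thus "X = \<zero>\<^bsub>U\<^esub>"
      unfolding universal_cstar_def universal.zero_cls x(2)
      using x(1) by (simp add: universal.cls_eq_iff universal.cauchy_const)
  qed
  thus ?thesis unfolding universal_cstar_def gen_def
    by (rule reflect) (auto simp: \<Theta>_def Adm_def)
qed

lemma universal_monoid: "monoid U"
  using unital[OF cstar_seminorm_N] universal_relations by (simp add: universal_cstar_def gen_def)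

text \<open>Since the target may have any type, the last hypothesis asks for the relations in the
  completion for the pulled back norm, whose elements have the type of the universal algebra.\<close>

lemma universal_property:
  fixes B :: "('b, 'm) cstar_scheme"
  assumes B: "cstar_algebra B" "monoid B" "h ` G \<subseteq> carrier B"
    and R: "\<And>p \<phi>. jointly_faithful (completion G p) G (completion_gen G p) {(B, h, \<phi>)} \<Longrightarrow>
      R (completion G p) (completion_gen G p)"
  shows "\<exists>\<phi>. contractive U B \<phi> \<and> (\<forall>g\<in>G. \<phi> (gen g) = h g)"
proof -
  let ?h = "\<lambda>g. if g \<in> G then h g else \<zero>\<^bsub>B\<^esub>"
  interpret B: unital_cstar B using B(1,2) by (simp add: unital_cstar_def)
  interpret e: evaluation B ?h by unfold_locales (use B(3) in auto)
  let ?p = "\<lambda>x. nrm B (ev B ?h x)"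
  have p: "cstar_seminorm G ?p" by (rule e.cstar_seminorm_ev)
  interpret c: completion_map G ?p B ?h
    by (rule completion_map_h[OF B p]) simp
  have "jointly_faithful (completion G ?p) G (completion_gen G ?p) {(B, h, c.ext)}"
    unfolding jointly_faithful_def
  proof (intro conjI ballI impI)
    fix X assume X: "X \<in> carrier c.K" and "\<forall>(B, h, \<phi>)\<in>{(B, h, c.ext)}. \<phi> X = \<zero>\<^bsub>B\<^esub>"
    hence "nrm c.K X = 0" using c.ext_isometric[OF _ X] by simp
    thus "X = \<zero>\<^bsub>c.K\<^esub>" using cstar_algebra.nrm_eq_0[OF c.cstar_algebra_completion X] by simp
  qed (use B c.cstar_algebra_completion c.unit_determined_completion c.completion_gen_closed
      c.ext_contractive c.ext_gen in \<open>auto simp: contractive_def\<close>)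
  from R[OF this] have "?p \<in> Adm" using p by (simp add: Adm_def)
  hence "completion_map G N B ?h"
    by (intro completion_map_h[OF B cstar_seminorm_N] Adm_le)
  then interpret n: completion_map G N B ?h .
  show ?thesis using n.ext_contractive n.ext_gen by (auto simp: universal_cstar_def gen_def)
qed

end

section \<open>Isometries whose range projections sum to one\<close>

lemma sum_roots_of_unity:
  assumes "0 < i" "i < n"
  shows "(\<Sum>j<n. cis (2 * pi / n) ^ (j * i)) = 0"
proof -
  let ?z = "cis (2 * pi / n) ^ i"
  have z: "?z = cis (2 * pi * (i / n))" by (simp add: DeMoivre mult.commute)
  have "?z \<noteq> 1"
  proof
    assume "?z = 1"
    hence "cos (2 * pi * (i / n)) = 1" unfolding z by (metis cis.sel(1) one_complex.sel(1))
    then obtain k :: int where "2 * pi * (i / n) = of_int k * 2 * pi" using cos_one_2pi_int by blast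
    hence "2 * pi * (real i / n - of_int k) = 0" by (simp add: algebra_simps)
    hence "real i / n = of_int k" by simp
    hence "real i = of_int k * real n" using assms by (simp add: field_simps)
    hence "int i = k * int n" by (metis of_int_eq_iff of_int_mult of_int_of_nat_eq)
    moreover have "0 < int i" "int i < int n" using assms by simp_all
    ultimately have "0 < k * int n" "k * int n < int n" by simp_all
    hence "0 < k" "k * int n < 1 * int n" by (simp_all add: zero_less_mult_iff)
    thus False using mult_right_mono[of 1 k "int n"] by simp
  qed
  moreover have "?z ^ n = 1"
  proof -
    have "?z ^ n = (cis (2 * pi / n) ^ n) ^ i" by (simp add: mult.commute flip: power_mult)
    thus ?thesis using assms by (simp add: DeMoivre)
  qed
  ultimately have "(\<Sum>j<n. ?z ^ j) = 0" by (simp add: geometric_sum)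
  thus ?thesis by (simp add: mult.commute flip: power_mult)
qed

context cstar_algebra
begin

lemma nrm_finsum:
  assumes "finite I" "\<And>i. i \<in> I \<Longrightarrow> f i \<in> carrier A"
  shows "nrm A (\<Oplus>i\<in>I. f i) \<le> (\<Sum>i\<in>I. nrm A (f i))"
  using assms
proof (induction I rule: finite_induct)
  case (insert i I)
  have "nrm A (f i \<oplus> (\<Oplus>i\<in>I. f i)) \<le> nrm A (f i) + nrm A (\<Oplus>i\<in>I. f i)"
    using insert by (intro nrm_triangle finsum_closed) auto
  thus ?case using insert by (simp add: Pi_iff)
qed simp

lemma finsum_scale_const:
  assumes "finite I" "x \<in> carrier A"
  shows "(\<Oplus>i\<in>I. scale A (f i) x) = scale A (\<Sum>i\<in>I. f i) x"
  using assms by (induction I rule: finite_induct) (simp_all add: scale_add_left scale_closed Pi_iff)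

end

context unital_cstar
begin

lemma nrm_power_le: assumes "x \<in> carrier A" "nrm A x \<le> 1" shows "nrm A (x [^] (m::nat)) \<le> 1"
proof (induction m)
  case (Suc m)
  have "nrm A (x [^] m) * nrm A x \<le> 1 * 1"
    using Suc assms nrm_nonneg[OF assms(1)] by (intro mult_mono) auto
  thus ?case using nrm_mult[of "x [^] m" x] assms(1) by simp
qed (simp add: nrm_one_le)

lemma nrm_average:
  assumes "x \<in> carrier A" "y \<in> carrier A" "nrm A x \<le> 1" "nrm A y \<le> 1" "0 \<le> s" "0 \<le> t" "s + t = 1"
  shows "nrm A (scale A (of_real s) x \<oplus> scale A (of_real t) y) \<le> 1"
proof -
  have "nrm A (scale A (of_real s) x \<oplus> scale A (of_real t) y) \<le> s * nrm A x + t * nrm A y"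
    using nrm_triangle[OF scale_closed scale_closed, of x y "of_real s" "of_real t"] assms
    by (simp add: nrm_scale)
  also have "\<dots> \<le> s * 1 + t * 1" using assms by (intro add_mono mult_left_mono) auto
  finally show ?thesis using assms by simp
qed

text \<open>Averaging \<open>(1 + \<omega> w)\<^sup>m\<close> against \<open>\<omega>\<inverse>\<close> over the \<open>n\<close>-th roots of unity, \<open>n > m\<close>, extracts the
  linear coefficient \<open>m w\<close>, whose norm is therefore at most \<open>1\<close> for every \<open>m\<close>.\<close>

lemma unit_disc_direction_zero:
  assumes w: "w \<in> carrier A" and ball: "\<And>\<omega>. cmod \<omega> = 1 \<Longrightarrow> nrm A (\<one> \<oplus> scale A \<omega> w) \<le> 1"
  shows "w = \<zero>"
proof -
  have "real m * nrm A w \<le> 1" for m :: nat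
  proof -
    define n where "n = Suc m"
    define u where "u = cis (2 * pi / n)"
    have u: "cmod (u ^ j) = 1" "u ^ (j * n) = 1" for j
    proof -
      have "n \<noteq> 0" by (simp add: n_def)
      hence "u ^ n = 1" by (simp add: u_def DeMoivre)
      thus "u ^ (j * n) = 1" by (metis power_mult power_one mult.commute)
    qed (simp add: u_def norm_power)
    define e where "e j = \<one> \<oplus> scale A (u ^ j) w" for j
    have e [simp]: "e j \<in> carrier A" for j by (simp add: e_def w scale_closed)
    \<comment> \<open>\<open>a l k\<close> is \<open>n\<close> times the sum of the coefficients of \<open>\<omega>\<^sup>k'\<close> in \<open>(1 + \<omega> w)\<^sup>l\<close>, over \<open>k' \<equiv> k\<close> modulo \<open>n\<close>. The
      exponent \<open>n - k\<close> stands for \<open>-k\<close>; the column \<open>k = n\<close> duplicates \<open>k = 0\<close> so that \<open>rec\<close> reaches it.\<close>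
    define a where "a l k = (\<Oplus>j\<in>{..<n}. scale A (u ^ (j * (n - k))) (e j [^] (l::nat)))" for l k
    have a_closed [simp]: "a l k \<in> carrier A" for l k
      unfolding a_def by (rule finsum_closed) (simp add: scale_closed)
    have a0: "a 0 k = scale A (if k = n then of_nat n else 0) \<one>" if "0 < k" "k \<le> n" for k
    proof -
      have "a 0 k = scale A (\<Sum>j<n. u ^ (j * (n - k))) \<one>"
        unfolding a_def by (simp add: finsum_scale_const)
      moreover have "(\<Sum>j<n. u ^ (j * (n - k))) = 0" if "k < n"
        unfolding u_def using \<open>0 < k\<close> that by (intro sum_roots_of_unity) auto
      ultimately show ?thesis using that by (cases "k = n") auto
    qed
    have rec: "a (Suc l) (Suc k) = a l (Suc k) \<oplus> w \<otimes> a l k" if "k < n" for l k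
    proof -
      have "scale A (u ^ (j * (n - Suc k))) (e j [^] Suc l) =
          scale A (u ^ (j * (n - Suc k))) (e j [^] l) \<oplus> w \<otimes> scale A (u ^ (j * (n - k))) (e j [^] l)" for j
      proof -
        have "j + j * (n - Suc k) = j * (n - k)"
          using that by (metis Suc_diff_Suc mult_Suc_right)
        hence "u ^ j * u ^ (j * (n - Suc k)) = u ^ (j * (n - k))" by (metis power_add)
        moreover have "e j [^] Suc l = e j [^] l \<oplus> scale A (u ^ j) (w \<otimes> e j [^] l)"
          using w by (subst nat_pow_Suc2) (simp_all add: e_def[of j] l_distr scale_mult_left scale_closed)
        ultimately show ?thesis
          using w by (simp add: scale_add_right scale_scale scale_mult_right scale_closed mult.commute)
      qed
      thus ?thesis unfolding a_def
        by (simp add: finsum_addf finsum_rdistr scale_closed w Pi_iff)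
    qed
    have zero: "a l k = \<zero>" if "l < k" "k < n" for l k
      using that
    proof (induction l arbitrary: k)
      case 0
      thus ?case by (simp add: a0)
    next
      case (Suc l)
      then obtain k' where k: "k = Suc k'" by (cases k) auto
      thus ?case using Suc rec[of k' l] w by simp
    qed
    have top: "a l n = scale A (of_nat n) \<one>" if "l \<le> m" for l
      using that
    proof (induction l)
      case 0
      thus ?case by (simp add: a0 n_def)
    next
      case (Suc l)
      thus ?case using rec[of m l] zero[of l m] w by (simp add: n_def scale_closed)
    qed
    have bot: "a l 0 = a l n" for l unfolding a_def by (simp add: u)
    have lin: "0 < l \<Longrightarrow> l \<le> m \<Longrightarrow> a l 1 = scale A (of_nat n * of_nat l) w" for l
    proof (induction l)
      case (Suc l)
      have "a (Suc l) 1 = a l 1 \<oplus> scale A (of_nat n) w"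
        using rec[of 0 l] Suc.prems bot[of l] top[of l] w by (simp add: n_def scale_mult_right)
      moreover have "a l 1 = scale A (of_nat n * of_nat l) w"
      proof (cases "l = 0")
        case True
        thus ?thesis using zero[of 0 1] Suc.prems w by (simp add: n_def)
      qed (use Suc in simp)
      ultimately show ?case using w by (simp add: semiring_class.distrib_left add.commute flip: scale_add_left)
    qed simp
    have "nrm A (a m 1) \<le> n"
    proof -
      have "nrm A (a m 1) \<le> (\<Sum>j<n. nrm A (scale A (u ^ (j * (n - 1))) (e j [^] m)))"
        unfolding a_def by (rule nrm_finsum) (simp_all add: scale_closed)
      also have "\<dots> \<le> (\<Sum>j<n. 1)"
      proof (rule sum_mono)
        fix j
        have "nrm A (e j [^] m) \<le> 1" using ball[OF u(1), of j] by (intro nrm_power_le) (simp_all add: e_def w scale_closed)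
        thus "nrm A (scale A (u ^ (j * (n - 1))) (e j [^] m)) \<le> 1" by (simp add: nrm_scale u)
      qed
      finally show ?thesis by simp
    qed
    thus ?thesis
    proof (cases "m = 0")
      case False
      have "real n * (real m * nrm A w) \<le> real n * 1"
        using \<open>nrm A (a m 1) \<le> n\<close> lin[of m] False w by (simp add: nrm_scale norm_mult)
      thus ?thesis by (rule mult_left_le_imp_le) (simp add: n_def)
    qed simp
  qed
  hence "nrm A w \<le> 0"
    by (metis mult.commute reals_Archimedean3 not_less linorder_le_less_linear)
  thus ?thesis using w nrm_le_0 by simp
qed

text \<open>For self-adjoint \<open>z\<close> the C*-identity gives \<open>\<parallel>1 + \<i>t z\<parallel>\<^sup>2 = \<parallel>1 + t\<^sup>2 z\<^sup>2\<parallel>\<close>, and \<open>1 + t\<^sup>2 z\<^sup>2\<close> is the average of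
  \<open>(1 + t z)\<^sup>2\<close> and \<open>(1 - t z)\<^sup>2\<close>. So the two real directions \<open>\<plusminus>z\<close> yield the imaginary ones, and, after halving
  \<open>z\<close>, all complex ones. This replaces the spectral argument that an element which is both positive and
  negative is zero.\<close>

lemma unit_extreme_point:
  assumes z: "z \<in> carrier A" and sa: "star A z = z"
    and plus: "nrm A (\<one> \<oplus> z) \<le> 1" and minus: "nrm A (\<one> \<ominus> z) \<le> 1"
  shows "z = \<zero>"
proof -
  have re: "nrm A (\<one> \<oplus> scale A (of_real t) z) \<le> 1" if "\<bar>t\<bar> \<le> 1" for t
  proof -
    define s where "s = (1 + t) / 2"
    define s' where "s' = (1 - t) / 2"
    have s: "0 \<le> s" "0 \<le> s'" "s + s' = 1" "s - s' = t" using that by (auto simp: s_def s'_def field_simps)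
    have "scale A (of_real s) (\<one> \<oplus> z) \<oplus> scale A (of_real s') (\<one> \<ominus> z) =
        scale A (of_real s + of_real s') \<one> \<oplus> scale A (of_real s + - of_real s') z"
      using z by (simp only: scale_add_left one_closed) 
        (simp add: a_minus_def scale_add_right scale_closed uminus_eq_scale scale_scale a_ac)
    also have "\<dots> = \<one> \<oplus> scale A (of_real t) z"
      using s z by (simp add: scale_one flip: of_real_add of_real_diff of_real_minus)
    finally show ?thesis using nrm_average[of "\<one> \<oplus> z" "\<one> \<ominus> z" s s'] plus minus s z by simp
  qed
  have im: "nrm A (\<one> \<oplus> scale A (\<i> * of_real t) z) \<le> 1" if t: "\<bar>t\<bar> \<le> 1" for t
  proof -
    let ?x = "\<one> \<oplus> scale A (\<i> * of_real t) z"
    let ?p = "\<one> \<oplus> scale A (of_real t) z" and ?q = "\<one> \<oplus> scale A (of_real (- t)) z"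
    let ?h = "of_real (1 / 2) :: complex"
    have zz: "z \<otimes> z \<in> carrier A" using z by simp
    have sq: "(\<one> \<oplus> scale A k z) \<otimes> (\<one> \<oplus> scale A l z) = \<one> \<oplus> scale A (k + l) z \<oplus> scale A (k * l) (z \<otimes> z)" for k l
      using z by (simp add: l_distr r_distr scale_closed scale_mult_left scale_mult_right scale_scale
          scale_add_left scale_add_right a_ac mult.commute)
    have "star A ?x \<otimes> ?x = (\<one> \<oplus> scale A (- \<i> * of_real t) z) \<otimes> ?x"
      using z sa by (simp add: star_add star_scale scale_closed)
    also have "\<dots> = \<one> \<oplus> scale A (of_real (t * t)) (z \<otimes> z)"
      unfolding sq using z by (simp add: algebra_simps)
    also have "\<dots> = scale A ?h (?p \<otimes> ?p) \<oplus> scale A ?h (?q \<otimes> ?q)"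
    proof -
      have "scale A ?h (?p \<otimes> ?p) \<oplus> scale A ?h (?q \<otimes> ?q) =
         scale A (?h + ?h) \<one> \<oplus> scale A (?h * of_real t + ?h * of_real t + (?h * of_real (-t) + ?h * of_real (-t))) z
          \<oplus> scale A (?h * (of_real t * of_real t) + ?h * (of_real (-t) * of_real (-t))) (z \<otimes> z)"
        unfolding sq using z zz by (simp only: scale_add_left one_closed scale_add_right scale_closed a_closed)
          (simp add: scale_closed scale_scale a_ac)
      also have "\<dots> = \<one> \<oplus> scale A (of_real (t * t)) (z \<otimes> z)"
        using z by (simp add: scale_one)
      finally show ?thesis by simp
    qed
    finally have eq: "star A ?x \<otimes> ?x = scale A ?h (?p \<otimes> ?p) \<oplus> scale A ?h (?q \<otimes> ?q)" .
    have pq: "?p \<in> carrier A" "?q \<in> carrier A" using z by (simp_all add: scale_closed)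
    have "nrm A ?p \<le> 1" "nrm A ?q \<le> 1" using re[of t] re[of "-t"] t by auto
    hence "nrm A (?p [^] (2::nat)) \<le> 1" "nrm A (?q [^] (2::nat)) \<le> 1" using pq nrm_power_le by blast+
    hence pq1: "nrm A (?p \<otimes> ?p) \<le> 1" "nrm A (?q \<otimes> ?q) \<le> 1"
      using pq by (simp_all add: numeral_2_eq_2)
    have "nrm A (star A ?x \<otimes> ?x) \<le> 1" unfolding eq
      by (rule nrm_average) (use pq pq1 in simp_all)
    hence "(nrm A ?x)\<^sup>2 \<le> 1" using nrm_cstar[of ?x] z by (simp add: scale_closed)
    thus ?thesis using power2_le_imp_le[of "nrm A ?x" 1] by simp
  qed
  \<comment> \<open>\<open>1 + \<omega>/2 z\<close> is the average of \<open>1 + Re \<omega> z\<close> and \<open>1 + \<i> Im \<omega> z\<close>.\<close>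
  let ?w = "scale A (1 / 2) z"
  have "nrm A (\<one> \<oplus> scale A \<omega> ?w) \<le> 1" if "cmod \<omega> = 1" for \<omega>
  proof -
    have b: "\<bar>Re \<omega>\<bar> \<le> 1" "\<bar>Im \<omega>\<bar> \<le> 1" using that abs_Re_le_cmod abs_Im_le_cmod by metis+
    let ?h = "of_real (1 / 2) :: complex"
    have \<omega>: "\<omega> = of_real (Re \<omega>) + \<i> * of_real (Im \<omega>)" by (simp add: complex_eq flip: complex_eq)
    have "scale A ?h (\<one> \<oplus> scale A (of_real (Re \<omega>)) z) \<oplus> scale A ?h (\<one> \<oplus> scale A (\<i> * of_real (Im \<omega>)) z) =
        scale A (?h + ?h) \<one> \<oplus> scale A (?h * of_real (Re \<omega>) + ?h * (\<i> * of_real (Im \<omega>))) z"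
      using z by (simp only: scale_add_left one_closed) (simp add: scale_add_right scale_closed scale_scale a_ac)
    also have "?h * of_real (Re \<omega>) + ?h * (\<i> * of_real (Im \<omega>)) = \<omega> * (1 / 2)"
      by (subst (3) \<omega>) (simp add: algebra_simps)
    also have "scale A (?h + ?h) \<one> \<oplus> scale A (\<omega> * (1 / 2)) z = \<one> \<oplus> scale A \<omega> ?w"
      using z by (simp add: scale_one scale_scale)
    finally show ?thesis
      using nrm_average[OF _ _ re[OF b(1)] im[OF b(2)], of "1/2" "1/2"] z by (simp add: scale_closed)
  qed
  hence "?w = \<zero>" by (intro unit_disc_direction_zero) (simp_all add: z scale_closed)
  hence "scale A 2 ?w = \<zero>" by simp
  thus ?thesis using z by (simp add: scale_scale scale_one)
qed

lemma projection_minus: assumes "projection A q" shows "projection A (\<one> \<ominus> q)"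
proof -
  have q: "q \<in> carrier A" "q \<otimes> q = q" "star A q = q" using assms by (auto simp: projection_def)
  have "(\<one> \<ominus> q) \<otimes> (\<one> \<ominus> q) = \<one> \<ominus> q \<ominus> (q \<ominus> q)"
    using q by (simp add: minus_distrib_left minus_distrib_right)
  thus ?thesis using q by (simp add: projection_def star_minus) (simp add: a_minus_def r_neg)
qed

lemma isometry_range: assumes "isometry A x" shows "projection A (x \<otimes> star A x)"
proof -
  have x: "x \<in> carrier A" "star A x \<otimes> x = \<one>" using assms by (auto simp: isometry_def)
  have "x \<otimes> star A x \<otimes> (x \<otimes> star A x) = x \<otimes> (star A x \<otimes> x) \<otimes> star A x"
    using x(1) by (simp add: m_assoc star_closed)
  thus ?thesis using x by (simp add: projection_def star_mult star_star star_closed)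
qed

text \<open>Let \<open>y\<^sub>k = t\<^sub>j\<^sup>* t\<^sub>k t\<^sub>k\<^sup>* t\<^sub>j\<close>. Compressing the relation by \<open>t\<^sub>j\<close> shows that the \<open>y\<^sub>k\<close> with \<open>k \<noteq> j\<close> sum to zero,
  and \<open>\<parallel>1 - y\<^sub>k\<parallel> \<le> 1\<close>. Writing \<open>y\<^sub>i\<close> as minus the sum of the others, one sees that both \<open>1 - z\<close> and \<open>1 + z\<close> are
  averages of elements of the unit ball for a small multiple \<open>z\<close> of \<open>y\<^sub>i\<close>. Hence \<open>y\<^sub>i = (t\<^sub>i\<^sup>* t\<^sub>j)\<^sup>* (t\<^sub>i\<^sup>* t\<^sub>j)\<close> is zero.\<close>

lemma isometries_orthogonal:
  assumes "finite I" and iso: "\<And>i. i \<in> I \<Longrightarrow> isometry A (t i)"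
    and sum: "(\<Oplus>i\<in>I. t i \<otimes> star A (t i)) = \<one>"
    and ij: "i \<in> I" "j \<in> I" "i \<noteq> j"
  shows "star A (t i) \<otimes> t j = \<zero>"
proof -
  have t [simp]: "t k \<in> carrier A" "star A (t k) \<in> carrier A" "star A (t k) \<otimes> t k = \<one>" if "k \<in> I" for k
    using iso[OF that] by (auto simp: isometry_def star_closed)
  define y where "y k = star A (t j) \<otimes> (t k \<otimes> star A (t k)) \<otimes> t j" for k
  have y [simp]: "y k \<in> carrier A" if "k \<in> I" for k using that ij by (simp add: y_def)
  have ball: "nrm A (\<one> \<ominus> y k) \<le> 1" if k: "k \<in> I" for k
  proof -
    let ?q = "t k \<otimes> star A (t k)"
    have q: "nrm A (\<one> \<ominus> ?q) \<le> 1"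
      by (intro nrm_projection projection_minus isometry_range iso k)
    have eq: "\<one> \<ominus> y k = star A (t j) \<otimes> (\<one> \<ominus> ?q) \<otimes> t j"
      using k ij by (simp add: y_def minus_distrib_left minus_distrib_right)
    have "nrm A (\<one> \<ominus> y k) \<le> nrm A (star A (t j)) * nrm A (\<one> \<ominus> ?q) * nrm A (t j)"
      unfolding eq using k ij nrm_mult[of "star A (t j) \<otimes> (\<one> \<ominus> ?q)" "t j"] nrm_mult[of "star A (t j)" "\<one> \<ominus> ?q"]
        nrm_nonneg[of "t j"] by (auto intro: order_trans mult_right_mono)
    also have "\<dots> \<le> 1 * 1 * 1"
      using k ij q nrm_isometry[OF iso[OF ij(2)]] by (intro mult_mono) (simp_all add: nrm_star nrm_nonneg)
    finally show ?thesis by simp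
  qed
  have yj: "y j = \<one>"
    using ij t(3)[OF ij(2)] by (simp add: y_def m_assoc flip: m_assoc[of "star A (t j)" "t j"])
  define L where "L = I - {i, j}"
  have L: "finite L" "L \<subseteq> I" "i \<notin> L" "j \<notin> L" "I = insert j (insert i L)"
    using assms(1) ij by (auto simp: L_def)
  have Lc: "(\<Oplus>k\<in>L. y k) \<in> carrier A" "(\<Oplus>k\<in>L. \<one> \<ominus> y k) \<in> carrier A"
    using L by (auto intro!: finsum_closed)
  have "(\<Oplus>k\<in>I. y k) = star A (t j) \<otimes> (\<Oplus>k\<in>I. t k \<otimes> star A (t k)) \<otimes> t j"
    unfolding y_def using assms(1) ij by (subst finsum_rdistr, simp, simp, force, subst finsum_ldistr) auto
  also have "\<dots> = \<one>" using ij by (simp add: sum)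
  finally have "y j \<oplus> (y i \<oplus> (\<Oplus>k\<in>L. y k)) = \<one>"
    using L ij by (simp add: L(5) Pi_iff subset_iff)
  hence "y i \<oplus> (\<Oplus>k\<in>L. y k) = \<zero>"
  proof -
    let ?X = "y i \<oplus> (\<Oplus>k\<in>L. y k)"
    assume "y j \<oplus> ?X = \<one>"
    hence "\<ominus> \<one> \<oplus> (\<one> \<oplus> ?X) = \<ominus> \<one> \<oplus> \<one>" using yj by simp
    moreover have "?X \<in> carrier A" using ij Lc by simp
    ultimately show ?thesis by (simp only: r_neg1 one_closed l_neg)
  qed
  hence yi: "y i = \<ominus> (\<Oplus>k\<in>L. y k)"
    using minus_equality[of "y i" "\<Oplus>k\<in>L. y k"] ij Lc by simp
  have ys: "star A (y i) = y i"
    using ij by (simp add: y_def star_mult star_star m_assoc)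
  define n where "n = Suc (card L)"
  have sumL: "(\<Oplus>k\<in>L. \<one> \<ominus> y k) = scale A (of_nat (card L)) \<one> \<oplus> y i"
  proof -
    have "(\<Oplus>k\<in>L'. \<one> \<ominus> y k) = scale A (of_nat (card L')) \<one> \<ominus> (\<Oplus>k\<in>L'. y k)"
      if "finite L'" "L' \<subseteq> I" for L'
      using that
    proof (induction L' rule: finite_induct)
      case (insert k L')
      have c: "y k \<in> carrier A" "(\<Oplus>k\<in>L'. y k) \<in> carrier A" "scale A (of_nat (card L')) \<one> \<in> carrier A"
        using insert by (auto intro!: finsum_closed scale_closed)
      have "(\<Oplus>l\<in>insert k L'. \<one> \<ominus> y l) = (\<one> \<ominus> y k) \<oplus> (\<Oplus>l\<in>L'. \<one> \<ominus> y l)"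
        using insert by (intro finsum_insert) auto
      also have "\<dots> = (\<one> \<ominus> y k) \<oplus> (scale A (of_nat (card L')) \<one> \<ominus> (\<Oplus>l\<in>L'. y l))"
        using insert by simp
      also have "\<dots> = (\<one> \<oplus> scale A (of_nat (card L')) \<one>) \<ominus> (y k \<oplus> (\<Oplus>l\<in>L'. y l))"
        using c by (simp only: add_minus_distrib one_closed)
      also have "\<one> \<oplus> scale A (of_nat (card L')) \<one> = scale A (of_nat (card (insert k L'))) \<one>"
        using insert by (simp add: scale_add_left scale_one)
      also have "y k \<oplus> (\<Oplus>l\<in>L'. y l) = (\<Oplus>l\<in>insert k L'. y l)"
        using insert by (intro finsum_insert[symmetric]) auto
      finally show ?case .
    qed (simp add: a_minus_def)
    from this[OF L(1,2)] show ?thesis using yi by (simp add: a_minus_def)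
  qed
  let ?z = "scale A (1 / of_nat n) (y i)"
  have "nrm A (\<one> \<oplus> ?z) \<le> 1"
  proof -
    have "nrm A (\<Oplus>k\<in>L. \<one> \<ominus> y k) \<le> (\<Sum>k\<in>L. nrm A (\<one> \<ominus> y k))"
      using L by (intro nrm_finsum) auto
    also have "\<dots> \<le> (\<Sum>k\<in>L. 1)" using ball L by (intro sum_mono) auto
    finally have 1: "nrm A (\<Oplus>k\<in>L. \<one> \<ominus> y k) \<le> card L" by simp
    have "\<one> \<oplus> ?z = scale A (1 / of_nat n) (\<one> \<oplus> (\<Oplus>k\<in>L. \<one> \<ominus> y k))"
    proof -
      have "\<one> \<oplus> (\<Oplus>k\<in>L. \<one> \<ominus> y k) = scale A (of_nat n) \<one> \<oplus> y i"
        unfolding sumL using ij by (simp add: n_def scale_add_left scale_one scale_closed a_assoc)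
      thus ?thesis using ij by (simp add: scale_add_right scale_scale scale_one scale_closed n_def del: of_nat_Suc)
    qed
    hence "nrm A (\<one> \<oplus> ?z) = nrm A (\<one> \<oplus> (\<Oplus>k\<in>L. \<one> \<ominus> y k)) / n"
      using Lc by (simp add: nrm_scale norm_divide n_def del: of_nat_Suc)
    moreover have "nrm A (\<one> \<oplus> (\<Oplus>k\<in>L. \<one> \<ominus> y k)) \<le> n"
      using nrm_triangle[OF one_closed Lc(2)] nrm_one_le 1 by (simp add: n_def)
    ultimately show ?thesis by (simp add: n_def divide_le_eq)
  qed
  moreover have "nrm A (\<one> \<ominus> ?z) \<le> 1"
  proof -
    have unit_sum: "real (card L) / n + 1 / n = 1" by (simp add: n_def flip: add_divide_distrib)
    have "\<one> \<ominus> ?z = scale A (of_real (card L / n)) \<one> \<oplus> scale A (of_real (1 / n)) (\<one> \<ominus> y i)"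
    proof -
      have "scale A (of_real (card L / n)) \<one> \<oplus> scale A (of_real (1 / n)) (\<one> \<ominus> y i) =
        scale A (of_real (card L / n) + of_real (1 / n)) \<one> \<ominus> scale A (of_real (1 / n)) (y i)"
        using ij by (simp only: scale_add_left one_closed) (simp add: scale_closed a_minus_def a_assoc scale_add_right uminus_eq_scale scale_scale)
      also have "of_real (card L / n) + of_real (1 / n) = (1 :: complex)"
        by (simp only: of_real_add[symmetric] unit_sum of_real_1)
      finally show ?thesis by (simp add: scale_one)
    qed
    thus ?thesis
      using unit_sum nrm_average[OF one_closed _ nrm_one_le ball[OF ij(1)], of "card L / n" "1 / n"] ij by simp
  qed
  ultimately have "?z = \<zero>"
    using ij ys by (intro unit_extreme_point) (simp_all add: scale_closed star_scale)
  hence "scale A (of_nat n) ?z = \<zero>" by simp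
  hence "y i = \<zero>" using ij by (simp add: scale_scale scale_one n_def del: of_nat_Suc)
  moreover have "star A (star A (t i) \<otimes> t j) \<otimes> (star A (t i) \<otimes> t j) = y i"
    using ij by (simp add: y_def star_mult star_star m_assoc)
  ultimately have "nrm A (star A (t i) \<otimes> t j) = 0"
    using nrm_cstar[of "star A (t i) \<otimes> t j"] ij by simp
  thus ?thesis using ij by (simp add: nrm_eq_0)
qed

end

section \<open>Presented groups\<close>

lemma word_class_eq_iff: "word_class R u = word_class R v \<longleftrightarrow> word_eq R u v"
  unfolding word_class_def by (metis mem_Collect_eq word_eq.refl word_eq.sym word_eq.trans subsetI subset_antisym)

lemma mult_word_class:
  "word_class R u \<otimes>\<^bsub>presented_group R\<^esub> word_class R v = word_class R (u @ v)"
proof -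
  have "word_class R (u' @ v') = word_class R (u @ v)" if "u' \<in> word_class R u" "v' \<in> word_class R v" for u' v'
    using that unfolding word_class_eq_iff by (auto simp: word_class_def intro: word_eq.append word_eq.sym)
  moreover have "u \<in> word_class R u" "v \<in> word_class R v" by (simp_all add: word_class_def word_eq.refl)
  ultimately have "(\<Union>u'\<in>word_class R u. \<Union>v'\<in>word_class R v. word_class R (u' @ v')) = word_class R (u @ v)"
    by blast
  thus ?thesis by (simp add: presented_group_def)
qed

lemma monoid_presented_group: "monoid (presented_group R)"
proof (rule monoidI)
  have car: "carrier (presented_group R) = range (word_class R)" and one: "\<one>\<^bsub>presented_group R\<^esub> = word_class R []"
    by (simp_all add: presented_group_def)
  fix x y z assume "x \<in> carrier (presented_group R)" "y \<in> carrier (presented_group R)" "z \<in> carrier (presented_group R)"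
  then obtain u v w where "x = word_class R u" "y = word_class R v" "z = word_class R w" by (auto simp: car)
  thus "x \<otimes>\<^bsub>presented_group R\<^esub> y \<in> carrier (presented_group R)"
    "x \<otimes>\<^bsub>presented_group R\<^esub> y \<otimes>\<^bsub>presented_group R\<^esub> z = x \<otimes>\<^bsub>presented_group R\<^esub> (y \<otimes>\<^bsub>presented_group R\<^esub> z)"
    "\<one>\<^bsub>presented_group R\<^esub> \<otimes>\<^bsub>presented_group R\<^esub> x = x" "x \<otimes>\<^bsub>presented_group R\<^esub> \<one>\<^bsub>presented_group R\<^esub> = x"
    by (simp_all add: mult_word_class car one)
qed (simp_all add: presented_group_def)

section \<open>Normal forms in Baumslag--Solitar groups\<close>

text \<open>A reduced word \<open>b\<^sup>i a\<^sup>\<plusminus>\<^sup>1 b\<^sup>j a\<^sup>\<plusminus>\<^sup>1 \<dots> b\<^sup>n\<close> of the HNN extension is encoded by the list of the pairs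
  (exponent of \<open>b\<close>, sign of the following \<open>a\<close>), with \<open>True\<close> for \<open>a\<inverse>\<close>, and the last exponent \<open>n\<close>.
  Exponents before \<open>a\<close> are residues modulo \<open>d\<close> and exponents before \<open>a\<inverse>\<close> residues modulo \<open>c\<close>,
  because \<open>b\<^sup>d a = a b\<^sup>c\<close> and \<open>b\<^sup>c a\<inverse> = a\<inverse> b\<^sup>d\<close> move the quotient to the right. Letting the group act
  on these words separates its elements without Britton's lemma.\<close>

locale bs =
  fixes c d :: nat
  assumes c_pos: "0 < c" and d_pos: "0 < d"
begin

definition base :: "bool \<Rightarrow> int" where "base e = (if e then int c else int d)"

lemma base_pos [simp]: "0 < base e"
  using c_pos d_pos by (simp add: base_def)

text \<open>The next two functions describe left multiplication by \<open>b\<^sup>m\<close>: the new exponents, and the power of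
  \<open>b\<close> that arrives at the right end.\<close>

fun zshift :: "int \<Rightarrow> (int \<times> bool) list \<Rightarrow> (int \<times> bool) list" where
  "zshift m [] = []"
| "zshift m ((i, e) # w) = ((m + i) mod base e, e) # zshift (base (\<not> e) * ((m + i) div base e)) w"

fun zcarry :: "int \<Rightarrow> (int \<times> bool) list \<Rightarrow> int" where
  "zcarry m [] = m"
| "zcarry m ((i, e) # w) = zcarry (base (\<not> e) * ((m + i) div base e)) w"

fun reduced :: "(int \<times> bool) list \<Rightarrow> bool" where
  "reduced [] \<longleftrightarrow> True"
| "reduced ((i, e) # w) \<longleftrightarrow> 0 \<le> i \<and> i < base e \<and> reduced w \<and> (\<forall>w'. w \<noteq> (0, \<not> e) # w')"

text \<open>Left multiplication by \<open>a\<close> (\<open>e = False\<close>) or \<open>a\<inverse>\<close>: a leading inverse letter is cancelled.\<close>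

definition push :: "bool \<Rightarrow> (int \<times> bool) list \<Rightarrow> (int \<times> bool) list" where
  "push e w = (if w \<noteq> [] \<and> hd w = (0, \<not> e) then tl w else (0, e) # w)"

fun lact :: "bs_letter \<times> bool \<Rightarrow> (int \<times> bool) list \<times> int \<Rightarrow> (int \<times> bool) list \<times> int" where
  "lact (La, e) (w, n) = (push e w, n)"
| "lact (Lb, e) (w, n) = (let m = (if e then - 1 else 1) in (zshift m w, zcarry m w + n))"

definition wact where "wact u = foldr lact u"

lemma zshift_zero: "reduced w \<Longrightarrow> zshift 0 w = w \<and> zcarry 0 w = 0"
  by (induction w rule: reduced.induct) auto

lemma zshift_add: "zshift (m + k) w = zshift m (zshift k w) \<and> zcarry (m + k) w = zcarry m (zshift k w) + zcarry k w"
proof (induction w arbitrary: m k rule: reduced.induct)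
  case (2 i e w)
  let ?b = "base e"
  have dv: "(m + k + i) div ?b = (m + (k + i) mod ?b) div ?b + (k + i) div ?b"
  proof -
    have "m + k + i = (m + (k + i) mod ?b) + ((k + i) div ?b) * ?b"
      by (simp add: algebra_simps)
    thus ?thesis by (metis base_pos div_mult_self1 less_irrefl add.commute)
  qed
  have md: "(m + k + i) mod ?b = (m + (k + i) mod ?b) mod ?b"
    by (simp add: mod_add_right_eq add.assoc)
  show ?case using "2.IH" by (simp add: dv md distrib_left)
qed simp

text \<open>A factor \<open>a b\<^sup>j a\<inverse>\<close> receives a multiple of \<open>c\<close> on \<open>b\<^sup>j\<close>, where \<open>j\<close> is a residue modulo \<open>c\<close>, and likewise
  with the signs exchanged. So exponents between opposite signs do not change, and no cancellation
  can appear.\<close>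

lemma reduced_zshift: "reduced w \<Longrightarrow> reduced (zshift m w)"
proof (induction w arbitrary: m rule: reduced.induct)
  case (2 i e w)
  have "zshift (base (\<not> e) * q) w \<noteq> (0, \<not> e) # w'" for q w'
  proof (cases w)
    case (Cons l w2)
    obtain j f where l: "l = (j, f)" by (cases l)
    show ?thesis
    proof (cases "f = (\<not> e)")
      case True
      hence "0 \<le> j" "j < base (\<not> e)" "j \<noteq> 0" using 2 Cons l by auto
      thus ?thesis using Cons l True by simp
    qed (simp add: Cons l)
  qed simp
  thus ?case using 2 by simp
qed simp

lemma reduced_push: "reduced w \<Longrightarrow> reduced (push e w)"
  by (cases w; cases "hd w") (auto simp: push_def)

lemma push_push: "reduced w \<Longrightarrow> push e (push (\<not> e) w) = w"
  by (cases w; cases "tl w"; cases "hd w") (auto simp: push_def)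

lemma reduced_lact: "reduced (fst y) \<Longrightarrow> reduced (fst (lact l y))"
  by (cases "(l, y)" rule: lact.cases) (auto simp: reduced_push reduced_zshift Let_def)

lemma wact_append: "wact (u @ v) y = wact u (wact v y)"
  by (simp add: wact_def)

lemma reduced_wact: "reduced (fst y) \<Longrightarrow> reduced (fst (wact u y))"
  by (induction u) (simp_all add: wact_def reduced_lact)

lemma lact_cancel: "reduced (fst y) \<Longrightarrow> lact (x, e) (lact (x, \<not> e) y) = y"
proof (cases x)
  case Lb
  assume r: "reduced (fst y)"
  obtain w n where y: "y = (w, n)" by (cases y)
  show ?thesis
    using r zshift_add[of 1 "-1" w] zshift_add[of "-1" 1 w] zshift_zero[of w] by (cases e) (auto simp: Lb y Let_def)
next
  case La
  assume "reduced (fst y)"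
  thus ?thesis using La push_push[of "fst y" e] by (cases y) simp
qed

lemma wact_replicate_b:
  "reduced w \<Longrightarrow> wact (replicate m (Lb, False)) (w, n) = (zshift (int m) w, zcarry (int m) w + n)"
proof (induction m)
  case 0
  thus ?case by (simp add: wact_def zshift_zero)
next
  case (Suc m)
  thus ?case using zshift_add[of 1 "int m" w] by (simp add: wact_def)
qed

lemma wact_relator:
  assumes "reduced w"
  shows "wact ([(La, False)] @ replicate c (Lb, False)) (w, n) = wact (replicate d (Lb, False) @ [(La, False)]) (w, n)"
proof -
  have a: "wact [(La, False)] (v, k) = (push False v, k)" for v k by (simp add: wact_def)
  have "(push False (zshift (int c) w), zcarry (int c) w) = (zshift (int d) (push False w), zcarry (int d) (push False w))"
  proof (cases "w \<noteq> [] \<and> hd w = (0, True)")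
    case True
    then obtain w' where "w = (0, True) # w'" by (cases w) auto
    thus ?thesis using c_pos by (simp add: push_def base_def)
  next
    case False
    have "\<not> (zshift (int c) w \<noteq> [] \<and> hd (zshift (int c) w) = (0, True))"
    proof (cases w)
      case (Cons l w')
      obtain j f where l: "l = (j, f)" by (cases l)
      show ?thesis using assms False by (cases f) (auto simp: Cons l base_def)
    qed simp
    thus ?thesis using False d_pos by (auto simp: push_def base_def)
  qed
  thus ?thesis
    unfolding wact_append a wact_replicate_b[OF assms] wact_replicate_b[OF reduced_push[OF assms]] by simp
qed

text \<open>The letters act by mutually inverse bijections of the reduced words and the defining relation
  holds for them, so that words which are equal in the group act equally.\<close>

lemma wact_word_eq:
  assumes "word_eq (bs_equations c d) u v" "reduced (fst y)"
  shows "wact u y = wact v y"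
  using assms
proof (induction arbitrary: y rule: word_eq.induct)
  case (relator u v)
  thus ?case using wact_relator[of "fst y" "snd y"] by (simp add: bs_equations_def)
next
  case (cancel x e)
  thus ?case using lact_cancel by (simp add: wact_def)
next
  case (append u v u' v')
  thus ?case by (simp add: wact_append reduced_wact)
qed simp_all

section \<open>The positive monoid in coordinates\<close>

text \<open>A positive element is \<open>b\<^sup>i a b\<^sup>j a \<dots> a b\<^sup>n\<close> with digits \<open>i, j, \<dots> < d\<close>, recorded as the list
  of the digits and \<open>n\<close>. Left multiplication by \<open>b\<^sup>m\<close> is an adding machine in base \<open>d\<close> whose carries are multiplied by \<open>c\<close>.\<close>

fun shift :: "nat \<Rightarrow> nat list \<Rightarrow> nat list" where
  "shift m [] = []"
| "shift m (i # w) = ((m + i) mod d) # shift (c * ((m + i) div d)) w"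

fun carry :: "nat \<Rightarrow> nat list \<Rightarrow> nat" where
  "carry m [] = m"
| "carry m (i # w) = carry (c * ((m + i) div d)) w"

definition digits :: "nat list \<Rightarrow> bool" where "digits w \<longleftrightarrow> (\<forall>i\<in>set w. i < d)"

fun nact :: "bs_letter \<Rightarrow> nat list \<times> nat \<Rightarrow> nat list \<times> nat" where
  "nact La (w, n) = (0 # w, n)"
| "nact Lb (w, n) = (shift 1 w, carry 1 w + n)"

definition nf :: "bs_letter list \<Rightarrow> nat list \<times> nat" where "nf u = foldr nact u ([], 0)"

definition pos :: "bs_letter list \<Rightarrow> (bs_letter \<times> bool) list" where "pos u = map (\<lambda>x. (x, False)) u"

definition emb :: "nat list \<times> nat \<Rightarrow> (int \<times> bool) list \<times> int" where
  "emb y = (map (\<lambda>i. (int i, False)) (fst y), int (snd y))"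

definition rep :: "nat list \<times> nat \<Rightarrow> bs_letter list" where
  "rep y = concat (map (\<lambda>i. replicate i Lb @ [La]) (fst y)) @ replicate (snd y) Lb"

lemma digits_simps [simp]: "digits []" "digits (i # w) \<longleftrightarrow> i < d \<and> digits w" "digits (v @ w) \<longleftrightarrow> digits v \<and> digits w"
  by (auto simp: digits_def)

lemma length_shift [simp]: "length (shift m w) = length w"
  by (induction w arbitrary: m) simp_all

lemma digits_shift [simp]: "digits (shift m w)"
  using d_pos by (induction w arbitrary: m) simp_all

lemma digits_nf: "digits (fst (nf u))"
proof (induction u)
  case (Cons x u)
  obtain w n where "nf u = (w, n)" by (cases "nf u")
  thus ?case using Cons d_pos by (cases x) (auto simp: nf_def)
qed (simp add: nf_def)

lemma zshift_emb:
  "zshift (int m) (map (\<lambda>i. (int i, False)) w) = map (\<lambda>i. (int i, False)) (shift m w) \<and>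
   zcarry (int m) (map (\<lambda>i. (int i, False)) w) = int (carry m w)"
proof (induction w arbitrary: m)
  case (Cons i w)
  have "int c * ((int m + int i) div int d) = int (c * ((m + i) div d))"
    by (simp add: zdiv_int)
  thus ?case using Cons by (simp add: base_def zmod_int del: of_nat_mult)
qed simp

lemma wact_pos: "wact (pos u) ([], 0) = emb (nf u)"
proof (induction u)
  case (Cons x u)
  obtain w n where y: "nf u = (w, n)" by (cases "nf u")
  have "wact (pos (x # u)) ([], 0) = lact (x, False) (emb (w, n))"
    using Cons by (simp add: wact_def pos_def y)
  also have "\<dots> = emb (nact x (w, n))"
  proof (cases x)
    case La
    show ?thesis by (cases w) (auto simp: La emb_def push_def)
  next
    case Lb
    show ?thesis using zshift_emb[of 1 w] by (simp add: Lb emb_def)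
  qed
  also have "nact x (w, n) = nf (x # u)" using y by (simp add: nf_def)
  finally show ?case .
qed (simp add: wact_def pos_def emb_def nf_def)

lemma inj_emb: "emb y = emb z \<Longrightarrow> y = z"
proof -
  assume "emb y = emb z"
  moreover have "inj (map (\<lambda>i. (int i, False)))" by (rule inj_mapI) (auto intro: injI)
  ultimately show ?thesis by (auto simp: emb_def prod_eq_iff dest: injD)
qed

lemma nf_eq_of_word_eq: "word_eq (bs_equations c d) (pos u) (pos v) \<Longrightarrow> nf u = nf v"
  using wact_word_eq[of "pos u" "pos v" "([], 0)"] wact_pos inj_emb by simp

lemma shift_zero: "digits w \<Longrightarrow> shift 0 w = w \<and> carry 0 w = 0"
  by (induction w) simp_all

text \<open>Inherited from the integer version along the inclusion of the nonnegative digits.\<close>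

lemma shift_add: "shift (m + k) w = shift m (shift k w) \<and> carry (m + k) w = carry m (shift k w) + carry k w"
proof -
  let ?e = "map (\<lambda>i. (int i, False))"
  have i: "inj ?e" by (rule inj_mapI) (auto intro: injI)
  have "?e (shift (m + k) w) = zshift (int m + int k) (?e w)" by (simp add: zshift_emb flip: of_nat_add)
  also have "\<dots> = ?e (shift m (shift k w))" using zshift_add by (simp add: zshift_emb)
  finally have 1: "shift (m + k) w = shift m (shift k w)" using i by (simp add: inj_eq)
  have "int (carry (m + k) w) = zcarry (int m + int k) (?e w)" by (simp add: zshift_emb flip: of_nat_add)
  also have "\<dots> = int (carry m (shift k w) + carry k w)" using zshift_add by (simp add: zshift_emb)
  finally show ?thesis using 1 by linarith
qed

lemma foldr_nact_b: "digits w \<Longrightarrow> foldr nact (replicate m Lb) (w, n) = (shift m w, carry m w + n)"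
proof (induction m)
  case 0
  thus ?case by (simp add: shift_zero)
next
  case (Suc m)
  thus ?case using shift_add[of 1 m w] by simp
qed

lemma foldr_nact_rep:
  assumes "digits v" "digits w"
  shows "foldr nact (rep (v, m)) (w, n) = (v @ shift m w, carry m w + n)"
  using assms(1)
proof (induction v)
  case Nil
  show ?case using assms by (simp add: rep_def foldr_nact_b del: foldr_replicate)
next
  case (Cons i v)
  have "foldr nact (rep (i # v, m)) (w, n) = foldr nact (replicate i Lb) (nact La (foldr nact (rep (v, m)) (w, n)))"
    by (simp add: rep_def)
  also have "\<dots> = foldr nact (replicate i Lb) (0 # v @ shift m w, carry m w + n)"
    using Cons by simp
  also have "\<dots> = (i # v @ shift m w, carry m w + n)"
    using Cons d_pos by (simp add: foldr_nact_b shift_zero del: foldr_replicate)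
  finally show ?case by simp
qed

lemma nf_rep: "digits w \<Longrightarrow> nf (rep (w, n)) = (w, n)"
  unfolding nf_def by (simp add: foldr_nact_rep)

end

text \<open>Normalising a positive word uses only the defining relation, so it preserves the value of the
  word in every monoid containing a solution \<open>(\<alpha>, \<beta>)\<close> of it.\<close>

locale bs_solution = bs c d + monoid G for c d and G (structure) +
  fixes \<alpha> \<beta>
  assumes closed [simp]: "\<alpha> \<in> carrier G" "\<beta> \<in> carrier G"
    and relation: "\<alpha> \<otimes> \<beta> [^] c = \<beta> [^] d \<otimes> \<alpha>"
begin

definition lval where "lval x = (case x of La \<Rightarrow> \<alpha> | Lb \<Rightarrow> \<beta>)"

definition val where "val u = foldr (\<lambda>x y. lval x \<otimes> y) u \<one>"

lemma lval_closed [simp]: "lval x \<in> carrier G"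
  by (simp add: lval_def split: bs_letter.split)

lemma val_simps [simp]: "val [] = \<one>" "val (x # u) = lval x \<otimes> val u"
  by (simp_all add: val_def)

lemma val_closed [simp]: "val u \<in> carrier G"
  by (induction u) simp_all

lemma val_append: "val (u @ v) = val u \<otimes> val v"
  by (induction u) (simp_all add: m_assoc)

lemma val_replicate_b: "val (replicate m Lb) = \<beta> [^] m"
proof (induction m)
  case (Suc m)
  thus ?case using nat_pow_Suc2[of \<beta> m] by (simp add: lval_def)
qed simp

lemma power_relation: "\<beta> [^] (d * q) \<otimes> \<alpha> = \<alpha> \<otimes> \<beta> [^] (c * q)"
proof (induction q)
  case (Suc q)
  have "\<beta> [^] (d * Suc q) \<otimes> \<alpha> = \<beta> [^] d \<otimes> (\<beta> [^] (d * q) \<otimes> \<alpha>)"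
    by (simp add: m_assoc flip: nat_pow_mult)
  also have "\<dots> = \<alpha> \<otimes> \<beta> [^] c \<otimes> \<beta> [^] (c * q)"
    unfolding Suc using relation by (simp flip: m_assoc)
  also have "\<dots> = \<alpha> \<otimes> \<beta> [^] (c * Suc q)" by (simp add: m_assoc nat_pow_mult)
  finally show ?case .
qed simp

lemma val_shift: "val (replicate m Lb @ rep (w, n)) = val (rep (shift m w, carry m w + n))"
proof (induction w arbitrary: m)
  case Nil
  show ?case by (simp add: rep_def add.commute flip: replicate_add)
next
  case (Cons i w)
  let ?q = "(m + i) div d" and ?r = "(m + i) mod d"
  have mi: "\<beta> [^] (m + i) = \<beta> [^] ?r \<otimes> \<beta> [^] (d * ?q)" by (simp only: nat_pow_mult closed mod_mult_div_eq)
  have "val (replicate m Lb @ rep (i # w, n)) = \<beta> [^] (m + i) \<otimes> (\<alpha> \<otimes> val (rep (w, n)))"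
    by (simp add: rep_def val_append val_replicate_b lval_def m_assoc flip: nat_pow_mult)
  also have "\<dots> = \<beta> [^] ?r \<otimes> (\<beta> [^] (d * ?q) \<otimes> \<alpha> \<otimes> val (rep (w, n)))"
    unfolding mi by (simp add: m_assoc)
  also have "\<dots> = \<beta> [^] ?r \<otimes> (\<alpha> \<otimes> val (replicate (c * ?q) Lb @ rep (w, n)))"
    unfolding power_relation by (simp add: val_append val_replicate_b m_assoc)
  also have "\<dots> = val (rep (shift m (i # w), carry m (i # w) + n))"
    unfolding Cons by (simp add: rep_def val_append val_replicate_b lval_def m_assoc)
  finally show ?case .
qed

lemma val_nf: "val u = val (rep (nf u))"
proof (induction u)
  case Nil
  show ?case by (simp add: nf_def rep_def)
next
  case (Cons x u)
  obtain w n where y: "nf u = (w, n)" by (cases "nf u")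
  have "lval x \<otimes> val (rep (w, n)) = val (rep (nact x (w, n)))"
  proof (cases x)
    case La
    thus ?thesis by (simp add: rep_def)
  next
    case Lb
    thus ?thesis using val_shift[of 1 w n] by simp
  qed
  thus ?case using Cons y by (simp add: nf_def)
qed

end

context bs
begin

abbreviation "R \<equiv> bs_equations c d"
abbreviation "P \<equiv> BS_plus c d"
abbreviation "right_ideal p \<equiv> p <#\<^bsub>P\<^esub> carrier P"
definition "elt u = word_class R (pos u)"

lemma elt_append: "elt u \<otimes>\<^bsub>P\<^esub> elt v = elt (u @ v)"
  by (simp add: BS_plus_def BS_def elt_def mult_word_class pos_def)

lemma elt_Nil: "\<one>\<^bsub>P\<^esub> = elt []"
  by (simp add: BS_plus_def BS_def elt_def pos_def presented_group_def)

lemma carrier_P: "carrier P = range elt"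
proof
  interpret G: monoid "BS c d" unfolding BS_def by (rule monoid_presented_group)
  have m: "elt u \<otimes>\<^bsub>BS c d\<^esub> elt v = elt (u @ v)" for u v
    by (simp add: BS_def elt_def mult_word_class pos_def)
  have one: "\<one>\<^bsub>BS c d\<^esub> = elt []" by (simp add: BS_def elt_def pos_def presented_group_def)
  have ab: "bs_a c d = elt [La]" "bs_b c d = elt [Lb]" by (simp_all add: bs_a_def bs_b_def elt_def pos_def)
  have "carrier (BS c d) = range (word_class R)" by (simp add: BS_def presented_group_def)
  hence sub: "range elt \<subseteq> carrier (BS c d)" by (auto simp: elt_def)
  have "submonoid (range elt) (BS c d)"
    by (rule submonoid.intro[OF sub]) (auto simp: m one)
  thus "carrier P \<subseteq> range elt" by (auto simp: BS_plus_def ab)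
  have "elt u \<in> H" if H: "submonoid H (BS c d)" "bs_a c d \<in> H" "bs_b c d \<in> H" for u H
  proof (induction u)
    case Nil
    show ?case using submonoid.one_closed[OF H(1)] one by simp
  next
    case (Cons x u)
    have "elt [x] \<in> H" using H(2,3) ab by (cases x) simp_all
    thus ?case using submonoid.m_closed[OF H(1) _ Cons] m[of "[x]" u] by fastforce
  qed
  thus "range elt \<subseteq> carrier P" by (auto simp: BS_plus_def)
qed

lemma monoid_P: "monoid P"
  by (rule monoidI) (auto simp: carrier_P elt_Nil elt_append)

lemma relation_P: "elt [La] \<otimes>\<^bsub>P\<^esub> elt [Lb] [^]\<^bsub>P\<^esub> c = elt [Lb] [^]\<^bsub>P\<^esub> d \<otimes>\<^bsub>P\<^esub> elt [La]"
proof -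
  have pw: "elt [Lb] [^]\<^bsub>P\<^esub> m = elt (replicate m Lb)" for m :: nat
  proof (induction m)
    case (Suc m)
    have "replicate m Lb @ [Lb] = replicate (Suc m) Lb" by (simp add: replicate_append_same)
    thus ?case using Suc by (simp add: elt_append monoid.nat_pow_Suc[OF monoid_P])
  qed (simp add: elt_Nil monoid.nat_pow_0[OF monoid_P])
  have "word_eq R (pos ([La] @ replicate c Lb)) (pos (replicate d Lb @ [La]))"
    by (rule word_eq.relator) (simp add: bs_equations_def pos_def)
  thus ?thesis by (simp add: pw elt_append) (simp add: elt_def word_class_eq_iff)
qed

sublocale self: bs_solution c d P "elt [La]" "elt [Lb]"
  by (intro bs_solution.intro bs_solution_axioms.intro bs_axioms monoid_P relation_P) (simp_all add: carrier_P)

lemma self_val: "self.val u = elt u"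
proof (induction u)
  case (Cons x u)
  have "self.lval x = elt [x]" by (simp add: self.lval_def split: bs_letter.split)
  thus ?case using Cons by (simp add: elt_append)
qed (simp add: elt_Nil)

lemma elt_eq_iff: "elt u = elt v \<longleftrightarrow> nf u = nf v"
proof
  assume "elt u = elt v"
  thus "nf u = nf v" by (simp add: elt_def word_class_eq_iff nf_eq_of_word_eq)
next
  assume "nf u = nf v"
  thus "elt u = elt v" using self.val_nf[of u] self.val_nf[of v] by (simp add: self_val)
qed

definition coord :: "(bs_letter \<times> bool) list set \<Rightarrow> nat list \<times> nat" where
  "coord p = nf (SOME u. p = elt u)"

abbreviation "dig p \<equiv> fst (coord p)"
abbreviation "cnt p \<equiv> snd (coord p)"

definition mk :: "nat list \<Rightarrow> nat \<Rightarrow> (bs_letter \<times> bool) list set" where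
  "mk w n = elt (rep (w, n))"

lemma coord_elt: "coord (elt u) = nf u"
  unfolding coord_def by (metis (mono_tags) elt_eq_iff someI)

lemma mk_closed [simp]: "mk w n \<in> carrier P"
  by (simp add: mk_def carrier_P)

lemma mk_coord: assumes "p \<in> carrier P" shows "mk (dig p) (cnt p) = p"
proof -
  obtain u where u: "p = elt u" using assms by (auto simp: carrier_P)
  have "nf (rep (fst (nf u), snd (nf u))) = nf u" by (subst nf_rep[OF digits_nf]) simp
  thus ?thesis unfolding u coord_elt mk_def elt_eq_iff .
qed

lemma coord_mk: "digits w \<Longrightarrow> coord (mk w n) = (w, n)"
  by (simp add: mk_def coord_elt nf_rep)

lemma digits_dig: "p \<in> carrier P \<Longrightarrow> digits (dig p)"
  by (auto simp: carrier_P coord_elt digits_nf)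

lemma mk_mult:
  assumes "digits v" "digits w"
  shows "mk v m \<otimes>\<^bsub>P\<^esub> mk w n = mk (v @ shift m w) (carry m w + n)"
proof -
  have "nf (rep (v, m) @ rep (w, n)) = (v @ shift m w, carry m w + n)"
    using foldr_nact_rep[OF assms, of m n] nf_rep[OF assms(2), of n] by (simp add: nf_def)
  thus ?thesis using assms by (simp add: mk_def elt_append elt_eq_iff nf_rep)
qed

lemma mk_cases: assumes "p \<in> carrier P" obtains w n where "digits w" "p = mk w n"
  by (rule that[OF digits_dig[OF assms] mk_coord[OF assms, symmetric]])

lemma mk_inject:
  assumes "digits v" "digits w" shows "mk v m = mk w n \<longleftrightarrow> v = w \<and> m = n"
proof
  assume "mk v m = mk w n"
  hence "(v, m) = (w, n)" unfolding coord_mk[OF assms(1), symmetric] coord_mk[OF assms(2), symmetric] by (rule arg_cong)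
  thus "v = w \<and> m = n" by simp
qed simp

lemma one_P: "\<one>\<^bsub>P\<^esub> = mk [] 0"
  by (simp add: mk_def rep_def elt_Nil)

section \<open>Principal right ideals of the positive monoid\<close>

text \<open>The adding machine permutes the digit lists of each length.\<close>

lemma shift_surj: "digits z \<Longrightarrow> \<exists>y. digits y \<and> shift m y = z"
proof (induction z arbitrary: m)
  case (Cons j z)
  obtain i where i: "i < d" "(m + i) mod d = j"
  proof
    let ?i = "(j + (d - m mod d)) mod d"
    show "?i < d" using d_pos by simp
    have le: "m mod d \<le> d" using d_pos by (simp add: less_imp_le)
    have "(m + ?i) mod d = (m mod d + (j + (d - m mod d))) mod d" by (simp only: mod_add_left_eq mod_add_right_eq)
    also have "m mod d + (j + (d - m mod d)) = j + d" using le by simp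
    finally show "(m + ?i) mod d = j" using Cons.prems by simp
  qed
  obtain y where "digits y" "shift (c * ((m + i) div d)) y = z" using Cons by auto
  thus ?case using i by (intro exI[of _ "i # y"]) simp
qed (auto intro: exI[of _ "[]"])

lemma shift_append: "shift m (v @ w) = shift m v @ shift (carry m v) w" "carry m (v @ w) = carry (carry m v) w"
  by (induction v arbitrary: m) simp_all

lemma shift_inj: "\<lbrakk>digits u; digits v; shift m u = shift m v\<rbrakk> \<Longrightarrow> u = v"
proof (induction u arbitrary: m v)
  case Nil
  thus ?case by (cases v) simp_all
next
  case (Cons i u)
  then obtain j v' where v: "v = j # v'" by (cases v) auto
  have ij: "i < d" "j < d" "(m + i) mod d = (m + j) mod d" using Cons.prems by (auto simp: v)
  have "k = l" if "k \<le> l" "l < d" "(m + k) mod d = (m + l) mod d" for k l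
  proof -
    have "d dvd (m + l) - (m + k)" using that by (subst mod_eq_dvd_iff_nat[symmetric]) auto
    hence "d dvd l - k" by simp
    thus ?thesis using that by (auto dest: dvd_imp_le)
  qed
  from this[of i j] this[of j i] have "i = j" using ij by (cases "i \<le> j") auto
  thus ?case using Cons by (auto simp: v)
qed

lemma mem_ideal_iff:
  assumes "digits v"
  shows "x \<in> right_ideal (mk v m) \<longleftrightarrow>
    (\<exists>y k. digits y \<and> x = mk (v @ shift m y) (carry m y + k))"
proof
  assume "x \<in> right_ideal (mk v m)"
  then obtain q where "q \<in> carrier P" "x = mk v m \<otimes>\<^bsub>P\<^esub> q" by (auto simp: l_coset_def)
  moreover obtain y k where "digits y" "q = mk y k" using \<open>q \<in> carrier P\<close> by (rule mk_cases)
  ultimately have "digits y \<and> x = mk (v @ shift m y) (carry m y + k)" using assms by (simp add: mk_mult)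
  thus "\<exists>y k. digits y \<and> x = mk (v @ shift m y) (carry m y + k)" by blast
next
  assume "\<exists>y k. digits y \<and> x = mk (v @ shift m y) (carry m y + k)"
  then obtain y k where "digits y" "x = mk (v @ shift m y) (carry m y + k)" by blast
  hence "x = mk v m \<otimes>\<^bsub>P\<^esub> mk y k" using assms by (simp add: mk_mult)
  thus "x \<in> right_ideal (mk v m)" using mk_closed unfolding l_coset_def by blast
qed

lemma ideal_eqD:
  assumes "p \<in> carrier P" "q \<in> carrier P" "right_ideal p = right_ideal q"
  shows "p = q"
proof -
  obtain v m where p: "digits v" "p = mk v m" using assms(1) by (rule mk_cases)
  obtain w n where q: "digits w" "q = mk w n" using assms(2) by (rule mk_cases)
  have "p \<in> right_ideal p" "q \<in> right_ideal q"
    using assms(1,2) self.r_one self.one_closed unfolding l_coset_def by fastforce+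
  hence "p \<in> right_ideal (mk w n)" "q \<in> right_ideal (mk v m)" using assms(3) p q by auto
  then obtain y k y' k' where 1: "digits y" "p = mk (w @ shift n y) (carry n y + k)"
    "digits y'" "q = mk (v @ shift m y') (carry m y' + k')"
    using p q by (auto simp: mem_ideal_iff)
  have "v = w @ shift n y \<and> m = carry n y + k" using 1 p q by (simp add: mk_inject)
  moreover have "w = v @ shift m y' \<and> n = carry m y' + k'" using 1 p q by (simp add: mk_inject)
  ultimately have "y = []" "y' = []" "m = n + k" "n = m + k'" "v = w"
    by (metis append_self_conv append_assoc append_is_Nil_conv length_0_conv length_shift carry.simps(1) shift.simps(1))+
  thus ?thesis using p q by simp
qed

text \<open>With \<open>p\<close> having digits \<open>v\<close> and \<open>q\<close> having digits \<open>vz\<close>, a common multiple must first extend \<open>p\<close> by the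
  unique digit string \<open>y\<close> that the adding machine turns into \<open>z\<close>. After that the two elements differ only in
  the last exponent, and the larger exponent wins.\<close>

lemma ideal_inter_prefix:
  assumes "digits v" "digits z"
  shows "\<exists>r\<in>carrier P. dig r = v @ z \<and>
    right_ideal (mk v m) \<inter> right_ideal (mk (v @ z) n) = right_ideal r"
proof -
  obtain y where y: "digits y" "shift m y = z" using shift_surj[OF assms(2)] by blast
  define r where "r = mk (v @ z) (max (carry m y) n)"
  have raise: "digits w \<Longrightarrow> right_ideal (mk w (k + l)) \<subseteq> right_ideal (mk w k)" for w k l
  proof
    fix x assume w: "digits w" and "x \<in> right_ideal (mk w (k + l))"
    then obtain u j where "digits u" "x = mk (w @ shift (k + l) u) (carry (k + l) u + j)"
      by (auto simp: mem_ideal_iff)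
    thus "x \<in> right_ideal (mk w k)"
      using w shift_add[of k l u] unfolding mem_ideal_iff[OF w]
      by (intro exI[of _ "shift l u"] exI[of _ "carry l u + j"]) (simp add: add.assoc)
  qed
  have sub: "right_ideal (mk (v @ z) (carry m y)) \<subseteq> right_ideal (mk v m)"
  proof
    fix x assume "x \<in> right_ideal (mk (v @ z) (carry m y))"
    then obtain u j where "digits u" "x = mk ((v @ z) @ shift (carry m y) u) (carry (carry m y) u + j)"
      using assms by (auto simp: mem_ideal_iff)
    thus "x \<in> right_ideal (mk v m)"
      using y assms by (auto simp: mem_ideal_iff shift_append intro!: exI[of _ "y @ u"] exI[of _ j])
  qed
  have "right_ideal r \<subseteq> right_ideal (mk v m) \<inter> right_ideal (mk (v @ z) n)"
    using raise[of "v @ z" "carry m y" "max (carry m y) n - carry m y"] sub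
      raise[of "v @ z" n "max (carry m y) n - n"] assms by (auto simp: r_def)
  moreover have "right_ideal (mk v m) \<inter> right_ideal (mk (v @ z) n) \<subseteq> right_ideal r"
  proof
    fix x assume x: "x \<in> right_ideal (mk v m) \<inter> right_ideal (mk (v @ z) n)"
    obtain y1 k1 where 1: "digits y1" "x = mk (v @ shift m y1) (carry m y1 + k1)"
      using x assms by (auto simp: mem_ideal_iff)
    obtain y2 k2 where 2: "digits y2" "x = mk ((v @ z) @ shift n y2) (carry n y2 + k2)"
      using x assms by (auto simp: mem_ideal_iff)
    have "v @ shift m y1 = (v @ z) @ shift n y2 \<and> carry m y1 + k1 = carry n y2 + k2"
      using 1 2 assms by (subst mk_inject[symmetric]) auto
    hence eq: "shift m y1 = z @ shift n y2" "carry m y1 + k1 = carry n y2 + k2" by simp_all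
    define u where "u = take (length z) y1"
    define u' where "u' = drop (length z) y1"
    have y1: "y1 = u @ u'" by (simp add: u_def u'_def)
    have len: "length u = length z" unfolding u_def using eq(1) by (metis length_append length_shift length_take min.absorb2 le_add1)
    have "shift m u = z" "shift (carry m u) u' = shift n y2"
      using eq(1) len by (auto simp: y1 shift_append append_eq_append_conv)
    moreover have "u = y" 
      using shift_inj[of u y m] \<open>shift m u = z\<close> y 1(1) y1 by simp
    ultimately have e: "shift (carry m y) u' = shift n y2" by simp
    show "x \<in> right_ideal r"
    proof (cases "carry m y \<ge> n")
      case True
      have "x = mk ((v @ z) @ shift (carry m y) u') (carry (carry m y) u' + k1)"
        using 1 y y1 \<open>u = y\<close> by (simp add: shift_append)
      thus ?thesis using True 1(1) y1 assms by (auto simp: r_def mem_ideal_iff max_def)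
    next
      case False
      thus ?thesis using 2 assms by (auto simp: r_def mem_ideal_iff max_def)
    qed
  qed
  ultimately show ?thesis using assms by (intro bexI[of _ r]) (auto simp: r_def coord_mk)
qed

end

section \<open>Relations are inherited from jointly faithful representations\<close>

lemma star_hom_finsum:
  assumes "cstar_algebra A" "cstar_algebra B" "\<phi> \<in> star_hom A B" "finite I" "\<And>i. i \<in> I \<Longrightarrow> f i \<in> carrier A"
  shows "\<phi> (\<Oplus>\<^bsub>A\<^esub>i\<in>I. f i) = (\<Oplus>\<^bsub>B\<^esub>i\<in>I. \<phi> (f i))"
proof -
  interpret A: cstar_algebra A by fact
  interpret B: cstar_algebra B by fact
  show ?thesis using assms(4,5)
  proof (induction I rule: finite_induct)
    case empty
    show ?case using star_hom_zero[OF assms(1-3)] by simp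
  next
    case (insert i I)
    have c: "(\<Oplus>\<^bsub>A\<^esub>i\<in>I. f i) \<in> carrier A" using insert by (intro A.finsum_closed) auto
    have "\<phi> (\<Oplus>\<^bsub>A\<^esub>i\<in>insert i I. f i) = \<phi> (f i \<oplus>\<^bsub>A\<^esub> (\<Oplus>\<^bsub>A\<^esub>i\<in>I. f i))"
      using insert by (subst A.finsum_insert) auto
    also have "\<dots> = \<phi> (f i) \<oplus>\<^bsub>B\<^esub> (\<Oplus>\<^bsub>B\<^esub>i\<in>I. \<phi> (f i))"
      using insert c by (subst star_homD(4)[OF assms(3)]) auto
    also have "\<dots> = (\<Oplus>\<^bsub>B\<^esub>i\<in>insert i I. \<phi> (f i))"
      using insert star_homD(1)[OF assms(3)] by (subst B.finsum_insert) auto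
    finally show ?case .
  qed
qed

lemma jointly_faithful_eq:
  fixes A :: "('a, 'm) cstar_scheme" (structure)
  assumes "jointly_faithful A G g \<Theta>" "x \<in> carrier A" "y \<in> carrier A"
    and "\<And>B h \<phi>. (B, h, \<phi>) \<in> \<Theta> \<Longrightarrow> \<phi> x = \<phi> y"
  shows "x = y"
proof -
  interpret cstar_algebra A using assms(1) by (simp add: jointly_faithful_def)
  have "\<phi> (x \<ominus> y) = \<zero>\<^bsub>B\<^esub>" if th: "(B, h, \<phi>) \<in> \<Theta>" for B h \<phi>
  proof -
    have B: "cstar_algebra B" and f: "\<phi> \<in> star_hom A B"
      using assms(1) th by (auto simp: jointly_faithful_def)
    interpret B: cstar_algebra B by fact
    show ?thesis using star_hom_minus[OF cstar_algebra_axioms B f assms(2,3)] assms(4)[OF th]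
        star_homD(1)[OF f assms(3)] by (simp add: a_minus_def B.r_neg)
  qed
  hence "\<forall>(B, h, \<phi>)\<in>\<Theta>. \<phi> (x \<ominus> y) = \<zero>\<^bsub>B\<^esub>" by blast
  hence "x \<ominus> y = \<zero>" using assms(1-3) unfolding jointly_faithful_def by simp
  thus ?thesis using assms(2,3) eq_iff_minus by simp
qed

lemma jointly_faithfulD:
  assumes "jointly_faithful A G g \<Theta>"
  shows "cstar_algebra A" "x \<in> G \<Longrightarrow> g x \<in> carrier A"
    "(B, h, \<phi>) \<in> \<Theta> \<Longrightarrow> cstar_algebra B" "(B, h, \<phi>) \<in> \<Theta> \<Longrightarrow> \<phi> \<in> star_hom A B"
    "(B, h, \<phi>) \<in> \<Theta> \<Longrightarrow> x \<in> G \<Longrightarrow> \<phi> (g x) = h x"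
  using assms by (auto simp: jointly_faithful_def)

text \<open>An element that every representation sends to the unit is itself a unit.\<close>

lemma jointly_faithful_unit:
  fixes A :: "('a, 'm) cstar_scheme" (structure)
  assumes J: "jointly_faithful A G g \<Theta>" and u: "u \<in> carrier A"
    and units: "\<forall>(B, h, \<phi>)\<in>\<Theta>. monoid B \<and> \<phi> u = \<one>\<^bsub>B\<^esub>"
  shows "monoid A" "\<one> = u"
proof -
  have unit: "monoid B \<and> \<phi> u = \<one>\<^bsub>B\<^esub>" if "(B, h, \<phi>) \<in> \<Theta>" for B h \<phi> using units that by blast
  note A = jointly_faithfulD(1)[OF J]
  interpret cstar_algebra A by (rule A)
  have "u \<otimes> x = x \<and> x \<otimes> u = x" if x: "x \<in> carrier A" for x
  proof -
    have f: "\<phi> (u \<otimes> x) = \<phi> x \<and> \<phi> (x \<otimes> u) = \<phi> x" if th: "(B, h, \<phi>) \<in> \<Theta>" for B h \<phi>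
    proof -
      interpret B: monoid B using unit[OF th] by simp
      note f = jointly_faithfulD(4)[OF J th]
      show ?thesis using unit[OF th] star_homD(1)[OF f x] u x
        by (simp add: star_homD(5)[OF f])
    qed
    have "u \<otimes> x = x" by (rule jointly_faithful_eq[OF J]) (use f u x mult_closed in auto)
    moreover have "x \<otimes> u = x" by (rule jointly_faithful_eq[OF J]) (use f u x mult_closed in auto)
    ultimately show ?thesis ..
  qed
  moreover have "unit_determined A" using J by (simp add: jointly_faithful_def)
  ultimately show "monoid A" "\<one> = u" using unit_determined_monoid[OF A _ u] by auto
qed

text \<open>The relations are equations, so they can be tested in the representations. The one exception is
  the existence of a unit, which is produced as the value of the sum \<open>\<Sum> t\<^sub>i t\<^sub>i\<^sup>*\<close>.\<close>

lemma reflect_st: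
  fixes A :: "('a, 'm) cstar_scheme" (structure)
  assumes J: "jointly_faithful A (st_gens d) g \<Theta>"
    and R: "\<And>B h \<phi>. (B, h, \<phi>) \<in> \<Theta> \<Longrightarrow> st_relations c d B h" and "0 < d"
  shows "st_relations c d A g"
proof -
  note A = jointly_faithfulD(1)[OF J]
  interpret A: cstar_algebra A by (rule A)
  have car: "g S \<in> carrier A" "i \<in> {1..d} \<Longrightarrow> g (T i) \<in> carrier A" for i
    using jointly_faithfulD(2)[OF J] by (simp_all add: st_gens_def)
  define u where "u = (\<Oplus>i\<in>{1..d}. g (T i) \<otimes> star A (g (T i)))"
  have u: "u \<in> carrier A" unfolding u_def by (rule A.finsum_closed) (auto intro!: A.mult_closed A.star_closed car)
  have ph: "\<phi> (g S) = h S \<and> (\<forall>i\<in>{1..d}. \<phi> (g (T i)) = h (T i))" if "(B, h, \<phi>) \<in> \<Theta>" for B h \<phi>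
    using jointly_faithfulD(5)[OF J that] by (simp add: st_gens_def)
  have unit: "monoid B \<and> \<phi> u = \<one>\<^bsub>B\<^esub>" if th: "(B, h, \<phi>) \<in> \<Theta>" for B h \<phi>
  proof -
    note f = jointly_faithfulD(4)[OF J th]
    interpret B: cstar_algebra B by (rule jointly_faithfulD(3)[OF J th])
    have "\<phi> u = (\<Oplus>\<^bsub>B\<^esub>i\<in>{1..d}. \<phi> (g (T i) \<otimes> star A (g (T i))))"
      unfolding u_def by (rule star_hom_finsum[OF A B.cstar_algebra_axioms f])
        (auto intro!: A.mult_closed A.star_closed car)
    also have "\<dots> = (\<Oplus>\<^bsub>B\<^esub>i\<in>{1..d}. h (T i) \<otimes>\<^bsub>B\<^esub> star B (h (T i)))"
    proof (rule B.finsum_cong')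
      show "(\<lambda>i. h (T i) \<otimes>\<^bsub>B\<^esub> star B (h (T i))) \<in> {1..d} \<rightarrow> carrier B"
        using R[OF th] by (auto simp: st_relations_def isometry_def intro!: B.mult_closed B.star_closed)
      fix i assume i: "i \<in> {1..d}"
      show "\<phi> (g (T i) \<otimes> star A (g (T i))) = h (T i) \<otimes>\<^bsub>B\<^esub> star B (h (T i))"
        using ph[OF th] i car(2)[OF i] by (simp add: star_homD[OF f] A.star_closed)
    qed simp
    finally show ?thesis using R[OF th] by (simp add: st_relations_def)
  qed
  have "\<forall>(B, h, \<phi>)\<in>\<Theta>. monoid B \<and> \<phi> u = \<one>\<^bsub>B\<^esub>" using unit by blast
  note one = jointly_faithful_unit[OF J u this]
  interpret M: monoid A by (rule one(1))
  have eqI: "x = y" if "x \<in> carrier A" "y \<in> carrier A"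
    "\<And>B h \<phi>. (B, h, \<phi>) \<in> \<Theta> \<Longrightarrow> \<phi> x = \<phi> y" for x y
    using jointly_faithful_eq[OF J that(1,2)] that(3) by blast
  have phi_one: "\<phi> \<one> = \<one>\<^bsub>B\<^esub>" if "(B, h, \<phi>) \<in> \<Theta>" for B h \<phi>
    using unit[OF that] one(2) by simp
  have iso: "star A x \<otimes> x = \<one>" if x: "x \<in> carrier A"
    "\<And>B h \<phi>. (B, h, \<phi>) \<in> \<Theta> \<Longrightarrow> star B (\<phi> x) \<otimes>\<^bsub>B\<^esub> \<phi> x = \<one>\<^bsub>B\<^esub>" for x
    by (rule eqI) (use x phi_one in \<open>auto simp: star_homD[OF jointly_faithfulD(4)[OF J]] A.star_closed\<close>)
  have coiso: "x \<otimes> star A x = \<one>" if x: "x \<in> carrier A"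
    "\<And>B h \<phi>. (B, h, \<phi>) \<in> \<Theta> \<Longrightarrow> \<phi> x \<otimes>\<^bsub>B\<^esub> star B (\<phi> x) = \<one>\<^bsub>B\<^esub>" for x
    by (rule eqI) (use x phi_one in \<open>auto simp: star_homD[OF jointly_faithfulD(4)[OF J]] A.star_closed\<close>)
  have pow: "\<phi> (g S [^] (n::nat)) = h S [^]\<^bsub>B\<^esub> n" if th: "(B, h, \<phi>) \<in> \<Theta>" for B h \<phi> n
  proof (induction n)
    case (Suc n)
    interpret B: monoid B using unit[OF th] by simp
    show ?case using Suc car ph[OF th] by (simp add: star_homD[OF jointly_faithfulD(4)[OF J th]])
  next
    case 0
    interpret B: monoid B using unit[OF th] by simp
    show ?case using phi_one[OF th] by simp
  qed
  show ?thesis unfolding st_relations_def unitary_def isometry_def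
  proof (intro conjI ballI allI impI)
    show "monoid A" by (rule one(1))
    show "star A (g S) \<otimes> g S = \<one>"
    proof (rule iso[OF car(1)])
      fix B h \<phi> assume th: "(B, h, \<phi>) \<in> \<Theta>"
      show "star B (\<phi> (g S)) \<otimes>\<^bsub>B\<^esub> \<phi> (g S) = \<one>\<^bsub>B\<^esub>"
        using R[OF th] ph[OF th] by (simp add: st_relations_def unitary_def)
    qed
    show "g S \<otimes> star A (g S) = \<one>"
    proof (rule coiso[OF car(1)])
      fix B h \<phi> assume th: "(B, h, \<phi>) \<in> \<Theta>"
      show "\<phi> (g S) \<otimes>\<^bsub>B\<^esub> star B (\<phi> (g S)) = \<one>\<^bsub>B\<^esub>"
        using R[OF th] ph[OF th] by (simp add: st_relations_def unitary_def)
    qed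
    show "g S \<in> carrier A" "i \<in> {1..d} \<Longrightarrow> g (T i) \<in> carrier A" for i using car by blast+
    show "star A (g (T i)) \<otimes> g (T i) = \<one>" if i: "i \<in> {1..d}" for i
    proof (rule iso[OF car(2)[OF i]])
      fix B h \<phi> assume th: "(B, h, \<phi>) \<in> \<Theta>"
      show "star B (\<phi> (g (T i))) \<otimes>\<^bsub>B\<^esub> \<phi> (g (T i)) = \<one>\<^bsub>B\<^esub>"
        using R[OF th] ph[OF th] i by (simp add: st_relations_def isometry_def)
    qed
    show "(\<Oplus>i\<in>{1..d}. g (T i) \<otimes> star A (g (T i))) = \<one>"
      using one(2) by (simp add: u_def)
    show "g S \<otimes> g (T i) = g (T (i + 1))" if i: "1 \<le> i \<and> i < d" for i
    proof (rule eqI)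
      fix B h \<phi> assume th: "(B, h, \<phi>) \<in> \<Theta>"
      have "i \<in> {1..d}" "i + 1 \<in> {1..d}" using i by auto
      thus "\<phi> (g S \<otimes> g (T i)) = \<phi> (g (T (i + 1)))"
        using R[OF th] ph[OF th] i car by (simp add: star_homD[OF jointly_faithfulD(4)[OF J th]] st_relations_def)
    qed (use car i in \<open>auto intro!: A.mult_closed\<close>)
    show "g S \<otimes> g (T d) = g (T 1) \<otimes> g S [^] c"
    proof (rule eqI)
      fix B h \<phi> assume th: "(B, h, \<phi>) \<in> \<Theta>"
      have "1 \<in> {1..d}" "d \<in> {1..d}" using \<open>0 < d\<close> by auto
      thus "\<phi> (g S \<otimes> g (T d)) = \<phi> (g (T 1) \<otimes> g S [^] c)"
        using R[OF th] ph[OF th] car pow[OF th] by (simp add: star_homD[OF jointly_faithfulD(4)[OF J th]] st_relations_def)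
    qed (use car \<open>0 < d\<close> in \<open>auto intro!: A.mult_closed\<close>)
  qed
qed

section \<open>Right LCM monoids\<close>

text \<open>In a left cancellative monoid, injectivity of \<open>p \<mapsto> pP\<close> means that there are no nontrivial units.\<close>

locale right_lcm = P: monoid P for P :: "('p, 'k) monoid_scheme" +
  assumes ideal_inj: "\<lbrakk>p \<in> carrier P; q \<in> carrier P; p <#\<^bsub>P\<^esub> carrier P = q <#\<^bsub>P\<^esub> carrier P\<rbrakk> \<Longrightarrow> p = q"
    and lcm: "\<lbrakk>p \<in> carrier P; q \<in> carrier P\<rbrakk> \<Longrightarrow>
      (p <#\<^bsub>P\<^esub> carrier P) \<inter> (q <#\<^bsub>P\<^esub> carrier P) = {} \<or>
      (\<exists>r\<in>carrier P. (p <#\<^bsub>P\<^esub> carrier P) \<inter> (q <#\<^bsub>P\<^esub> carrier P) = r <#\<^bsub>P\<^esub> carrier P)"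
begin

abbreviation "right_ideal p \<equiv> p <#\<^bsub>P\<^esub> carrier P"

lemma ideal_one: "right_ideal \<one>\<^bsub>P\<^esub> = carrier P"
  by (auto simp: l_coset_def)

lemma ideal_self: "p \<in> carrier P \<Longrightarrow> p \<in> right_ideal p"
  unfolding l_coset_def using P.r_one P.one_closed by fastforce

lemma ideal_subset: "p \<in> carrier P \<Longrightarrow> right_ideal p \<subseteq> carrier P"
  by (auto simp: l_coset_def)

lemma ideal_coset: "\<lbrakk>p \<in> carrier P; q \<in> carrier P\<rbrakk> \<Longrightarrow> p <#\<^bsub>P\<^esub> (right_ideal q) = right_ideal (p \<otimes>\<^bsub>P\<^esub> q)"
  by (auto simp: l_coset_def P.m_assoc)

lemma ideal_mono: "\<lbrakk>p \<in> carrier P; q \<in> right_ideal p\<rbrakk> \<Longrightarrow> right_ideal q \<subseteq> right_ideal p"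
  by (auto simp: l_coset_def P.m_assoc)

lemma principal_ideal [simp]: "p \<in> carrier P \<Longrightarrow> right_ideal p \<in> principal_ideals P"
  by (auto simp: principal_ideals_def)

lemma principal_ideals_cases:
  assumes "X \<in> principal_ideals P"
  obtains "X = {}" | p where "p \<in> carrier P" "X = right_ideal p"
  using assms by (auto simp: principal_ideals_def)

lemma empty_ideal [simp]: "{} \<in> principal_ideals P"
  by (simp add: principal_ideals_def)

lemma full_ideal [simp]: "carrier P \<in> principal_ideals P"
  using principal_ideal[OF P.one_closed] by (simp add: ideal_one)

lemma principal_ideals_coset:
  assumes "p \<in> carrier P" "X \<in> principal_ideals P" shows "p <#\<^bsub>P\<^esub> X \<in> principal_ideals P"
  using assms(2)
proof (cases rule: principal_ideals_cases)
  case 1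
  thus ?thesis by (simp add: l_coset_def)
next
  case (2 q)
  thus ?thesis using assms by (simp add: ideal_coset)
qed

lemma principal_ideals_inter:
  assumes "X \<in> principal_ideals P" "Y \<in> principal_ideals P" shows "X \<inter> Y \<in> principal_ideals P"
  using assms(1)
proof (cases rule: principal_ideals_cases)
  case (2 p)
  note p = 2
  show ?thesis using assms(2)
  proof (cases rule: principal_ideals_cases)
    case (2 q)
    show ?thesis using lcm[OF p(1) 2(1)] p(2) 2(2) by auto
  qed simp
qed simp

text \<open>Again everything but the unit is equational, and the unit is the projection of the ideal \<open>P\<close>.\<close>

lemma reflect_boundary:
  fixes A :: "('a, 'm) cstar_scheme" (structure)
  assumes J: "jointly_faithful A (boundary_gens P) g \<Theta>"
    and R: "\<And>B h \<phi>. (B, h, \<phi>) \<in> \<Theta> \<Longrightarrow> boundary_relations P B h"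
  shows "boundary_relations P A g"
proof -
  note A = jointly_faithfulD(1)[OF J]
  interpret A: cstar_algebra A by (rule A)
  note full = full_ideal
  have carV: "g (V p) \<in> carrier A" if "p \<in> carrier P" for p
    using jointly_faithfulD(2)[OF J] that by (simp add: boundary_gens_def)
  have carE: "g (E X) \<in> carrier A" if "X \<in> principal_ideals P" for X
    using jointly_faithfulD(2)[OF J] that by (simp add: boundary_gens_def)
  have phV: "\<phi> (g (V p)) = h (V p)" if "(B, h, \<phi>) \<in> \<Theta>" "p \<in> carrier P" for B h \<phi> p
    using jointly_faithfulD(5)[OF J that(1)] that(2) by (simp add: boundary_gens_def)
  have phE: "\<phi> (g (E X)) = h (E X)" if "(B, h, \<phi>) \<in> \<Theta>" "X \<in> principal_ideals P" for B h \<phi> X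
    using jointly_faithfulD(5)[OF J that(1)] that(2) by (simp add: boundary_gens_def)
  have unit: "monoid B \<and> \<phi> (g (E (carrier P))) = \<one>\<^bsub>B\<^esub>" if th: "(B, h, \<phi>) \<in> \<Theta>" for B h \<phi>
    using R[OF th] phE[OF th full] by (simp add: boundary_relations_def)
  have "\<forall>(B, h, \<phi>)\<in>\<Theta>. monoid B \<and> \<phi> (g (E (carrier P))) = \<one>\<^bsub>B\<^esub>" using unit by blast
  note one = jointly_faithful_unit[OF J carE[OF full] this]
  interpret M: unital_cstar A using A one(1) by (simp add: unital_cstar_def)
  have eqI: "x = y" if "x \<in> carrier A" "y \<in> carrier A"
    "\<And>B h \<phi>. (B, h, \<phi>) \<in> \<Theta> \<Longrightarrow> \<phi> x = \<phi> y" for x y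
    using jointly_faithful_eq[OF J that(1,2)] that(3) by blast
  have phi_one: "\<phi> \<one> = \<one>\<^bsub>B\<^esub>" if "(B, h, \<phi>) \<in> \<Theta>" for B h \<phi>
    using unit[OF that] one(2) by simp
  note ideal = principal_ideal and ideal_mult = principal_ideals_coset
  note hom = star_homD[OF jointly_faithfulD(4)[OF J]]
  show ?thesis unfolding boundary_relations_def isometry_def projection_def
  proof (intro conjI ballI allI impI)
    show "monoid A" by (rule one(1))
    show "g (E (carrier P)) = \<one>" using one(2) by simp
    have em: "{} \<in> principal_ideals P" by (simp add: principal_ideals_def)
    show "g (E {}) = \<zero>"
    proof (rule eqI[OF carE[OF em] A.zero_closed])
      fix B h \<phi> assume th: "(B, h, \<phi>) \<in> \<Theta>"
      show "\<phi> (g (E {})) = \<phi> \<zero>"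
        using R[OF th] phE[OF th em] star_hom_zero[OF A jointly_faithfulD(3,4)[OF J th]]
        by (simp add: boundary_relations_def)
    qed
  next
    fix p assume p: "p \<in> carrier P"
    show "g (V p) \<in> carrier A" by (rule carV[OF p])
    show "star A (g (V p)) \<otimes> g (V p) = \<one>"
    proof (rule eqI)
      fix B h \<phi> assume th: "(B, h, \<phi>) \<in> \<Theta>"
      show "\<phi> (star A (g (V p)) \<otimes> g (V p)) = \<phi> \<one>"
        using R[OF th] p by (simp add: hom[OF th] carV A.star_closed phV[OF th] phi_one[OF th] boundary_relations_def isometry_def)
    qed (auto simp: A.mult_closed A.star_closed carV p)
  next
    fix X assume X: "X \<in> principal_ideals P"
    show "g (E X) \<in> carrier A" by (rule carE[OF X])
    show "g (E X) \<otimes> g (E X) = g (E X)"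
    proof (rule eqI)
      fix B h \<phi> assume th: "(B, h, \<phi>) \<in> \<Theta>"
      show "\<phi> (g (E X) \<otimes> g (E X)) = \<phi> (g (E X))"
        using R[OF th] X by (simp add: hom[OF th] carE phE[OF th] boundary_relations_def projection_def)
    qed (auto simp: A.mult_closed carE X)
    show "star A (g (E X)) = g (E X)"
    proof (rule eqI)
      fix B h \<phi> assume th: "(B, h, \<phi>) \<in> \<Theta>"
      show "\<phi> (star A (g (E X))) = \<phi> (g (E X))"
        using R[OF th] X by (simp add: hom[OF th] carE phE[OF th] boundary_relations_def projection_def)
    qed (auto simp: A.star_closed carE X)
  next
    fix p q assume p: "p \<in> carrier P" and q: "q \<in> carrier P"
    show "g (V p) \<otimes> g (V q) = g (V (p \<otimes>\<^bsub>P\<^esub> q))"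
    proof (rule eqI)
      fix B h \<phi> assume th: "(B, h, \<phi>) \<in> \<Theta>"
      show "\<phi> (g (V p) \<otimes> g (V q)) = \<phi> (g (V (p \<otimes>\<^bsub>P\<^esub> q)))"
        using R[OF th] p q by (simp add: hom[OF th] carV phV[OF th] boundary_relations_def)
    qed (auto simp: A.mult_closed carV p q)
  next
    fix p X assume p: "p \<in> carrier P" and X: "X \<in> principal_ideals P"
    show "g (V p) \<otimes> g (E X) \<otimes> star A (g (V p)) = g (E (p <#\<^bsub>P\<^esub> X))"
    proof (rule eqI)
      fix B h \<phi> assume th: "(B, h, \<phi>) \<in> \<Theta>"
      show "\<phi> (g (V p) \<otimes> g (E X) \<otimes> star A (g (V p))) = \<phi> (g (E (p <#\<^bsub>P\<^esub> X)))"
        using R[OF th] p X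
        by (simp add: hom[OF th] carV carE A.star_closed A.mult_closed phV[OF th] phE[OF th] ideal_mult boundary_relations_def)
    qed (auto simp: A.mult_closed A.star_closed carV carE ideal_mult p X)
  next
    fix X Y assume X: "X \<in> principal_ideals P" and Y: "Y \<in> principal_ideals P"
    show "g (E X) \<otimes> g (E Y) = g (E (X \<inter> Y))"
    proof (rule eqI)
      fix B h \<phi> assume th: "(B, h, \<phi>) \<in> \<Theta>"
      show "\<phi> (g (E X) \<otimes> g (E Y)) = \<phi> (g (E (X \<inter> Y)))"
        using R[OF th] X Y by (simp add: hom[OF th] carE phE[OF th] boundary_relations_def principal_ideals_inter)
    qed (auto simp: A.mult_closed carE X Y principal_ideals_inter)
  next
    fix ps assume ps: "distinct ps \<and> foundation_set P (set ps)"
    hence sub: "set ps \<subseteq> carrier P" by (simp add: foundation_set_def)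
    have cl: "foldr (\<lambda>p x. (\<one> \<ominus> g (E (right_ideal p))) \<otimes> x) qs \<one> \<in> carrier A \<and>
       (\<forall>(B, h, \<phi>)\<in>\<Theta>. \<phi> (foldr (\<lambda>p x. (\<one> \<ominus> g (E (right_ideal p))) \<otimes> x) qs \<one>) =
         foldr (\<lambda>p x. (\<one>\<^bsub>B\<^esub> \<ominus>\<^bsub>B\<^esub> h (E (right_ideal p))) \<otimes>\<^bsub>B\<^esub> x) qs \<one>\<^bsub>B\<^esub>)" if "set qs \<subseteq> carrier P" for qs
      using that
    proof (induction qs)
      case Nil
      thus ?case using phi_one by auto
    next
      case (Cons q qs)
      have q: "q \<in> carrier P" using Cons.prems by simp
      have "\<phi> (\<one> \<ominus> g (E (right_ideal q))) = \<one>\<^bsub>B\<^esub> \<ominus>\<^bsub>B\<^esub> h (E (right_ideal q))"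
        if th: "(B, h, \<phi>) \<in> \<Theta>" for B h \<phi>
        using star_hom_minus[OF A jointly_faithfulD(3,4)[OF J th] M.one_closed carE[OF ideal[OF q]]]
          phi_one[OF th] phE[OF th ideal[OF q]] by simp
      thus ?case using Cons carE[OF ideal[OF q]] by (auto simp: hom)
    qed
    show "foldr (\<lambda>p x. (\<one> \<ominus> g (E (right_ideal p))) \<otimes> x) ps \<one> = \<zero>"
    proof (rule eqI)
      fix B h \<phi> assume th: "(B, h, \<phi>) \<in> \<Theta>"
      have "foldr (\<lambda>p x. (\<one>\<^bsub>B\<^esub> \<ominus>\<^bsub>B\<^esub> h (E (right_ideal p))) \<otimes>\<^bsub>B\<^esub> x) ps \<one>\<^bsub>B\<^esub> = \<zero>\<^bsub>B\<^esub>"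
        using R[OF th] ps unfolding boundary_relations_def by blast
      thus "\<phi> (foldr (\<lambda>p x. (\<one> \<ominus> g (E (right_ideal p))) \<otimes> x) ps \<one>) = \<phi> \<zero>"
        using cl[OF sub] th star_hom_zero[OF A jointly_faithfulD(3,4)[OF J th]] by auto
    qed (use cl[OF sub] in auto)
  qed
qed

section \<open>Boundary relations and path relations\<close>

text \<open>In the path algebra the identity morphism need not be sent to the unit of the target; the
  version of the relations in which it is has the same universal algebra.\<close>

definition path_unital :: "('a, 'n) cstar_scheme \<Rightarrow> ('p \<Rightarrow> 'a) \<Rightarrow> bool" where
  "path_unital A \<tau> \<longleftrightarrow> path_relations (monoid_category P) A \<tau> \<and> monoid A \<and> \<tau> \<one>\<^bsub>P\<^esub> = \<one>\<^bsub>A\<^esub>"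

text \<open>The projection of a nonempty ideal is forced to be \<open>\<tau>\<^sub>r \<tau>\<^sub>r\<^sup>*\<close> for its generator \<open>r\<close>, which is unique.\<close>

definition boundary_family :: "('a, 'n) cstar_scheme \<Rightarrow> ('p \<Rightarrow> 'a) \<Rightarrow> 'p boundary_gen \<Rightarrow> 'a" where
  "boundary_family A \<tau> x = (case x of V p \<Rightarrow> \<tau> p | E X \<Rightarrow> if X = {} then \<zero>\<^bsub>A\<^esub> else
     (let r = (SOME r. r \<in> carrier P \<and> X = right_ideal r) in \<tau> r \<otimes>\<^bsub>A\<^esub> star A (\<tau> r)))"

lemma boundary_family_V [simp]: "boundary_family A \<tau> (V p) = \<tau> p"
  by (simp add: boundary_family_def)

lemma boundary_family_empty [simp]: "boundary_family A \<tau> (E {}) = \<zero>\<^bsub>A\<^esub>"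
  by (simp add: boundary_family_def)

lemma boundary_family_E [simp]:
  assumes "p \<in> carrier P"
  shows "boundary_family A \<tau> (E (right_ideal p)) = \<tau> p \<otimes>\<^bsub>A\<^esub> star A (\<tau> p)"
proof -
  have "(SOME r. r \<in> carrier P \<and> right_ideal p = right_ideal r) = p"
    using assms ideal_inj by (intro some_equality) auto
  moreover have "right_ideal p \<noteq> {}" using ideal_self[OF assms] by blast
  ultimately show ?thesis by (simp add: boundary_family_def)
qed

lemma extensions_eq: "extensions (monoid_category P) p = right_ideal p"
  by (auto simp: extensions_def monoid_category_def l_coset_def)

lemma min_common_ext_empty:
  "right_ideal p \<inter> right_ideal q = {} \<Longrightarrow> min_common_ext (monoid_category P) p q = {}"
  by (simp add: min_common_ext_def extensions_eq)

text \<open>Minimal common extensions are the generators of the intersection, and there is only one.\<close>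

lemma min_common_ext_lcm:
  assumes "p \<in> carrier P" "q \<in> carrier P" "r \<in> carrier P"
    and eq: "right_ideal p \<inter> right_ideal q = right_ideal r"
  shows "min_common_ext (monoid_category P) p q = {r}"
proof -
  have "y = r" if y: "y \<in> right_ideal r" "r \<in> right_ideal y" for y
  proof -
    have "y \<in> carrier P" using y ideal_subset[OF assms(3)] by blast
    thus ?thesis using ideal_inj ideal_mono assms(3) y by (metis subset_antisym)
  qed
  thus ?thesis unfolding min_common_ext_def extensions_eq eq using ideal_self[OF assms(3)] by blast
qed

lemma exhaustive_iff:
  "finite M \<Longrightarrow> exhaustive (monoid_category P) \<one>\<^bsub>P\<^esub> M \<longleftrightarrow> foundation_set P M"
  by (simp add: exhaustive_def foundation_set_def extensions_eq ideal_one)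

end

context unital_cstar
begin

lemma projection_zero: "projection A \<zero>"
  by (simp add: projection_def)

lemma projection_one: "projection A \<one>"
  by (simp add: projection_def)

lemma is_join_empty_iff: "is_join A {} x \<longleftrightarrow> x = \<zero>"
proof
  assume "is_join A {} x"
  hence "projection A x" "proj_le A x \<zero>" using projection_zero by (auto simp: is_join_def)
  thus "x = \<zero>" by (simp add: proj_le_def projection_def)
qed (auto simp: is_join_def projection_zero proj_le_def projection_def)

text \<open>Two projections below each other are equal, by taking adjoints.\<close>

lemma is_join_singletonD:
  assumes "is_join A {e} x" shows "x = e"
proof -
  have p: "projection A x" "projection A e" "proj_le A e x" using assms by (auto simp: is_join_def)
  hence "proj_le A x e" using assms by (auto simp: is_join_def proj_le_def projection_def)
  hence "x \<otimes> e = x" "e \<otimes> x = e" using p by (auto simp: proj_le_def)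
  moreover have "star A (x \<otimes> e) = e \<otimes> x" using p by (simp add: projection_def star_mult)
  ultimately show ?thesis using p by (simp add: projection_def)
qed

lemma is_join_singleton: "projection A e \<Longrightarrow> is_join A {e} e"
  by (auto simp: is_join_def proj_le_def projection_def)

lemma foldr_complement_absorb:
  assumes "\<And>e. e \<in> set es \<Longrightarrow> e \<in> carrier A \<and> e \<otimes> x = \<zero>" "x \<in> carrier A"
  shows "foldr (\<lambda>e y. (\<one> \<ominus> e) \<otimes> y) es \<one> \<in> carrier A \<and> foldr (\<lambda>e y. (\<one> \<ominus> e) \<otimes> y) es \<one> \<otimes> x = x"
  using assms(1)
proof (induction es)
  case (Cons e es)
  let ?W = "foldr (\<lambda>e y. (\<one> \<ominus> e) \<otimes> y) es \<one>"
  have W: "?W \<in> carrier A" "?W \<otimes> x = x" and e: "e \<in> carrier A" "e \<otimes> x = \<zero>" using Cons by auto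
  have "(\<one> \<ominus> e) \<otimes> ?W \<otimes> x = (\<one> \<ominus> e) \<otimes> x" using W e assms(2) by (simp add: m_assoc)
  also have "\<dots> = x" using e assms(2) by (simp add: minus_distrib_right) (simp add: a_minus_def)
  finally show ?case using W e by simp
qed (use assms(2) in simp)

text \<open>The last part, commutation with whatever commutes with the factors, is what carries the induction.\<close>

lemma foldr_complement:
  assumes "\<And>e. e \<in> set es \<Longrightarrow> projection A e" "\<And>e f. e \<in> set es \<Longrightarrow> f \<in> set es \<Longrightarrow> e \<otimes> f = f \<otimes> e"
  defines "W \<equiv> foldr (\<lambda>e y. (\<one> \<ominus> e) \<otimes> y) es \<one>"
  shows "projection A W \<and> (\<forall>e\<in>set es. e \<otimes> W = \<zero>) \<and>
    (\<forall>f\<in>carrier A. (\<forall>e\<in>set es. e \<otimes> f = f \<otimes> e) \<longrightarrow> W \<otimes> f = f \<otimes> W)"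
  unfolding W_def using assms(1,2)
proof (induction es)
  case (Cons e es)
  let ?W = "foldr (\<lambda>e y. (\<one> \<ominus> e) \<otimes> y) es \<one>"
  have W: "projection A ?W" "\<forall>e\<in>set es. e \<otimes> ?W = \<zero>"
    "\<And>f. f \<in> carrier A \<Longrightarrow> (\<forall>e\<in>set es. e \<otimes> f = f \<otimes> e) \<Longrightarrow> ?W \<otimes> f = f \<otimes> ?W"
    using Cons by auto
  have e: "projection A e" "e \<in> carrier A" "e \<otimes> e = e" using Cons.prems(1)[of e] by (auto simp: projection_def)
  have Wc: "?W \<in> carrier A" "?W \<otimes> ?W = ?W" "star A ?W = ?W" using W(1) by (auto simp: projection_def)
  have comm_minus: "?W \<otimes> (\<one> \<ominus> e) = (\<one> \<ominus> e) \<otimes> ?W"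
    using W(3)[of e] e Wc Cons.prems by (simp add: minus_distrib_left minus_distrib_right)
  note pm = projection_minus[OF e(1)]
  let ?q = "\<one> \<ominus> e"
  have q: "?q \<in> carrier A" "?q \<otimes> ?q = ?q" "star A ?q = ?q" using pm by (auto simp: projection_def)
  have "?q \<otimes> ?W \<otimes> (?q \<otimes> ?W) = ?q \<otimes> (?W \<otimes> ?q) \<otimes> ?W" using q Wc by (simp only: m_assoc m_closed)
  also have "\<dots> = (?q \<otimes> ?q) \<otimes> (?W \<otimes> ?W)" unfolding comm_minus using q(1) Wc(1) by (simp only: m_assoc m_closed)
  finally have 1: "projection A (?q \<otimes> ?W)"
    using q Wc comm_minus by (simp add: projection_def star_mult)
  have 2: "f \<otimes> (?q \<otimes> ?W) = \<zero>" if f: "f \<in> set (e # es)" for f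
  proof (cases "f = e")
    case True
    have "e \<otimes> ?q = \<zero>" using e by (simp add: minus_distrib_left) (simp add: a_minus_def r_neg)
    thus ?thesis using True q Wc e by (simp flip: m_assoc)
  next
    case False
    hence fe: "f \<in> set es" "f \<in> carrier A" using f Cons.prems(1)[of f] by (auto simp: projection_def)
    have "f \<otimes> (?q \<otimes> ?W) = f \<otimes> ?W \<otimes> ?q" using fe q Wc by (simp add: m_assoc flip: comm_minus)
    thus ?thesis using W(2) fe q by simp
  qed
  have 3: "?q \<otimes> ?W \<otimes> f = f \<otimes> (?q \<otimes> ?W)" if f: "f \<in> carrier A" "\<forall>e\<in>set (e # es). e \<otimes> f = f \<otimes> e" for f
  proof -
    have a: "?q \<otimes> f = f \<otimes> ?q" using f e by (simp add: minus_distrib_left minus_distrib_right)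
    have "?W \<otimes> f = f \<otimes> ?W" using W(3)[of f] f by simp
    hence "?q \<otimes> ?W \<otimes> f = ?q \<otimes> f \<otimes> ?W" using f q(1) Wc(1) by (simp only: m_assoc)
    thus ?thesis unfolding a using f q(1) Wc(1) by (simp only: m_assoc)
  qed
  show ?case using 1 2 3 by simp
qed (simp add: projection_one)

end

context right_lcm
begin

text \<open>A criterion that avoids joins: exhaustive sets need only be tested on elements annihilated by
  all the range projections.\<close>

lemma path_unitalI:
  fixes A :: "('a, 'm) cstar_scheme" (structure)
  assumes A: "unital_cstar A"
    and cl: "\<And>p. p \<in> carrier P \<Longrightarrow> \<tau> p \<in> carrier A" and one: "\<tau> \<one>\<^bsub>P\<^esub> = \<one>"
    and iso: "\<And>p. p \<in> carrier P \<Longrightarrow> star A (\<tau> p) \<otimes> \<tau> p = \<one>"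
    and mult: "\<And>p q. p \<in> carrier P \<Longrightarrow> q \<in> carrier P \<Longrightarrow> \<tau> p \<otimes> \<tau> q = \<tau> (p \<otimes>\<^bsub>P\<^esub> q)"
    and disj: "\<And>p q. p \<in> carrier P \<Longrightarrow> q \<in> carrier P \<Longrightarrow> right_ideal p \<inter> right_ideal q = {} \<Longrightarrow>
      \<tau> p \<otimes> star A (\<tau> p) \<otimes> (\<tau> q \<otimes> star A (\<tau> q)) = \<zero>"
    and meet: "\<And>p q r. p \<in> carrier P \<Longrightarrow> q \<in> carrier P \<Longrightarrow> r \<in> carrier P \<Longrightarrow>
      right_ideal p \<inter> right_ideal q = right_ideal r \<Longrightarrow>
      \<tau> p \<otimes> star A (\<tau> p) \<otimes> (\<tau> q \<otimes> star A (\<tau> q)) = \<tau> r \<otimes> star A (\<tau> r)"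
    and found: "\<And>M x. foundation_set P M \<Longrightarrow> x \<in> carrier A \<Longrightarrow>
      (\<And>p. p \<in> M \<Longrightarrow> \<tau> p \<otimes> star A (\<tau> p) \<otimes> x = \<zero>) \<Longrightarrow> x = \<zero>"
  shows "path_unital A \<tau>"
proof -
  interpret A: unital_cstar A by (rule A)
  have proj: "projection A (\<tau> p \<otimes> star A (\<tau> p))" if "p \<in> carrier P" for p
    using A.isometry_range cl iso that by (simp add: isometry_def)
  have simps: "Mor (monoid_category P) = carrier P" "src (monoid_category P) = (\<lambda>_. \<one>\<^bsub>P\<^esub>)"
    "rng (monoid_category P) = (\<lambda>_. \<one>\<^bsub>P\<^esub>)" "cmp (monoid_category P) = mult P"
    "objects (monoid_category P) = {\<one>\<^bsub>P\<^esub>}"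
    by (auto simp: monoid_category_def objects_def)
  have join: "is_join A ((\<lambda>r. \<tau> r \<otimes> star A (\<tau> r)) ` min_common_ext (monoid_category P) p q)
      (\<tau> p \<otimes> star A (\<tau> p) \<otimes> (\<tau> q \<otimes> star A (\<tau> q)))" if pq: "p \<in> carrier P" "q \<in> carrier P" for p q
    using lcm[OF pq]
  proof
    assume "right_ideal p \<inter> right_ideal q = {}"
    thus ?thesis by (simp add: min_common_ext_empty disj[OF pq] A.is_join_empty_iff)
  next
    assume "\<exists>r\<in>carrier P. right_ideal p \<inter> right_ideal q = right_ideal r"
    then obtain r where r: "r \<in> carrier P" "right_ideal p \<inter> right_ideal q = right_ideal r" by blast
    show ?thesis unfolding min_common_ext_lcm[OF pq r] meet[OF pq r]
      using A.is_join_singleton[OF proj[OF r(1)]] by simp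
  qed
  have exh: "is_join A ((\<lambda>r. \<tau> r \<otimes> star A (\<tau> r)) ` M) \<one>" if M: "foundation_set P M" for M
    unfolding is_join_def
  proof (intro conjI ballI allI impI)
    have sub: "M \<subseteq> carrier P" using M by (simp add: foundation_set_def)
    show "projection A \<one>" by (rule A.projection_one)
    show "projection A e" "proj_le A e \<one>" if "e \<in> (\<lambda>r. \<tau> r \<otimes> star A (\<tau> r)) ` M" for e
      using that proj sub by (auto simp: proj_le_def projection_def)
    fix r assume r: "projection A r \<and> (\<forall>q\<in>(\<lambda>r. \<tau> r \<otimes> star A (\<tau> r)) ` M. proj_le A q r)"
    hence rc: "r \<in> carrier A" by (simp add: projection_def)
    have "\<one> \<ominus> r = \<zero>"
    proof (rule found[OF M])
      fix p assume p: "p \<in> M"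
      let ?e = "\<tau> p \<otimes> star A (\<tau> p)"
      have "?e \<otimes> r = ?e" "?e \<in> carrier A" using r p proj[of p] sub by (auto simp: proj_le_def projection_def)
      thus "?e \<otimes> (\<one> \<ominus> r) = \<zero>"
        using rc by (simp add: A.minus_distrib_left) (simp add: a_minus_def A.r_neg)
    qed (use rc in simp)
    hence "\<one> = r" using rc A.eq_iff_minus by simp
    thus "proj_le A \<one> r" using r by (simp add: proj_le_def projection_def)
  qed
  have "monoid A" by unfold_locales
  thus ?thesis unfolding path_unital_def path_relations_def simps
    using cl one iso mult join exh exhaustive_iff by auto
qed

text \<open>If all \<open>e\<^sub>p x = 0\<close> then the product of the complements \<open>1 - e\<^sub>p\<close> fixes \<open>x\<close>; over a foundation set
  this product vanishes, hence so does \<open>x\<close>.\<close>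

lemma boundary_to_path:
  fixes A :: "('a, 'm) cstar_scheme" (structure)
  assumes A: "cstar_algebra A" and g: "boundary_relations P A g"
  shows "path_unital A (\<lambda>p. g (V p))"
proof -
  have "monoid A" using g by (simp add: boundary_relations_def)
  then interpret A: unital_cstar A using A by (simp add: unital_cstar_def)
  have iso: "g (V p) \<in> carrier A" "star A (g (V p)) \<otimes> g (V p) = \<one>" if "p \<in> carrier P" for p
    using g that by (auto simp: boundary_relations_def isometry_def)
  have mult: "g (V p) \<otimes> g (V q) = g (V (p \<otimes>\<^bsub>P\<^esub> q))" if "p \<in> carrier P" "q \<in> carrier P" for p q
    using g that by (auto simp: boundary_relations_def)
  have range: "g (V p) \<otimes> star A (g (V p)) = g (E (right_ideal p))" if p: "p \<in> carrier P" for p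
  proof -
    have "g (V p) \<otimes> g (E (carrier P)) \<otimes> star A (g (V p)) = g (E (right_ideal p))"
      using g p full_ideal unfolding boundary_relations_def by blast
    moreover have "g (E (carrier P)) = \<one>" using g by (simp add: boundary_relations_def)
    ultimately show ?thesis using iso[OF p] by simp
  qed
  have inter: "g (E X) \<otimes> g (E Y) = g (E (X \<inter> Y))" if "X \<in> principal_ideals P" "Y \<in> principal_ideals P" for X Y
    using g that unfolding boundary_relations_def by blast
  have ecar: "g (E X) \<in> carrier A" if "X \<in> principal_ideals P" for X
    using g that by (auto simp: boundary_relations_def projection_def)
  show ?thesis
  proof (rule path_unitalI[OF A.unital_cstar_axioms])
    let ?v = "g (V \<one>\<^bsub>P\<^esub>)"
    have v: "?v \<in> carrier A" "star A ?v \<otimes> ?v = \<one>" "?v \<otimes> ?v = ?v"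
      using iso[of "\<one>\<^bsub>P\<^esub>"] mult[of "\<one>\<^bsub>P\<^esub>" "\<one>\<^bsub>P\<^esub>"] by auto
    have "?v = star A ?v \<otimes> ?v \<otimes> ?v" using v by simp
    also have "\<dots> = star A ?v \<otimes> (?v \<otimes> ?v)" using v(1) by (simp only: A.m_assoc A.star_closed)
    also have "\<dots> = \<one>" by (simp add: v)
    finally show "?v = \<one>" .
  next
    fix p q assume pq: "p \<in> carrier P" "q \<in> carrier P" "right_ideal p \<inter> right_ideal q = {}"
    have "g (E {}) = \<zero>" using g by (simp add: boundary_relations_def)
    thus "g (V p) \<otimes> star A (g (V p)) \<otimes> (g (V q) \<otimes> star A (g (V q))) = \<zero>"
      using pq by (simp add: range inter)
  next
    fix M x assume M: "foundation_set P M" and x: "x \<in> carrier A"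
      and 0: "\<And>p. p \<in> M \<Longrightarrow> g (V p) \<otimes> star A (g (V p)) \<otimes> x = \<zero>"
    have sub: "M \<subseteq> carrier P" and fin: "finite M" using M by (auto simp: foundation_set_def)
    obtain ps where ps: "set ps = M" "distinct ps" using finite_distinct_list[OF fin] by blast
    let ?es = "map (\<lambda>p. g (E (right_ideal p))) ps"
    have "foldr (\<lambda>p x. (\<one> \<ominus> g (E (right_ideal p))) \<otimes> x) ps \<one> = \<zero>"
      using g M ps unfolding boundary_relations_def by blast
    hence "foldr (\<lambda>e y. (\<one> \<ominus> e) \<otimes> y) ?es \<one> = \<zero>"
      by (simp add: foldr_map comp_def)
    moreover have "e \<in> carrier A \<and> e \<otimes> x = \<zero>" if "e \<in> set ?es" for e
    proof -
      obtain p where p: "p \<in> M" "e = g (E (right_ideal p))" using \<open>e \<in> set ?es\<close> ps by auto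
      thus ?thesis using 0[OF p(1)] sub ecar[OF principal_ideal[of p]] by (auto simp: range subset_iff)
    qed
    note A.foldr_complement_absorb[of ?es, OF this x]
    ultimately show "x = \<zero>" using x by simp
  qed (use iso mult in \<open>auto simp: range inter\<close>)
qed

text \<open>The product \<open>W\<close> of the complements over a foundation set is a projection orthogonal to all \<open>e\<^sub>p\<close>, so
  \<open>1 - W\<close> bounds them; as their join is \<open>1\<close>, this forces \<open>W = 0\<close>.\<close>

lemma path_to_boundary:
  fixes A :: "('a, 'm) cstar_scheme" (structure)
  assumes A: "cstar_algebra A" and \<tau>: "path_unital A \<tau>"
  shows "boundary_relations P A (boundary_family A \<tau>)"
proof -
  have mon: "monoid A" and one: "\<tau> \<one>\<^bsub>P\<^esub> = \<one>" and path: "path_relations (monoid_category P) A \<tau>"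
    using \<tau> by (auto simp: path_unital_def)
  interpret A: unital_cstar A using A mon by (simp add: unital_cstar_def)
  have simps: "Mor (monoid_category P) = carrier P" "src (monoid_category P) = (\<lambda>_. \<one>\<^bsub>P\<^esub>)"
    "rng (monoid_category P) = (\<lambda>_. \<one>\<^bsub>P\<^esub>)" "cmp (monoid_category P) = mult P"
    "objects (monoid_category P) = {\<one>\<^bsub>P\<^esub>}"
    by (auto simp: monoid_category_def objects_def)
  note rel = path[unfolded path_relations_def simps]
  have cl [simp]: "\<tau> p \<in> carrier A" if "p \<in> carrier P" for p using rel that by blast
  have iso: "star A (\<tau> p) \<otimes> \<tau> p = \<one>" if "p \<in> carrier P" for p using rel that one by simp
  have mult: "\<tau> p \<otimes> \<tau> q = \<tau> (p \<otimes>\<^bsub>P\<^esub> q)" if "p \<in> carrier P" "q \<in> carrier P" for p q using rel that by simp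
  define e where "e p = \<tau> p \<otimes> star A (\<tau> p)" for p
  have proj: "projection A (e p)" if "p \<in> carrier P" for p
    unfolding e_def using A.isometry_range cl iso that by (simp add: isometry_def)
  have ec [simp]: "e p \<in> carrier A" if "p \<in> carrier P" for p using proj[OF that] by (simp add: projection_def)
  have join: "is_join A (e ` min_common_ext (monoid_category P) p q) (e p \<otimes> e q)"
    if "p \<in> carrier P" "q \<in> carrier P" for p q using rel that by (simp add: e_def[abs_def])
  have disj: "e p \<otimes> e q = \<zero>" if "p \<in> carrier P" "q \<in> carrier P"
    "right_ideal p \<inter> right_ideal q = {}" for p q
    using join[OF that(1,2)] min_common_ext_empty[OF that(3)] by (simp add: A.is_join_empty_iff)
  have meet: "e p \<otimes> e q = e r" if "p \<in> carrier P" "q \<in> carrier P" "r \<in> carrier P"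
    "right_ideal p \<inter> right_ideal q = right_ideal r" for p q r
    using join[OF that(1,2)] min_common_ext_lcm[OF that] A.is_join_singletonD by simp
  have comm: "e p \<otimes> e q = e q \<otimes> e p" if pq: "p \<in> carrier P" "q \<in> carrier P" for p q
    using lcm[OF pq] disj[OF pq] disj[OF pq(2,1)] meet[OF pq] meet[OF pq(2,1)] by (metis Int_commute)
  let ?g = "boundary_family A \<tau>"
  have gE: "?g (E (right_ideal p)) = e p" if "p \<in> carrier P" for p using that by (simp add: e_def)
  show ?thesis unfolding boundary_relations_def
  proof (intro conjI ballI allI impI)
    show "monoid A" by (rule mon)
    show "isometry A (?g (V p))" if "p \<in> carrier P" for p using that iso by (simp add: isometry_def)
    show "projection A (?g (E X))" if "X \<in> principal_ideals P" for X
      using that by (cases rule: principal_ideals_cases) (simp_all add: A.projection_zero gE proj del: boundary_family_E)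
    show "?g (V p) \<otimes> ?g (V q) = ?g (V (p \<otimes>\<^bsub>P\<^esub> q))" if "p \<in> carrier P" "q \<in> carrier P" for p q
      using that mult by simp
    show "?g (V p) \<otimes> ?g (E X) \<otimes> star A (?g (V p)) = ?g (E (p <#\<^bsub>P\<^esub> X))"
      if p: "p \<in> carrier P" and "X \<in> principal_ideals P" for p X
      using that(2)
    proof (cases rule: principal_ideals_cases)
      case 1
      thus ?thesis using p by (simp add: l_coset_def A.star_closed)
    next
      case (2 q)
      thus ?thesis using p mult[OF p 2(1)]
        by (simp add: ideal_coset A.star_mult A.m_assoc A.star_closed flip: mult)
    qed
    show "?g (E (carrier P)) = \<one>" using gE[OF P.one_closed] one by (simp add: ideal_one e_def)
    show "?g (E {}) = \<zero>" by simp
    show "?g (E X) \<otimes> ?g (E Y) = ?g (E (X \<inter> Y))" if X: "X \<in> principal_ideals P" and Y: "Y \<in> principal_ideals P" for X Y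
      using X
    proof (cases rule: principal_ideals_cases)
      case 1
      note X1 = 1
      show ?thesis using Y by (cases rule: principal_ideals_cases) (simp_all add: X1 gE del: boundary_family_E)
    next
      case (2 p)
      note p = 2
      show ?thesis using Y
      proof (cases rule: principal_ideals_cases)
        case 1
        thus ?thesis using p by (simp add: gE del: boundary_family_E)
      next
        case (2 q)
        show ?thesis using lcm[OF p(1) 2(1)]
        proof
          assume "right_ideal p \<inter> right_ideal q = {}"
          thus ?thesis using p 2 disj by (simp add: gE del: boundary_family_E)
        next
          assume "\<exists>r\<in>carrier P. right_ideal p \<inter> right_ideal q = right_ideal r"
          thus ?thesis using p 2 meet by (auto simp add: gE simp del: boundary_family_E)
        qed
      qed
    qed
    fix ps assume ps: "distinct ps \<and> foundation_set P (set ps)"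
    hence sub: "set ps \<subseteq> carrier P" by (simp add: foundation_set_def)
    define W where "W = foldr (\<lambda>x y. (\<one> \<ominus> x) \<otimes> y) (map e ps) \<one>"
    have W: "projection A W" "\<forall>p\<in>set ps. e p \<otimes> W = \<zero>"
      using A.foldr_complement[of "map e ps"] proj comm sub by (auto simp: W_def subset_iff)
    have Wc: "W \<in> carrier A" using W(1) by (simp add: projection_def)
    have "is_join A (e ` set ps) \<one>"
      using rel ps exhaustive_iff[of "set ps"] one by (simp add: e_def[abs_def])
    moreover have "proj_le A (e p) (\<one> \<ominus> W)" if "p \<in> set ps" for p
      using W(2) that sub Wc by (auto simp: proj_le_def A.minus_distrib_left subset_iff) (simp add: a_minus_def)
    ultimately have "proj_le A \<one> (\<one> \<ominus> W)"
      using A.projection_minus[OF W(1)] unfolding is_join_def by blast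
    hence "\<one> \<ominus> W = \<one>" using Wc by (simp add: proj_le_def)
    hence "W \<oplus> (\<one> \<ominus> W) = W \<oplus> \<one>" by simp
    hence "\<one> = W \<oplus> \<one>" using Wc by (simp add: a_minus_def A.a_lcomm A.r_neg)
    hence "W = \<zero>" using Wc by (simp add: A.add.l_cancel_one')
    moreover have "foldr (\<lambda>p x. (\<one> \<ominus> ?g (E (right_ideal p))) \<otimes> x) qs \<one> =
        foldr (\<lambda>x y. (\<one> \<ominus> x) \<otimes> y) (map e qs) \<one>" if "set qs \<subseteq> carrier P" for qs
      using that by (induction qs) (simp_all add: gE del: boundary_family_E)
    ultimately show "foldr (\<lambda>p x. (\<one> \<ominus> ?g (E (right_ideal p))) \<otimes> x) ps \<one> = \<zero>"
      using sub by (simp add: W_def)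
  qed
qed

text \<open>Joins are not equational, but the equivalent boundary relations are.\<close>

lemma reflect_path:
  fixes A :: "('a, 'm) cstar_scheme" (structure)
  assumes J: "jointly_faithful A (carrier P) \<tau> \<Theta>"
    and R: "\<And>B h \<phi>. (B, h, \<phi>) \<in> \<Theta> \<Longrightarrow> path_unital B h"
  shows "path_unital A \<tau>"
proof -
  interpret A: cstar_algebra A by (rule jointly_faithfulD(1)[OF J])
  let ?\<Theta> = "(\<lambda>(B, h, \<phi>). (B, boundary_family B h, \<phi>)) ` \<Theta>"
  have cl: "\<tau> p \<in> carrier A" if "p \<in> carrier P" for p using jointly_faithfulD(2)[OF J that] .
  have fam: "boundary_family A \<tau> x \<in> carrier A" if "x \<in> boundary_gens P" for x
    using that by (auto simp: boundary_gens_def cl A.mult_closed A.star_closed elim!: principal_ideals_cases)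
  have phi: "\<phi> (boundary_family A \<tau> x) = boundary_family B h x"
    if th: "(B, h, \<phi>) \<in> \<Theta>" and x: "x \<in> boundary_gens P" for B h \<phi> x
    using x star_hom_zero[OF jointly_faithfulD(1)[OF J] jointly_faithfulD(3,4)[OF J th]]
    by (auto simp: boundary_gens_def cl A.mult_closed A.star_closed star_homD[OF jointly_faithfulD(4)[OF J th]]
        jointly_faithfulD(5)[OF J th] elim!: principal_ideals_cases)
  have J': "jointly_faithful A (boundary_gens P) (boundary_family A \<tau>) ?\<Theta>"
    using J fam phi unfolding jointly_faithful_def by auto
  have "boundary_relations P A (boundary_family A \<tau>)"
  proof (rule reflect_boundary[OF J'])
    fix B h' \<phi> assume "(B, h', \<phi>) \<in> ?\<Theta>"
    then obtain h where th: "(B, h, \<phi>) \<in> \<Theta>" "h' = boundary_family B h" by auto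
    show "boundary_relations P B h'"
      unfolding th(2) by (rule path_to_boundary[OF jointly_faithfulD(3)[OF J th(1)] R[OF th(1)]])
  qed
  from boundary_to_path[OF A.cstar_algebra_axioms this] show ?thesis by simp
qed

end

section \<open>The relations of the Baumslag--Solitar monoid\<close>

context unital_cstar
begin

text \<open>For orthogonal projections, inclusion-exclusion has only the linear terms.\<close>

lemma foldr_complement_orthogonal:
  assumes "distinct ps" "\<And>p. p \<in> set ps \<Longrightarrow> e p \<in> carrier A"
    and "\<And>p q. p \<in> set ps \<Longrightarrow> q \<in> set ps \<Longrightarrow> p \<noteq> q \<Longrightarrow> e p \<otimes> e q = \<zero>"
  shows "foldr (\<lambda>p x. (\<one> \<ominus> e p) \<otimes> x) ps \<one> = \<one> \<ominus> (\<Oplus>p\<in>set ps. e p)"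
  using assms
proof (induction ps)
  case Nil
  thus ?case by (simp add: a_minus_def)
next
  case (Cons p ps)
  let ?s = "\<Oplus>q\<in>set ps. e q"
  have e: "e p \<in> carrier A" "?s \<in> carrier A" using Cons.prems by (auto intro!: finsum_closed)
  have "e p \<otimes> ?s = (\<Oplus>q\<in>set ps. e p \<otimes> e q)" using Cons.prems e by (intro finsum_rdistr) auto
  also have "\<dots> = (\<Oplus>q\<in>set ps. \<zero>)"
    using Cons.prems by (intro finsum_cong') auto
  finally have 0: "e p \<otimes> ?s = \<zero>" by simp
  have "foldr (\<lambda>p x. (\<one> \<ominus> e p) \<otimes> x) (p # ps) \<one> = (\<one> \<ominus> e p) \<otimes> (\<one> \<ominus> ?s)" using Cons by simp
  also have "\<dots> = \<one> \<ominus> e p \<ominus> (?s \<ominus> \<zero>)" using e 0 by (simp add: minus_distrib_left minus_distrib_right)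
  also have "\<dots> = \<one> \<ominus> (e p \<oplus> ?s)" using e by (simp add: a_minus_def minus_add a_ac)
  also have "e p \<oplus> ?s = (\<Oplus>q\<in>set (p # ps). e q)" using Cons.prems e by (simp add: Pi_iff)
  finally show ?case .
qed

end

context bs
begin

lemma ideal_inter:
  assumes "p \<in> carrier P" "q \<in> carrier P" "right_ideal p \<inter> right_ideal q \<noteq> {}"
  shows "(\<exists>z. digits z \<and> dig q = dig p @ z) \<or> (\<exists>z. digits z \<and> dig p = dig q @ z)"
proof -
  obtain v m where p: "digits v" "p = mk v m" using assms(1) by (rule mk_cases)
  obtain w n where q: "digits w" "q = mk w n" using assms(2) by (rule mk_cases)
  obtain x where x: "x \<in> right_ideal (mk v m)" "x \<in> right_ideal (mk w n)"
    using assms(3) p q by auto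
  obtain y k where 1: "digits y" "x = mk (v @ shift m y) (carry m y + k)"
    using x(1) p(1) by (auto simp: mem_ideal_iff)
  obtain y' k' where 2: "digits y'" "x = mk (w @ shift n y') (carry n y' + k')"
    using x(2) q(1) by (auto simp: mem_ideal_iff)
  have "v @ shift m y = w @ shift n y'"
    using 1 2 p q mk_inject[of "v @ shift m y" "w @ shift n y'"] by auto
  then obtain z where "v = w @ z \<or> w = v @ z" by (auto simp: append_eq_append_conv2)
  thus ?thesis using p q by (auto simp: coord_mk)
qed

lemma ideal_inter_ne:
  assumes "digits v" "digits z"
  shows "right_ideal (mk v m) \<inter> right_ideal (mk (v @ z) n) \<noteq> {}"
proof -
  obtain r where r: "r \<in> carrier P"
    "right_ideal (mk v m) \<inter> right_ideal (mk (v @ z) n) = right_ideal r"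
    using ideal_inter_prefix[OF assms] by blast
  have "r \<otimes>\<^bsub>P\<^esub> \<one>\<^bsub>P\<^esub> \<in> right_ideal r" unfolding l_coset_def using self.one_closed by blast
  thus ?thesis unfolding r(2) by blast
qed

lemma ideal_lcm:
  assumes "p \<in> carrier P" "q \<in> carrier P"
  shows "right_ideal p \<inter> right_ideal q = {} \<or>
    (\<exists>r\<in>carrier P. right_ideal p \<inter> right_ideal q = right_ideal r \<and>
      (dig r = dig q \<and> (\<exists>z. dig q = dig p @ z) \<or> dig r = dig p \<and> (\<exists>z. dig p = dig q @ z)))"
proof (cases "right_ideal p \<inter> right_ideal q = {}")
  case False
  note mk = mk_coord[OF assms(1)] mk_coord[OF assms(2)]
  from ideal_inter[OF assms False] show ?thesis
  proof
    assume "\<exists>z. digits z \<and> dig q = dig p @ z"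
    then obtain z where z: "digits z" "dig q = dig p @ z" by blast
    show ?thesis using ideal_inter_prefix[OF digits_dig[OF assms(1)] z(1), of "cnt p" "cnt q"] z mk by auto
  next
    assume "\<exists>z. digits z \<and> dig p = dig q @ z"
    then obtain z where z: "digits z" "dig p = dig q @ z" by blast
    show ?thesis using ideal_inter_prefix[OF digits_dig[OF assms(2)] z(1), of "cnt q" "cnt p"] z mk
      by (auto simp: Int_commute)
  qed
qed simp

sublocale lcm: right_lcm P
  using ideal_lcm ideal_eqD by unfold_locales blast+

definition "gen_b = mk [] 1"
definition "gen_x i = mk [i] 0"

lemma gens_closed [simp]: "gen_b \<in> carrier P" "gen_x i \<in> carrier P"
  by (simp_all add: gen_b_def gen_x_def)

lemma gen_b_mult_x: "Suc i < d \<Longrightarrow> gen_b \<otimes>\<^bsub>P\<^esub> gen_x i = gen_x (Suc i)"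
  by (simp add: gen_b_def gen_x_def mk_mult)

lemma gen_b_mult_last: "gen_b \<otimes>\<^bsub>P\<^esub> gen_x (d - 1) = gen_x 0 \<otimes>\<^bsub>P\<^esub> mk [] c"
  using d_pos by (simp add: gen_b_def gen_x_def mk_mult)

text \<open>The empty digit string of \<open>b\<close> is a prefix of every other; and every digit string is either empty
  or begins with the digit of some \<open>b\<^sup>i a\<close>.\<close>

lemma foundation_b: "foundation_set P {gen_b}"
proof -
  have "right_ideal p \<inter> right_ideal gen_b \<noteq> {}" if p: "p \<in> carrier P" for p
    using ideal_inter_ne[of "[]" "dig p" 1 "cnt p"] mk_coord[OF p] digits_dig[OF p]
    by (simp add: gen_b_def Int_commute)
  thus ?thesis by (simp add: foundation_set_def)
qed

lemma foundation_x: "foundation_set P (gen_x ` {..<d})"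
proof -
  have "\<exists>q\<in>gen_x ` {..<d}. right_ideal p \<inter> right_ideal q \<noteq> {}" if p: "p \<in> carrier P" for p
  proof (cases "dig p")
    case Nil
    thus ?thesis using ideal_inter_ne[of "[]" "[0]" "cnt p" 0] mk_coord[OF p] d_pos
      by (auto simp: gen_x_def)
  next
    case (Cons i v)
    have "digits (i # v)" using digits_dig[OF p] Cons by simp
    thus ?thesis using ideal_inter_ne[of "[i]" v 0 "cnt p"] mk_coord[OF p] Cons
      by (auto simp: gen_x_def Int_commute)
  qed
  thus ?thesis by (auto simp: foundation_set_def)
qed

definition st_family :: "((bs_letter \<times> bool) list set boundary_gen \<Rightarrow> 'a) \<Rightarrow> st_gen \<Rightarrow> 'a" where
  "st_family g x = (case x of S \<Rightarrow> g (V gen_b) | T i \<Rightarrow> g (V (gen_x (i - 1))))"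

lemma st_family_simps [simp]: "st_family g S = g (V gen_b)" "st_family g (T i) = g (V (gen_x (i - 1)))"
  by (simp_all add: st_family_def)

text \<open>Unitarity of \<open>s\<close> and the Cuntz relation come from the two foundation sets above; the digit strings
  of \<open>b\<^sup>i a\<close> and \<open>b\<^sup>j a\<close> are incomparable for \<open>i \<noteq> j\<close>, which gives orthogonality.\<close>

lemma boundary_to_st:
  fixes A :: "('a, 'm) cstar_scheme" (structure)
  assumes A: "cstar_algebra A" and g: "boundary_relations P A g"
  shows "st_relations c d A (st_family g)"
proof -
  have "monoid A" using g by (simp add: boundary_relations_def)
  then interpret A: unital_cstar A using A by (simp add: unital_cstar_def)
  have iso: "isometry A (g (V p))" if "p \<in> carrier P" for p
    using g that by (auto simp: boundary_relations_def)
  have cl [simp]: "g (V p) \<in> carrier A" if "p \<in> carrier P" for p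
    using iso[OF that] by (simp add: isometry_def)
  have mult: "g (V p) \<otimes> g (V q) = g (V (p \<otimes>\<^bsub>P\<^esub> q))" if "p \<in> carrier P" "q \<in> carrier P" for p q
    using g that by (auto simp: boundary_relations_def)
  have one: "g (V \<one>\<^bsub>P\<^esub>) = \<one>"
    using lcm.boundary_to_path[OF A g] by (simp add: lcm.path_unital_def)
  have ecl: "g (E (right_ideal p)) \<in> carrier A" if "p \<in> carrier P" for p
    using g lcm.principal_ideal[OF that] unfolding boundary_relations_def projection_def by blast
  have range: "g (V p) \<otimes> star A (g (V p)) = g (E (right_ideal p))" if p: "p \<in> carrier P" for p
  proof -
    have "g (V p) \<otimes> g (E (carrier P)) \<otimes> star A (g (V p)) = g (E (right_ideal p))"
      using g p lcm.full_ideal unfolding boundary_relations_def by blast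
    moreover have "g (E (carrier P)) = \<one>" using g by (simp add: boundary_relations_def)
    ultimately show ?thesis using p by simp
  qed
  have found: "foldr (\<lambda>p x. (\<one> \<ominus> g (E (right_ideal p))) \<otimes> x) ps \<one> = \<zero>"
    if "distinct ps" "foundation_set P (set ps)" for ps
    using g that unfolding boundary_relations_def by blast
  have "\<one> \<ominus> g (E (right_ideal gen_b)) = \<zero>"
    using found[of "[gen_b]"] foundation_b ecl[of gen_b] by simp
  hence eb: "g (E (right_ideal gen_b)) = \<one>"
    using A.eq_iff_minus[of "\<one>", OF _ ecl[of gen_b]] by simp
  define ps where "ps = map gen_x [0..<d]"
  have inj: "inj_on gen_x {..<d}" by (rule inj_onI) (simp add: gen_x_def mk_inject)
  have ps: "distinct ps" "set ps = gen_x ` {..<d}"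
    using inj by (simp_all add: ps_def distinct_map atLeast0LessThan)
  have orth: "g (E (right_ideal p)) \<otimes> g (E (right_ideal q)) = \<zero>"
    if pq: "p \<in> set ps" "q \<in> set ps" "p \<noteq> q" for p q
  proof -
    obtain i j where ij: "i < d" "j < d" "p = gen_x i" "q = gen_x j" using pq ps by auto
    have "right_ideal p \<inter> right_ideal q = {}"
    proof (rule ccontr)
      assume "\<not> ?thesis"
      from ideal_inter[OF _ _ this] ij have "[j] = [i]" by (auto simp: gen_x_def coord_mk)
      thus False using ij pq by simp
    qed
    moreover have "g (E (right_ideal p)) \<otimes> g (E (right_ideal q)) =
        g (E (right_ideal p \<inter> right_ideal q))"
      using g lcm.principal_ideal ij gens_closed unfolding boundary_relations_def by blast
    moreover have "g (E {}) = \<zero>" using g by (simp add: boundary_relations_def)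
    ultimately show ?thesis by simp
  qed
  have "\<one> \<ominus> (\<Oplus>p\<in>set ps. g (E (right_ideal p))) = \<zero>"
  proof -
    have "g (E (right_ideal p)) \<in> carrier A" if "p \<in> set ps" for p using that ps ecl by auto
    from A.foldr_complement_orthogonal[OF ps(1) this orth] show ?thesis
      using found[OF ps(1)] foundation_x ps(2) by simp
  qed
  moreover have "(\<Oplus>p\<in>set ps. g (E (right_ideal p))) \<in> carrier A"
    using ecl ps by (intro A.finsum_closed) auto
  ultimately have sum: "(\<Oplus>p\<in>set ps. g (E (right_ideal p))) = \<one>"
    using A.eq_iff_minus[OF A.one_closed] by (metis (no_types, lifting))
  have bij: "set ps = (\<lambda>i. gen_x (i - 1)) ` {1..d}" "inj_on (\<lambda>i. gen_x (i - 1)) {1..d}"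
  proof -
    have "{..<d} = (\<lambda>i. i - 1) ` {1..d}" by (force simp: image_iff intro: bexI[of _ "Suc _"])
    thus "set ps = (\<lambda>i. gen_x (i - 1)) ` {1..d}" by (simp add: ps image_image)
    show "inj_on (\<lambda>i. gen_x (i - 1)) {1..d}"
    proof (rule inj_onI)
      fix i j assume ij: "i \<in> {1..d}" "j \<in> {1..d}" "gen_x (i - 1) = gen_x (j - 1)"
      hence "i - 1 \<in> {..<d}" "j - 1 \<in> {..<d}" using d_pos by auto
      hence "i - 1 = j - 1" using inj_onD[OF inj ij(3)] by simp
      thus "i = j" using ij by auto
    qed
  qed
  have "(\<Oplus>i\<in>{1..d}. g (V (gen_x (i - 1))) \<otimes> star A (g (V (gen_x (i - 1))))) =
      (\<Oplus>i\<in>{1..d}. g (E (right_ideal (gen_x (i - 1)))))"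
    by (simp add: range)
  also have "\<dots> = (\<Oplus>p\<in>set ps. g (E (right_ideal p)))"
    unfolding bij(1) using bij(2) ecl by (subst A.add.finprod_reindex) auto
  finally have sumt: "(\<Oplus>i\<in>{1..d}. g (V (gen_x (i - 1))) \<otimes> star A (g (V (gen_x (i - 1))))) = \<one>"
    by (simp add: sum)
  have pow: "g (V gen_b) [^] n = g (V (mk [] n))" for n :: nat
  proof (induction n)
    case 0
    thus ?case using one by (simp add: one_P)
  next
    case (Suc n)
    have "mk [] n \<otimes>\<^bsub>P\<^esub> gen_b = mk [] (Suc n)" by (simp add: gen_b_def mk_mult)
    thus ?case using Suc by (simp add: mult)
  qed
  show ?thesis unfolding st_relations_def unitary_def
  proof (intro conjI ballI allI impI)
    show "monoid A" by unfold_locales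
    show "star A (st_family g S) \<otimes> st_family g S = \<one>" using iso[of gen_b] by (simp add: isometry_def)
    show "st_family g S \<otimes> star A (st_family g S) = \<one>" using range[of gen_b] eb by simp
    show "isometry A (st_family g (T i))" for i using iso by simp
    show "(\<Oplus>i\<in>{1..d}. st_family g (T i) \<otimes> star A (st_family g (T i))) = \<one>" using sumt by simp
    show "st_family g S \<otimes> st_family g (T i) = st_family g (T (i + 1))" if "1 \<le> i \<and> i < d" for i
      using that gen_b_mult_x[of "i - 1"] by (simp add: mult)
    show "st_family g S \<otimes> st_family g (T d) = st_family g (T 1) \<otimes> st_family g S [^] c"
      by (simp add: mult pow gen_b_mult_last[simplified])
  qed simp
qed

end

text \<open>Conversely, a solution of the relations for \<open>s\<close> and \<open>t\<^sub>i\<close> gives a value to each positive word,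
  hence to each element of the monoid.\<close>

locale st_solution = bs c d + unital_cstar A for c d and A :: "('a, 'm) cstar_scheme" (structure) +
  fixes h :: "st_gen \<Rightarrow> 'a"
  assumes st: "st_relations c d A h"
begin

lemma s_closed [simp]: "h S \<in> carrier A" "star A (h S) \<in> carrier A"
  and s_unitary: "star A (h S) \<otimes> h S = \<one>" "h S \<otimes> star A (h S) = \<one>"
  using st by (auto simp: st_relations_def unitary_def star_closed)

lemma t_isometry: "i \<in> {1..d} \<Longrightarrow> isometry A (h (T i))"
  using st by (auto simp: st_relations_def)

lemma t_closed [simp]: "1 \<le> i \<Longrightarrow> i \<le> d \<Longrightarrow> h (T i) \<in> carrier A" "1 \<le> i \<Longrightarrow> i \<le> d \<Longrightarrow> star A (h (T i)) \<in> carrier A"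
  using t_isometry[of i] by (auto simp: isometry_def star_closed)

lemma t_sum: "(\<Oplus>i\<in>{1..d}. h (T i) \<otimes> star A (h (T i))) = \<one>"
  using st by (simp add: st_relations_def)

lemma t_orthogonal: "\<lbrakk>i \<in> {1..d}; j \<in> {1..d}; i \<noteq> j\<rbrakk> \<Longrightarrow> star A (h (T i)) \<otimes> h (T j) = \<zero>"
  using isometries_orthogonal[OF _ t_isometry t_sum] by simp

lemma t_shift: "i < d \<Longrightarrow> h S [^] i \<otimes> h (T 1) = h (T (Suc i))"
proof (induction i)
  case (Suc i)
  have "h S [^] Suc i \<otimes> h (T 1) = h S \<otimes> (h S [^] i \<otimes> h (T 1))"
    using Suc.prems nat_pow_Suc2[of "h S" i] by (simp add: m_assoc)
  also have "\<dots> = h (T (Suc (Suc i)))" using Suc st by (simp add: st_relations_def)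
  finally show ?case .
qed simp

lemma st_relation: "h (T 1) \<otimes> h S [^] c = h S [^] d \<otimes> h (T 1)"
proof -
  obtain e where e: "d = Suc e" using d_pos by (cases d) auto
  have "h S [^] d \<otimes> h (T 1) = h S \<otimes> (h S [^] e \<otimes> h (T 1))"
    using nat_pow_Suc2[of "h S" e] by (simp add: e m_assoc)
  also have "\<dots> = h S \<otimes> h (T d)" using t_shift[of e] e by simp
  also have "\<dots> = h (T 1) \<otimes> h S [^] c" using st by (simp add: st_relations_def)
  finally show ?thesis by simp
qed

sublocale sol: bs_solution c d A "h (T (Suc 0))" "h S"
  by unfold_locales (use d_pos st_relation in auto)

definition vfam :: "(bs_letter \<times> bool) list set \<Rightarrow> 'a" where
  "vfam p = sol.val (rep (coord p))"

lemma vfam_elt: "vfam (elt u) = sol.val u"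
  by (simp add: vfam_def coord_elt flip: sol.val_nf)

lemma vfam_closed [simp]: "vfam p \<in> carrier A"
  by (simp add: vfam_def)

lemma vfam_mult: "p \<in> carrier P \<Longrightarrow> q \<in> carrier P \<Longrightarrow> vfam p \<otimes> vfam q = vfam (p \<otimes>\<^bsub>P\<^esub> q)"
  by (auto simp: carrier_P vfam_elt elt_append sol.val_append)

lemma vfam_one: "vfam \<one>\<^bsub>P\<^esub> = \<one>"
  by (simp add: elt_Nil vfam_elt)

lemma vfam_gen_b: "vfam gen_b = h S"
  by (simp add: gen_b_def mk_def vfam_elt rep_def sol.lval_def)

lemma vfam_gen_x: "i < d \<Longrightarrow> vfam (gen_x i) = h (T (Suc i))"
  using t_shift[of i] by (simp add: gen_x_def mk_def vfam_elt rep_def sol.val_append sol.val_replicate_b sol.lval_def)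

text \<open>The isometry of a digit string is the product of the corresponding \<open>t\<^sub>i\<close>.\<close>

definition f :: "nat list \<Rightarrow> 'a" where "f w = vfam (mk w 0)"

lemma f_closed [simp]: "f w \<in> carrier A" "star A (f w) \<in> carrier A"
  by (simp_all add: f_def star_closed)

lemma f_Nil: "f [] = \<one>"
  using vfam_one by (simp add: f_def one_P)

lemma f_append: "digits v \<Longrightarrow> digits w \<Longrightarrow> f (v @ w) = f v \<otimes> f w"
  by (simp add: f_def vfam_mult mk_mult shift_zero)

lemma f_single: "i < d \<Longrightarrow> f [i] = h (T (Suc i))"
  using vfam_gen_x by (simp add: f_def gen_x_def)

lemma vfam_isometry: "p \<in> carrier P \<Longrightarrow> star A (vfam p) \<otimes> vfam p = \<one>"
proof -
  have l: "star A (sol.lval x) \<otimes> sol.lval x = \<one>" "star A (sol.lval x) \<in> carrier A" for x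
    using s_unitary t_isometry[of 1] d_pos by (auto simp: sol.lval_def isometry_def star_closed split: bs_letter.split)
  have "star A (sol.val u) \<otimes> sol.val u = \<one>" for u
  proof (induction u)
    case (Cons x u)
    have "star A (sol.val (x # u)) \<otimes> sol.val (x # u) = star A (sol.val u) \<otimes> (star A (sol.lval x) \<otimes> sol.lval x) \<otimes> sol.val u"
      by (simp add: star_mult star_closed m_assoc)
    thus ?case using Cons l by (simp add: star_closed)
  qed simp
  moreover assume "p \<in> carrier P"
  ultimately show ?thesis by (auto simp: carrier_P vfam_elt)
qed

text \<open>The powers of the unitary \<open>s\<close> cancel in range projections, which therefore depend only on the
  digits.\<close>

lemma vfam_range: assumes "p \<in> carrier P" shows "vfam p \<otimes> star A (vfam p) = f (dig p) \<otimes> star A (f (dig p))"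
proof -
  have pw: "h S [^] n \<otimes> star A (h S [^] n) = \<one>" for n :: nat
  proof (induction n)
    case (Suc n)
    have c: "h S [^] n \<in> carrier A" "star A (h S [^] n) \<in> carrier A" by (simp_all add: star_closed)
    have "h S [^] Suc n \<otimes> star A (h S [^] Suc n) = h S [^] n \<otimes> (h S \<otimes> star A (h S)) \<otimes> star A (h S [^] n)"
      using c by (simp add: star_mult m_assoc)
    thus ?case using Suc c s_unitary by simp
  qed simp
  obtain w n where p: "digits w" "p = mk w n" using assms by (rule mk_cases)
  have "mk w 0 \<otimes>\<^bsub>P\<^esub> mk [] n = mk w n" using p by (simp add: mk_mult)
  hence "vfam p = f w \<otimes> vfam (mk [] n)" using p by (simp add: f_def vfam_mult)
  also have "vfam (mk [] n) = h S [^] n"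
    by (simp add: mk_def vfam_elt rep_def sol.val_replicate_b del: foldr_replicate)
  finally have "vfam p \<otimes> star A (vfam p) = f w \<otimes> (h S [^] n \<otimes> star A (h S [^] n)) \<otimes> star A (f w)"
    by (simp add: star_mult m_assoc star_closed)
  thus ?thesis using p pw by (simp add: coord_mk)
qed

lemma f_isometry: "star A (f w) \<otimes> f w = \<one>"
  by (simp add: f_def vfam_isometry)

lemma f_prefix:
  assumes "digits v" "digits z"
  shows "f v \<otimes> star A (f v) \<otimes> (f (v @ z) \<otimes> star A (f (v @ z))) = f (v @ z) \<otimes> star A (f (v @ z))"
    "f (v @ z) \<otimes> star A (f (v @ z)) \<otimes> (f v \<otimes> star A (f v)) = f (v @ z) \<otimes> star A (f (v @ z))"
proof -
  have "f v \<otimes> star A (f v) \<otimes> (f (v @ z) \<otimes> star A (f (v @ z))) =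
      f v \<otimes> (star A (f v) \<otimes> f v) \<otimes> (f z \<otimes> star A (f (v @ z)))"
    using assms by (simp add: f_append star_mult star_closed m_assoc)
  thus "f v \<otimes> star A (f v) \<otimes> (f (v @ z) \<otimes> star A (f (v @ z))) = f (v @ z) \<otimes> star A (f (v @ z))"
    using assms by (simp add: f_isometry f_append star_mult star_closed m_assoc)
  have "f (v @ z) \<otimes> star A (f (v @ z)) \<otimes> (f v \<otimes> star A (f v)) =
      f (v @ z) \<otimes> star A (f z) \<otimes> (star A (f v) \<otimes> f v) \<otimes> star A (f v)"
    using assms by (simp add: f_append star_mult star_closed m_assoc)
  thus "f (v @ z) \<otimes> star A (f (v @ z)) \<otimes> (f v \<otimes> star A (f v)) = f (v @ z) \<otimes> star A (f (v @ z))"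
    using assms by (simp add: f_isometry f_append star_mult star_closed m_assoc)
qed

lemma f_orthogonal:
  assumes "digits v" "digits w" "\<nexists>z. w = v @ z" "\<nexists>z. v = w @ z"
  shows "star A (f v) \<otimes> f w = \<zero>"
  using assms
proof (induction v arbitrary: w)
  case (Cons i v)
  then obtain j w' where w: "w = j # w'" by (cases w) auto
  have ij: "i < d" "j < d" "digits v" "digits w'" using Cons.prems w by auto
  have "f (i # v) = f [i] \<otimes> f v" "f (j # w') = f [j] \<otimes> f w'"
    using f_append[of "[i]" v] f_append[of "[j]" w'] ij by simp_all
  hence eq: "star A (f (i # v)) \<otimes> f w = star A (f v) \<otimes> (star A (f [i]) \<otimes> f [j]) \<otimes> f w'"
    by (simp add: w star_mult m_assoc)
  show ?case
  proof (cases "i = j")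
    case True
    hence "star A (f (i # v)) \<otimes> f w = star A (f v) \<otimes> f w'" unfolding eq by (simp add: f_isometry)
    thus ?thesis using Cons True ij by (simp add: w)
  next
    case False
    thus ?thesis unfolding eq using ij t_orthogonal[of "Suc i" "Suc j"] by (simp add: f_single)
  qed
qed auto

text \<open>The range projections of the digit strings of a fixed length sum to one, by iterating
  \<open>\<Sum> t\<^sub>i t\<^sub>i\<^sup>* = 1\<close>; stated as separation to avoid sums over strings.\<close>

lemma f_total:
  assumes "x \<in> carrier A" "\<And>w. digits w \<Longrightarrow> length w = n \<Longrightarrow> star A (f w) \<otimes> x = \<zero>"
  shows "x = \<zero>"
  using assms(2)
proof (induction n)
  case 0
  from 0[of "[]"] show ?case using assms(1) by (simp add: f_Nil)
next
  case (Suc n)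
  show ?case
  proof (rule Suc.IH)
    fix w assume w: "digits w" "length w = n"
    let ?y = "star A (f w) \<otimes> x"
    have y: "?y \<in> carrier A" using assms(1) by simp
    have 0: "h (T i) \<otimes> star A (h (T i)) \<otimes> ?y = \<zero>" if i: "i \<in> {1..d}" for i
    proof -
      have "star A (f (w @ [i - 1])) \<otimes> x = \<zero>" using i w by (intro Suc.prems) auto
      moreover have "f (w @ [i - 1]) = f w \<otimes> h (T i)" using w i f_append[of w "[i - 1]"] f_single[of "i - 1"] by auto
      ultimately have "star A (h (T i)) \<otimes> ?y = \<zero>" using i assms(1) by (simp add: star_mult m_assoc)
      thus ?thesis using i y by (simp add: m_assoc)
    qed
    have "?y = (\<Oplus>i\<in>{1..d}. h (T i) \<otimes> star A (h (T i))) \<otimes> ?y" using y by (simp only: t_sum l_one)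
    also have "\<dots> = (\<Oplus>i\<in>{1..d}. h (T i) \<otimes> star A (h (T i)) \<otimes> ?y)"
      using y by (intro finsum_ldistr) auto
    also have "\<dots> = (\<Oplus>i\<in>{1..d}. \<zero>)" using 0 by (intro finsum_cong') auto
    finally show "?y = \<zero>" by simp
  qed
qed

text \<open>For a foundation set choose a length not exceeded by its digit strings. A string \<open>w\<close> of this length
  extends the digits of a member \<open>p\<close>, so that \<open>e\<^sub>p\<close> fixes the isometry of \<open>w\<close>; hence what the \<open>e\<^sub>p\<close> annihilate
  is annihilated by the adjoints of the isometries of all strings of this length, and is zero.\<close>

lemma vfam_path_unital: "lcm.path_unital A vfam"
proof (rule lcm.path_unitalI[OF unital_cstar_axioms])
  fix p q assume pq: "p \<in> carrier P" "q \<in> carrier P"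
  note dg = digits_dig[OF pq(1)] digits_dig[OF pq(2)]
  {
    assume dis: "right_ideal p \<inter> right_ideal q = {}"
    have "\<nexists>z. dig q = dig p @ z"
    proof
      assume "\<exists>z. dig q = dig p @ z"
      then obtain z where z: "dig q = dig p @ z" by blast
      hence "digits z" using dg by simp
      thus False using ideal_inter_ne[OF dg(1), of z "cnt p" "cnt q"] z dis mk_coord[OF pq(1)] mk_coord[OF pq(2)] by simp
    qed
    moreover have "\<nexists>z. dig p = dig q @ z"
    proof
      assume "\<exists>z. dig p = dig q @ z"
      then obtain z where z: "dig p = dig q @ z" by blast
      hence "digits z" using dg by simp
      thus False using ideal_inter_ne[OF dg(2), of z "cnt q" "cnt p"] z dis mk_coord[OF pq(1)] mk_coord[OF pq(2)]
        by (simp add: Int_commute)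
    qed
    ultimately have "star A (f (dig p)) \<otimes> f (dig q) = \<zero>" by (intro f_orthogonal dg)
    hence "f (dig p) \<otimes> (star A (f (dig p)) \<otimes> f (dig q)) \<otimes> star A (f (dig q)) = \<zero>" by simp
    thus "vfam p \<otimes> star A (vfam p) \<otimes> (vfam q \<otimes> star A (vfam q)) = \<zero>"
      by (simp add: vfam_range pq m_assoc)
  next
    fix r assume r: "r \<in> carrier P" "right_ideal p \<inter> right_ideal q = right_ideal r"
    have ne: "right_ideal r \<noteq> {}" using lcm.ideal_self[OF r(1)] by blast
    from ideal_lcm[OF pq] r ne obtain r' where r': "r' \<in> carrier P"
      "right_ideal r = right_ideal r'"
      "dig r' = dig q \<and> (\<exists>z. dig q = dig p @ z) \<or> dig r' = dig p \<and> (\<exists>z. dig p = dig q @ z)" by auto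
    have "r = r'" using ideal_eqD[OF r(1) r'(1,2)] .
    with r'(3) show "vfam p \<otimes> star A (vfam p) \<otimes> (vfam q \<otimes> star A (vfam q)) = vfam r \<otimes> star A (vfam r)"
      using dg by (auto simp: vfam_range pq r'(1) f_prefix)
  }
next
  fix M x assume M: "foundation_set P M" and x: "x \<in> carrier A"
    and 0: "\<And>p. p \<in> M \<Longrightarrow> vfam p \<otimes> star A (vfam p) \<otimes> x = \<zero>"
  have sub: "M \<subseteq> carrier P" and fin: "finite M" using M by (auto simp: foundation_set_def)
  define n where "n = (\<Sum>p\<in>M. length (dig p))"
  have len: "length (dig p) \<le> n" if "p \<in> M" for p
    unfolding n_def using fin that by (intro member_le_sum) auto
  show "x = \<zero>"
  proof (rule f_total[OF x])
    fix w assume w: "digits w" "length w = n"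
    obtain p where p: "p \<in> M" "right_ideal (mk w 0) \<inter> right_ideal p \<noteq> {}"
      using M w unfolding foundation_set_def by (metis mk_closed)
    have pP: "p \<in> carrier P" using p sub by blast
    have "(\<exists>z. digits z \<and> dig p = w @ z) \<or> (\<exists>z. digits z \<and> w = dig p @ z)"
      using ideal_inter[OF mk_closed pP p(2)] w by (simp add: coord_mk)
    then obtain z where z: "digits z" "w = dig p @ z"
    proof
      assume "\<exists>z. digits z \<and> dig p = w @ z"
      then obtain z where "dig p = w @ z" by blast
      thus thesis using len[OF p(1)] w that[of "[]"] by simp
    qed blast
    have "f w = vfam p \<otimes> star A (vfam p) \<otimes> f w"
    proof -
      have "vfam p \<otimes> star A (vfam p) \<otimes> f w = f (dig p) \<otimes> (star A (f (dig p)) \<otimes> f (dig p)) \<otimes> f z"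
        using z digits_dig[OF pP] by (simp add: vfam_range pP f_append m_assoc)
      thus ?thesis using z digits_dig[OF pP] by (simp add: f_isometry f_append)
    qed
    hence "star A (f w) = star A (vfam p \<otimes> star A (vfam p) \<otimes> f w)" by simp
    also have "\<dots> = star A (f w) \<otimes> (vfam p \<otimes> star A (vfam p))"
      by (simp add: star_mult star_star star_closed m_assoc)
    finally have "star A (f w) \<otimes> x = star A (f w) \<otimes> (vfam p \<otimes> star A (vfam p)) \<otimes> x" by simp
    also have "\<dots> = star A (f w) \<otimes> (vfam p \<otimes> star A (vfam p) \<otimes> x)"
      using x by (simp add: m_assoc star_closed)
    also have "\<dots> = \<zero>" using 0[OF p(1)] by simp
    finally show "star A (f w) \<otimes> x = \<zero>" .
  qed
qed (use vfam_one vfam_isometry vfam_mult in auto)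

end

section \<open>The three universal algebras\<close>

lemma presentation_st:
  assumes "0 < d" shows "presentation (st_gens d) (st_relations c d)"
proof (rule presentation.intro, goal_cases)
  case (1 p \<Theta>)
  show ?case by (rule reflect_st[OF 1(1) _ assms]) (rule 1(2))
next
  case (2 p)
  thus ?case by (simp add: st_relations_def)
next
  case (3 p g)
  interpret seminormed "st_gens d" p using 3(1) by (simp add: seminormed_def)
  interpret K: unital_cstar K
    using 3(2) cstar_algebra_completion by (simp add: unital_cstar_def st_relations_def)
  have "isometry K (completion_gen (st_gens d) p g)"
    using 3(2,3) by (auto simp: st_relations_def st_gens_def unitary_def isometry_def)
  thus ?case by (rule K.nrm_isometry)
qed

context right_lcm
begin

lemma presentation_boundary: "presentation (boundary_gens P) (boundary_relations P)"
proof (rule presentation.intro, goal_cases)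
  case (1 p \<Theta>)
  show ?case by (rule reflect_boundary[OF 1(1)]) (rule 1(2))
next
  case (2 p)
  thus ?case by (simp add: boundary_relations_def)
next
  case (3 p g)
  interpret seminormed "boundary_gens P" p using 3(1) by (simp add: seminormed_def)
  interpret K: unital_cstar K
    using 3(2) cstar_algebra_completion by (simp add: unital_cstar_def boundary_relations_def)
  have "isometry K (completion_gen (boundary_gens P) p g) \<or> projection K (completion_gen (boundary_gens P) p g)"
    using 3(2,3) by (auto simp: boundary_relations_def boundary_gens_def)
  thus ?case using K.nrm_isometry K.nrm_projection by blast
qed

lemma presentation_path: "presentation (carrier P) path_unital"
proof (rule presentation.intro, goal_cases)
  case (1 p \<Theta>)
  show ?case by (rule reflect_path[OF 1(1)]) (rule 1(2))
next
  case (2 p)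
  thus ?case by (simp add: path_unital_def)
next
  case (3 p g)
  interpret seminormed "carrier P" p using 3(1) by (simp add: seminormed_def)
  interpret K: unital_cstar K
    using 3(2) cstar_algebra_completion by (simp add: unital_cstar_def path_unital_def)
  have "boundary_relations P K (boundary_family K (completion_gen (carrier P) p))"
    by (rule path_to_boundary[OF cstar_algebra_completion 3(2)])
  hence "isometry K (completion_gen (carrier P) p g)" using 3(3) by (auto simp: boundary_relations_def)
  thus ?case by (rule K.nrm_isometry)
qed

text \<open>The identity morphism acts as a unit on all generators, hence on the C*-algebra they generate.\<close>

lemma path_relations_completion:
  assumes p: "cstar_seminorm (carrier P) p"
    and R: "path_relations (monoid_category P) (completion (carrier P) p) (completion_gen (carrier P) p)"
  shows "path_unital (completion (carrier P) p) (completion_gen (carrier P) p)"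
proof -
  interpret seminormed "carrier P" p using p by (simp add: seminormed_def)
  interpret K: cstar_algebra K by (rule cstar_algebra_completion)
  let ?\<tau> = "completion_gen (carrier P) p"
  have cl: "?\<tau> q \<in> carrier K" if "q \<in> carrier P" for q by (rule completion_gen_closed[OF that])
  have iso: "star K (?\<tau> q) \<otimes>\<^bsub>K\<^esub> ?\<tau> q = ?\<tau> \<one>\<^bsub>P\<^esub>" if "q \<in> carrier P" for q
    using R that by (simp add: path_relations_def monoid_category_def)
  have mult: "?\<tau> q \<otimes>\<^bsub>K\<^esub> ?\<tau> r = ?\<tau> (q \<otimes>\<^bsub>P\<^esub> r)" if "q \<in> carrier P" "r \<in> carrier P" for q r
    using R that by (simp add: path_relations_def monoid_category_def)
  define u where "u = ?\<tau> \<one>\<^bsub>P\<^esub>"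
  have u: "u \<in> carrier K" using cl by (simp add: u_def)
  have us: "star K u = u"
    using iso[of "\<one>\<^bsub>P\<^esub>"] K.star_mult[of "star K u" u] u by (simp add: u_def K.star_star K.star_closed)
  let ?H = "{x \<in> carrier K. u \<otimes>\<^bsub>K\<^esub> x = x \<and> x \<otimes>\<^bsub>K\<^esub> u = x}"
  have Hlim: "x \<in> ?H" if X: "\<forall>n. X n \<in> ?H" "(\<lambda>n. nrm K (X n \<ominus>\<^bsub>K\<^esub> x)) \<longlonglongrightarrow> 0" and x: "x \<in> carrier K" for X x
  proof -
    have l: "K.lim_to X x" using X x by (simp add: K.lim_to_def)
    have "(\<lambda>n. u \<otimes>\<^bsub>K\<^esub> X n) = X" "(\<lambda>n. X n \<otimes>\<^bsub>K\<^esub> u) = X" using X(1) by auto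
    hence lim: "K.lim_to X (u \<otimes>\<^bsub>K\<^esub> x)" "K.lim_to X (x \<otimes>\<^bsub>K\<^esub> u)"
      using K.lim_to_mult[OF K.lim_to_const[OF u] l] K.lim_to_mult[OF l K.lim_to_const[OF u]] by simp_all
    thus ?thesis using K.lim_to_unique[OF lim(1) l] K.lim_to_unique[OF lim(2) l] x by simp
  qed
  have Hstar: "star K x \<in> ?H" if x: "x \<in> ?H" for x
  proof -
    have xc: "x \<in> carrier K" using x by simp
    have "star K (x \<otimes>\<^bsub>K\<^esub> u) = star K x" "star K (u \<otimes>\<^bsub>K\<^esub> x) = star K x" using x by simp_all
    hence "u \<otimes>\<^bsub>K\<^esub> star K x = star K x" "star K x \<otimes>\<^bsub>K\<^esub> u = star K x"
      using u us xc by (simp_all add: K.star_mult)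
    thus ?thesis using xc by (simp add: K.star_closed)
  qed
  have Hmult: "x \<otimes>\<^bsub>K\<^esub> y \<in> ?H" if x: "x \<in> ?H" "y \<in> ?H" for x y
    using x u K.mult_assoc[of u x y] K.mult_assoc[of x y u] by (simp add: K.mult_closed)
  have Hadd: "x \<oplus>\<^bsub>K\<^esub> y \<in> ?H" if x: "x \<in> ?H" "y \<in> ?H" for x y
    using x u by (simp add: K.distrib_left K.distrib_right)
  have Hscale: "scale K k x \<in> ?H" if x: "x \<in> ?H" for x k
    using x u by (simp add: K.scale_mult_left K.scale_mult_right K.scale_closed)
  have sub: "cstar_subalgebra ?H K"
    unfolding cstar_subalgebra_def
  proof (intro conjI allI ballI impI)
    show "?H \<subseteq> carrier K" by blast
    show "\<zero>\<^bsub>K\<^esub> \<in> ?H" using u by simp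
    fix X x assume "x \<in> carrier K" "(\<forall>n. X n \<in> ?H) \<and> (\<lambda>n. nrm K (X n \<ominus>\<^bsub>K\<^esub> x)) \<longlonglongrightarrow> 0"
    thus "x \<in> ?H" using Hlim[of X x] by blast
  qed (rule Hadd Hmult Hscale Hstar; assumption)+
  have "?\<tau> ` carrier P \<subseteq> ?H" using cl mult by (auto simp: u_def)
  hence H: "?H = carrier K" using generates_completion sub unfolding generates_cstar_def by blast
  have "\<one>\<^bsub>K\<^esub> = u" "monoid K"
    using unit_determined_monoid[OF cstar_algebra_completion unit_determined_completion u] H by blast+
  thus ?thesis using R by (simp add: path_unital_def u_def)
qed

lemma path_cstar_eq: "path_cstar (monoid_category P) = universal_cstar (carrier P) path_unital"
proof -
  have "{p. cstar_seminorm (carrier P) p \<and>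
        path_relations (monoid_category P) (completion (carrier P) p) (completion_gen (carrier P) p)} =
      {p. cstar_seminorm (carrier P) p \<and> path_unital (completion (carrier P) p) (completion_gen (carrier P) p)}"
    using path_relations_completion by (auto simp: path_unital_def)
  hence "universal_norm (carrier P) (path_relations (monoid_category P)) = universal_norm (carrier P) path_unital"
    by (simp add: universal_norm_def fun_eq_iff)
  moreover have "Mor (monoid_category P) = carrier P" by (simp add: monoid_category_def)
  ultimately show ?thesis by (simp add: path_cstar_def universal_cstar_def)
qed

text \<open>Suppose that \<open>W\<close> has a family \<open>v\<close> with the path relations and a homomorphism \<open>\<psi>\<close> to the boundary
  quotient that carries \<open>v\<close> to the canonical isometries. Universality gives \<open>\<phi>\<close> in the other direction, and
  \<open>\<psi> \<circ> \<phi>\<close> is the identity since \<open>v\<^sub>p v\<^sub>p\<^sup>*\<close> is the projection of \<open>pP\<close>. So only \<open>\<phi> \<circ> \<psi>\<close> has to be checked on generators.\<close>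

lemma boundary_quotient_isoI:
  fixes W :: "(nat \<Rightarrow> 'g star_poly) set cstar"
  defines "Q \<equiv> boundary_quotient P" and "vQ \<equiv> \<lambda>p. presentation.gen (boundary_gens P) (boundary_relations P) (V p)"
  assumes W: "cstar_algebra W" and v: "path_unital W v" and gen: "generates_cstar M W"
    and psi: "contractive W Q \<psi>" "\<And>p. p \<in> carrier P \<Longrightarrow> \<psi> (v p) = vQ p"
    and home: "\<And>\<phi> x. contractive Q W \<phi> \<Longrightarrow> (\<And>p. p \<in> carrier P \<Longrightarrow> \<phi> (vQ p) = v p) \<Longrightarrow> x \<in> M \<Longrightarrow> \<phi> (\<psi> x) = x"
  obtains \<phi> where "contractive Q W \<phi>" "\<And>p. p \<in> carrier P \<Longrightarrow> \<phi> (vQ p) = v p"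
    "cstar_isomorphic Q W" "carrier Q \<subseteq> \<psi> ` carrier W"
proof -
  interpret Q: presentation "boundary_gens P" "boundary_relations P" by (rule presentation_boundary)
  have Q: "Q = Q.U" by (simp add: Q_def boundary_quotient_def)
  note QA = Q.universal_cstar_algebra[folded Q] and rel = Q.universal_relations[folded Q]
  interpret W: unital_cstar W using W v by (simp add: unital_cstar_def path_unital_def)
  interpret QU: unital_cstar Q using QA Q.universal_monoid by (simp add: unital_cstar_def Q)
  let ?fam = "boundary_family W v"
  have fam: "boundary_relations P W ?fam" by (rule path_to_boundary[OF W v])
  have famc: "?fam ` boundary_gens P \<subseteq> carrier W"
    using fam by (auto simp: boundary_relations_def boundary_gens_def isometry_def projection_def)
  obtain \<phi> where phi: "contractive Q W \<phi>" "\<forall>x\<in>boundary_gens P. \<phi> (Q.gen x) = ?fam x"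
    using Q.universal_property[OF W W.monoid_axioms famc] reflect_boundary fam unfolding Q by blast
  have phv: "\<phi> (vQ p) = v p" if "p \<in> carrier P" for p
    using phi(2) that by (simp add: boundary_gens_def vQ_def)
  have ph: "\<phi> \<in> star_hom Q W" and ps: "\<psi> \<in> star_hom W Q" using phi psi by (auto simp: contractive_def)
  have vc: "v p \<in> carrier W" if "p \<in> carrier P" for p
    using v that by (auto simp: path_unital_def path_relations_def monoid_category_def)
  have inv1: "\<psi> (\<phi> y) = y" if y: "y \<in> Q.gen ` boundary_gens P" for y
  proof -
    obtain x where x: "x \<in> boundary_gens P" "y = Q.gen x" using y by blast
    from x(1) consider p where "p \<in> carrier P" "x = V p" | "x = E {}" | p where "p \<in> carrier P" "x = E (right_ideal p)"
      by (auto simp: boundary_gens_def elim!: principal_ideals_cases)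
    thus ?thesis
    proof cases
      case 1
      thus ?thesis using phv psi x by (simp add: vQ_def)
    next
      case 2
      have "Q.gen (E {}) = \<zero>\<^bsub>Q\<^esub>" using rel by (simp add: boundary_relations_def)
      thus ?thesis using x 2 star_hom_zero[OF W QA ps] star_hom_zero[OF QA W ph] by simp
    next
      case 3
      have "Q.gen (V p) \<otimes>\<^bsub>Q\<^esub> Q.gen (E (carrier P)) \<otimes>\<^bsub>Q\<^esub> star Q (Q.gen (V p)) = Q.gen (E (right_ideal p))"
        using rel 3 full_ideal unfolding boundary_relations_def by blast
      moreover have "Q.gen (E (carrier P)) = \<one>\<^bsub>Q\<^esub>" "Q.gen (V p) \<in> carrier Q"
        using rel 3 by (auto simp: boundary_relations_def isometry_def)
      ultimately have "Q.gen (V p) \<otimes>\<^bsub>Q\<^esub> star Q (Q.gen (V p)) = Q.gen (E (right_ideal p))" by simp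
      thus ?thesis using phi psi x 3 vc[OF 3(1)] by (simp add: star_homD[OF ps] W.star_closed vQ_def)
    qed
  qed
  note inverse = mutually_inverse_on_generators[OF QA W phi(1) psi(1) Q.generates_universal[folded Q] gen
      inv1 home[OF phi(1) phv]]
  have "carrier Q \<subseteq> \<psi> ` carrier W"
    using inverse(1) star_homD(1)[OF ph] by (metis image_eqI subsetI)
  thus thesis using that phi(1) phv inverse(3) by blast
qed

theorem boundary_quotient_iso_path_cstar:
  "cstar_isomorphic (boundary_quotient P) (path_cstar (monoid_category P))"
proof -
  interpret Q: presentation "boundary_gens P" "boundary_relations P" by (rule presentation_boundary)
  interpret L: presentation "carrier P" path_unital by (rule presentation_path)
  have Q: "boundary_quotient P = Q.U" by (simp add: boundary_quotient_def)
  let ?v = "\<lambda>p. Q.gen (V p)"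
  have path: "path_unital Q.U ?v"
    by (rule boundary_to_path[OF Q.universal_cstar_algebra Q.universal_relations])
  have vc: "?v ` carrier P \<subseteq> carrier Q.U"
    using Q.universal_relations by (auto simp: boundary_relations_def isometry_def)
  obtain \<psi> where psi: "contractive L.U Q.U \<psi>" "\<forall>p\<in>carrier P. \<psi> (L.gen p) = ?v p"
    using L.universal_property[OF Q.universal_cstar_algebra Q.universal_monoid vc] reflect_path path by blast
  show ?thesis unfolding path_cstar_eq
    by (rule boundary_quotient_isoI[OF L.universal_cstar_algebra L.universal_relations L.generates_universal])
      (use psi in \<open>auto simp: Q\<close>)
qed

end

text \<open>The two homomorphisms are inverse to each other because a positive word is determined by its letters,
  and \<open>t\<^sub>i = s\<^sup>i\<^sup>-\<^sup>1 t\<^sub>1\<close>.\<close>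

lemma (in bs) boundary_quotient_st:
  defines "Q \<equiv> boundary_quotient P" and "W \<equiv> universal_cstar (st_gens d) (st_relations c d)"
    and "w \<equiv> presentation.gen (st_gens d) (st_relations c d)"
  obtains g \<phi> where "cstar_algebra Q" "cstar_isomorphic Q W" "contractive Q W \<phi>"
    "st_relations c d Q g" "generates_cstar (g ` st_gens d) Q" "\<forall>x\<in>st_gens d. \<phi> (g x) = w x"
proof -
  interpret Q: presentation "boundary_gens P" "boundary_relations P" by (rule lcm.presentation_boundary)
  interpret W: presentation "st_gens d" "st_relations c d" by (rule presentation_st[OF d_pos])
  note QA = Q.universal_cstar_algebra and WA = W.universal_cstar_algebra
  have QW: "boundary_quotient P = Q.U" "Q = Q.U" "W = W.U" "w = W.gen"
    by (simp_all add: Q_def W_def w_def boundary_quotient_def)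
  interpret WU: unital_cstar W.U using WA W.universal_monoid by (simp add: unital_cstar_def)
  interpret sol: st_solution c d W.U W.gen
    by unfold_locales (rule W.universal_relations)
  define g where "g = st_family Q.gen"
  have st: "st_relations c d Q.U g" unfolding g_def by (rule boundary_to_st[OF QA Q.universal_relations])
  have gc: "g ` st_gens d \<subseteq> carrier Q.U"
    using st by (auto simp: st_relations_def st_gens_def unitary_def isometry_def)
  obtain \<psi> where psi: "contractive W.U Q.U \<psi>" "\<forall>x\<in>st_gens d. \<psi> (W.gen x) = g x"
    using W.universal_property[OF QA Q.universal_monoid gc] reflect_st[OF _ _ d_pos] st by blast
  have ps: "\<psi> \<in> star_hom W.U Q.U" using psi by (simp add: contractive_def)
  have vmult: "Q.gen (V p) \<otimes>\<^bsub>Q.U\<^esub> Q.gen (V q) = Q.gen (V (p \<otimes>\<^bsub>P\<^esub> q))" if "p \<in> carrier P" "q \<in> carrier P" for p q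
    using Q.universal_relations that by (auto simp: boundary_relations_def)
  have vone: "Q.gen (V \<one>\<^bsub>P\<^esub>) = \<one>\<^bsub>Q.U\<^esub>"
    using lcm.boundary_to_path[OF QA Q.universal_relations] by (simp add: lcm.path_unital_def)
  have S: "S \<in> st_gens d" "T 1 \<in> st_gens d" using d_pos by (auto simp: st_gens_def)
  have psS: "\<psi> (W.gen S) = Q.gen (V gen_b)" and psT: "\<psi> (W.gen (T 1)) = Q.gen (V (gen_x 0))"
    using psi(2) S by (auto simp: g_def)
  have psone: "\<psi> \<one>\<^bsub>W.U\<^esub> = \<one>\<^bsub>Q.U\<^esub>"
  proof -
    have "\<psi> (star W.U (W.gen S) \<otimes>\<^bsub>W.U\<^esub> W.gen S) = star Q.U (g S) \<otimes>\<^bsub>Q.U\<^esub> g S"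
      using psi(2) S sol.s_closed by (simp add: star_homD[OF ps])
    thus ?thesis using sol.s_unitary st by (simp add: st_relations_def unitary_def)
  qed
  have psval: "\<psi> (sol.sol.val u) = Q.gen (V (elt u))" for u
  proof (induction u)
    case Nil
    show ?case using psone vone by (simp add: elt_Nil)
  next
    case (Cons x u)
    have "\<psi> (sol.sol.lval x) = Q.gen (V (elt [x]))"
      using psS psT by (simp add: sol.sol.lval_def gen_b_def gen_x_def mk_def rep_def split: bs_letter.split)
    hence "\<psi> (sol.sol.val (x # u)) = Q.gen (V (elt [x])) \<otimes>\<^bsub>Q.U\<^esub> Q.gen (V (elt u))"
      using Cons by (simp add: star_homD[OF ps])
    thus ?case by (simp add: vmult carrier_P elt_append)
  qed
  have psv: "\<psi> (sol.vfam p) = Q.gen (V p)" if "p \<in> carrier P" for p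
    using that psval by (auto simp: carrier_P sol.vfam_elt)
  have phg: "\<phi> (g x) = W.gen x" if "\<And>p. p \<in> carrier P \<Longrightarrow> \<phi> (Q.gen (V p)) = sol.vfam p" "x \<in> st_gens d" for \<phi> x
    using that sol.vfam_gen_b sol.vfam_gen_x by (auto simp: st_gens_def g_def)
  obtain \<phi> where phi: "contractive Q.U W.U \<phi>" "\<And>p. p \<in> carrier P \<Longrightarrow> \<phi> (Q.gen (V p)) = sol.vfam p"
    "cstar_isomorphic Q.U W.U" "carrier Q.U \<subseteq> \<psi> ` carrier W.U"
  proof (rule lcm.boundary_quotient_isoI[OF WA sol.vfam_path_unital W.generates_universal, unfolded QW(1)])
    show "contractive W.U Q.U \<psi>" by (rule psi(1))
    show "\<psi> (sol.vfam p) = Q.gen (V p)" if "p \<in> carrier P" for p by (rule psv[OF that])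
    show "\<phi> (\<psi> y) = y" if "\<And>p. p \<in> carrier P \<Longrightarrow> \<phi> (Q.gen (V p)) = sol.vfam p" "y \<in> W.gen ` st_gens d" for \<phi> y
      using phg[OF that(1)] psi(2) that(2) by auto
  qed blast
  have "generates_cstar (\<psi> ` W.gen ` st_gens d) Q.U"
    by (rule generates_cstar_image[OF QA WA psi(1) W.generates_universal phi(4)])
  moreover have "\<psi> ` W.gen ` st_gens d = g ` st_gens d" using psi(2) by (auto simp: image_iff)
  ultimately show thesis
    using that[of \<phi> g] QA phi(1,3) st phg[OF phi(2)] by (simp add: QW)
qed

theorem proposition6p1:
  fixes c d :: nat
  assumes "0 < c" and "0 < d"
  shows "cstar_algebra (boundary_quotient (BS_plus c d)) \<and>
    cstar_isomorphic (boundary_quotient (BS_plus c d))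
      (universal_cstar (st_gens d) (st_relations c d)) \<and>
    (\<exists>g. st_relations c d (boundary_quotient (BS_plus c d)) g \<and>
       generates_cstar (g ` st_gens d) (boundary_quotient (BS_plus c d)) \<and>
       (\<forall>(B :: 'b cstar) h. cstar_algebra B \<and> st_relations c d B h \<longrightarrow>
          (\<exists>\<phi>\<in>star_hom (boundary_quotient (BS_plus c d)) B. \<forall>x\<in>st_gens d. \<phi> (g x) = h x))) \<and>
    cstar_isomorphic (boundary_quotient (BS_plus c d))
      (path_cstar (monoid_category (BS_plus c d)))"
proof -
  interpret bs c d using assms by unfold_locales
  interpret W: presentation "st_gens d" "st_relations c d" by (rule presentation_st[OF d_pos])
  obtain g \<phi> where Q: "cstar_algebra (boundary_quotient P)" "cstar_isomorphic (boundary_quotient P) W.U"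
    "contractive (boundary_quotient P) W.U \<phi>" "st_relations c d (boundary_quotient P) g"
    "generates_cstar (g ` st_gens d) (boundary_quotient P)" "\<forall>x\<in>st_gens d. \<phi> (g x) = W.gen x"
    by (rule boundary_quotient_st)
  have "\<exists>\<chi>\<in>star_hom (boundary_quotient P) B. \<forall>x\<in>st_gens d. \<chi> (g x) = h x"
    if B: "cstar_algebra B" "st_relations c d B h" for B :: "'b cstar" and h
  proof -
    have M: "monoid B" and hc: "h ` st_gens d \<subseteq> carrier B"
      using B(2) by (auto simp: st_relations_def st_gens_def unitary_def isometry_def)
    obtain \<theta> where "contractive W.U B \<theta>" "\<forall>x\<in>st_gens d. \<theta> (W.gen x) = h x"
      using W.universal_property[OF B(1) M hc] reflect_st[OF _ _ d_pos] B(2) by blast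
    hence "\<theta> \<circ> \<phi> \<in> star_hom (boundary_quotient P) B" "\<forall>x\<in>st_gens d. (\<theta> \<circ> \<phi>) (g x) = h x"
      using star_hom_comp[of \<phi> _ _ \<theta>] Q(3,6) by (auto simp: contractive_def)
    thus ?thesis by blast
  qed
  thus ?thesis using Q lcm.boundary_quotient_iso_path_cstar by blast
qed

end
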